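(* Let $z$ be a point with $d(z,\mathcal{M})<C\sigma$ and projection $z^*$ onto $\mathcal{M}$. Let $\widehat\Pi^\perp_{z^*}$ be an orthogonal projection (estimator of $\Pi^\perp_{z^*}$) satisfying $\|\widehat\Pi^\perp_{z^*}-\Pi^\perp_{z^*}\|_F\le c\sigma^\kappa$, and $\widehat\Pi^-_{z^*}=I_D-\widehat\Pi^\perp_{z^*}$. Let $r_1=c\sigma$, $r_2=C\sigma\sqrt{\log(1/\sigma)}$, and $$\widehat{\mathbb{V}}_z=\{w\in\mathbb{R}^D:\ \|\widehat\Pi^-_{z^*}(w-z)\|_2\le r_1,\ \|\widehat\Pi^\perp_{z^*}(w-z)\|_2\le r_2\}.$$ Define $\widehat\mu_z^{\mathbb{V}}=z+\widehat\Pi^\perp_{z^*}\mathbb{E}_{Y\sim\nu}(Y-z\mid Y\in\widehat{\mathbb{V}}_z)$. Then $d(\widehat\mu_z^{\mathbb{V}},\mathcal{M})\le C\sigma^{1+\kappa}\sqrt{\log(1/\sigma)}$ for some constant $C$.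
   Context: Model: $\mathcal{M}\subset\mathbb{R}^D$ is a compact, twice-differentiable, $d$-dimensional embedded submanifold with $d$-dimensional Hausdorff volume at most $V$ and reach at least $\tau>0$. $X$ is uniform on $\mathcal{M}$, $\xi\sim N(0,\sigma^2I_D)$ independent, and $Y=X+\xi$ has density $\nu$. $z^*=\arg\min_{x\in\mathcal{M}}\|x-z\|_2$; $\Pi^\perp_x$ is the orthogonal projection onto the normal space of $\mathcal{M}$ at $x$; $\|\cdot\|_F$ is the Frobenius norm. $\sigma$ is sufficiently small; $c<1$, $C>1$ are constants independent of $\sigma$.
   Formalization: The exponent κ is restricted to 0 < κ ≤ 1 (for κ > 1 a curvature bias of order σ², e.g. for a circle, makes the claim false), the constant C in r_2 is required to be sufficiently large, and M is assumed nonempty. *)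

theory Defs
  imports "HOL-Analysis.Analysis"
begin

text \<open>The intrinsic dimension d is encoded by a finite type 'd (d = CARD('d)); the
ambient space R^D is real^'D.  A chart of M around p is a homeomorphism phi from an
open set U of R^d onto a relatively open neighbourhood M \<inter> W of p in M, which is
twice differentiable with an injective (rank d) differential J u (a D x d matrix).\<close>

definition is_chart :: "('d::finite) itself \<Rightarrow> (real^('D::finite)) set \<Rightarrow> (real^'d) set
    \<Rightarrow> (real^'d \<Rightarrow> real^'D) \<Rightarrow> (real^'d \<Rightarrow> real^'d^'D) \<Rightarrow> (real^('D::finite)) set \<Rightarrow> bool" where
  "is_chart _ M U \<phi> J W \<longleftrightarrow>
     open U \<and> open W \<and> \<phi> ` U = M \<inter> W \<and> inj_on \<phi> U \<and>
     continuous_on (M \<inter> W) (inv_into U \<phi>) \<and>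
     (\<forall>u\<in>U. (\<phi> has_derivative (\<lambda>h. J u *v h)) (at u)) \<and>
     (\<forall>u\<in>U. J differentiable (at u)) \<and>
     (\<forall>u\<in>U. rank (J u) = CARD('d))"

definition C2_submanifold :: "('d::finite) itself \<Rightarrow> (real^('D::finite)) set \<Rightarrow> bool" where
  "C2_submanifold T M \<longleftrightarrow>
     (\<forall>p\<in>M. \<exists>U \<phi> J W. is_chart T M U \<phi> J W \<and> p \<in> W)"

definition tangent_space :: "('d::finite) itself \<Rightarrow> (real^('D::finite)) set \<Rightarrow> real^'D \<Rightarrow> (real^'D) set" where
  "tangent_space T M x =
     {v. \<exists>U \<phi> J W u. is_chart T M U \<phi> J W \<and> u \<in> U \<and> \<phi> u = x \<and> v \<in> range (\<lambda>h. J u *v h)}"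

definition orth_proj :: "real^'D^'D \<Rightarrow> bool" where
  "orth_proj P \<longleftrightarrow> P ** P = P \<and> transpose P = P"

definition normal_proj :: "('d::finite) itself \<Rightarrow> (real^('D::finite)) set \<Rightarrow> real^'D \<Rightarrow> real^'D^'D" where
  "normal_proj T M x =
     (THE P. orth_proj P \<and> range (\<lambda>v. P *v v) = orthogonal_comp (tangent_space T M x))"

definition frob_norm :: "real^'n^'m \<Rightarrow> real" where
  "frob_norm A = sqrt (\<Sum>i\<in>UNIV. \<Sum>j\<in>UNIV. (A $ i $ j)^2)"

definition reach_ge :: "(real^('D::finite)) set \<Rightarrow> real \<Rightarrow> bool" where
  "reach_ge M \<tau> \<longleftrightarrow> (\<forall>y. infdist y M < \<tau> \<longrightarrow> (\<exists>!x. x \<in> M \<and> dist y x = infdist y M))"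

definition proj_onto :: "(real^('D::finite)) set \<Rightarrow> real^'D \<Rightarrow> real^'D" where
  "proj_onto M z = (SOME x. x \<in> M \<and> dist z x = infdist z M)"

definition unit_ball_vol :: "nat \<Rightarrow> real" where
  "unit_ball_vol s = pi powr (real s / 2) / Gamma (real s / 2 + 1)"

definition hausdorff_delta :: "nat \<Rightarrow> real \<Rightarrow> (real^('D::finite)) set \<Rightarrow> ennreal" where
  "hausdorff_delta s \<delta> A =
     (INF C \<in> {C :: nat \<Rightarrow> (real^('D::finite)) set. A \<subseteq> (\<Union>n. C n) \<and>
                (\<forall>n. bounded (C n) \<and> diameter (C n) \<le> \<delta>)}.
        (\<Sum>n. (if C n = {} then 0 else ennreal (unit_ball_vol s * (diameter (C n) / 2) ^ s))))"

definition hausdorff_outer :: "nat \<Rightarrow> (real^('D::finite)) set \<Rightarrow> ennreal" where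
  "hausdorff_outer s A = (SUP \<delta> \<in> {0<..}. hausdorff_delta s \<delta> A)"

definition hausdorff_measure :: "nat \<Rightarrow> (real^('D::finite)) measure" where
  "hausdorff_measure s = measure_of UNIV (sets borel) (hausdorff_outer s)"

definition gauss_density :: "real \<Rightarrow> real^'D \<Rightarrow> real" where
  "gauss_density \<sigma> u = (2 * pi * \<sigma>^2) powr (- real CARD('D) / 2) * exp (- ((norm u)\<^sup>2) / (2 * \<sigma>\<^sup>2))"

text \<open>Density nu of Y = X + xi, X uniform on M (normalised d-dim Hausdorff measure),
xi ~ N(0, sigma^2 I_D).\<close>
definition noisy_density :: "('d::finite) itself \<Rightarrow> (real^('D::finite)) set \<Rightarrow> real \<Rightarrow> real^'D \<Rightarrow> real" where
  "noisy_density T M \<sigma> y =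
     (LINT x:M|hausdorff_measure CARD('d). gauss_density \<sigma> (y - x))
       / measure (hausdorff_measure CARD('d)) M"

definition cond_mean_shift :: "(real^'D \<Rightarrow> real) \<Rightarrow> (real^('D::finite)) set \<Rightarrow> real^'D \<Rightarrow> real^'D" where
  "cond_mean_shift \<nu> S z =
     (1 / (LINT y:S|lborel. \<nu> y)) *\<^sub>R (LINT y:S|lborel. \<nu> y *\<^sub>R (y - z))"

definition window :: "real^'D^'D \<Rightarrow> real^'D \<Rightarrow> real \<Rightarrow> real \<Rightarrow> (real^('D::finite)) set" where
  "window Ph z r1 r2 =
     {w. norm ((mat 1 - Ph) *v (w - z)) \<le> r1 \<and> norm (Ph *v (w - z)) \<le> r2}"

end

theory Submission
  imports Defs "HOL-Probability.Distributions"
begin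

text \<open>Write p for the projection of z onto M, P for the estimated normal projection and N for the
  true one.  Since z - p is normal to M, the point z + P E(Y - z | Y in window) differs from p by
  (N - P)(z - p), which is small, plus E(P(Y - p) | Y in window).

  Positive reach gives |N(x - p)| \<le> |x - p|^2 / \<tau> for all x in M, hence |P(x - p)| is at most
  a multiple of \<sigma>^\<kappa> |x - p| plus |x - p|^2 / \<tau>.  The window has tangential width of order \<sigma>,
  so the hidden point x = X is at distance O(\<sigma>) from p up to Gaussian tails; with
  two-sided bounds of order r^d for the volume of M inside r-balls, the signal part P(X - p)
  contributes O(\<sigma>^(1+\<kappa>)).  The noise part vanishes by the symmetry of the Gaussian under the
  reflection u \<mapsto> u - 2Pu, except where the window and its reflection differ; there the noise is
  at least a multiple of \<sigma> sqrt(log(1/\<sigma>)), so this part is O(\<sigma>^(d+2)) when the constant in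
  the normal radius is large.\<close>

text \<open>The conditional mean is a quotient, and its denominator is only of order \<sigma>^d: a
  hidden point within \<sigma> of p puts Gaussian mass of order 1 into the window, but such points
  have volume of order \<sigma>^d. Every numerator has to be measured against this. All of M
  contributes to the signal part through Gaussian tails, so volume growth is wanted at all radii.
  Distant hidden points are harmless because of the short tangential side c1 \<sigma> of the window;
  its normal side is longer by a logarithmic factor. The noise bound carries the whole volume of M
  and pays for the division by \<sigma>^d by its tail, which is where a large C2 comes from. Reach
  is defined by uniqueness of foot points. It becomes quantitative by prolonging normal segments
  with Brouwer's theorem: no point of M lies inside a ball of radius \<tau>/2 that touches M at p
  along a normal. All terms turn out to be of order \<sigma>^(1+\<kappa>); the logarithmic factor
  enters only in the last line.\<close>

section \<open>Hausdorff measure as a Borel measure\<close>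

text \<open>Caratheodory's criterion for metric outer measures. The part \<open>K n\<close> of
  \<open>A\<close> at distance at least 1/(n+1) from \<open>F\<close> is separated from
  \<open>A \<inter> F\<close>, so only points outside but close to \<open>F\<close> need an
  argument. They are cut into shells \<open>R i\<close>. Shells of the same parity are separated, so
  the even and the odd shells each have total size at most \<open>f A\<close>, and the tail of the
  convergent series over all shells tends to 0.\<close>

lemma metric_outer_measure_closed:
  fixes f :: "'a::metric_space set \<Rightarrow> ennreal"
  assumes empty: "f {} = 0"
    and mono: "\<And>A B. A \<subseteq> B \<Longrightarrow> f A \<le> f B"
    and csub: "\<And>A :: nat \<Rightarrow> 'a set. f (\<Union>i. A i) \<le> (\<Sum>i. f (A i))"
    and sep: "\<And>A B e. e > 0 \<Longrightarrow> (\<And>a b. a \<in> A \<Longrightarrow> b \<in> B \<Longrightarrow> e \<le> dist a b) \<Longrightarrow> f A + f B \<le> f (A \<union> B)"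
    and F: "closed F"
  shows "f (A \<inter> F) + f (A - F) = f A"
proof -
  have sub2: "f (A \<union> B) \<le> f A + f B" for A B
  proof -
    have "(\<Union>i. (if i = 0 then A else if i = Suc 0 then B else {})) = A \<union> B" for i
      by (force split: if_splits)
    then have "f (A \<union> B) \<le> (\<Sum>i. f (if i = 0 then A else if i = Suc 0 then B else {}))"
      using csub[of "\<lambda>i. (if i = 0 then A else if i = Suc 0 then B else {})"] by simp
    also have "\<dots> = (\<Sum>i\<in>{0,Suc 0}. f (if i = 0 then A else if i = Suc 0 then B else {}))"
      by (rule suminf_finite) (auto simp: empty)
    finally show ?thesis by simp
  qed
  have "f (A \<inter> F) + f (A - F) \<le> f A"
  proof (cases "F = {} \<or> f A = \<infinity>")
    case True
    then show ?thesis by (auto simp: empty)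
  next
    case False
    then have Fne: "F \<noteq> {}" and fin: "f A \<noteq> \<infinity>" by auto
    define K where "K n = {x\<in>A. 1 / Suc n \<le> infdist x F}" for n :: nat
    define R where "R n = {x\<in>A. 1 / Suc (Suc n) \<le> infdist x F \<and> infdist x F < 1 / Suc n}" for n :: nat
    have sepK: "f (A \<inter> F) + f (K n) \<le> f A" for n
    proof -
      have "f (A \<inter> F) + f (K n) \<le> f ((A \<inter> F) \<union> K n)"
      proof (rule sep[of "1 / Suc n"])
        fix a b assume "a \<in> A \<inter> F" "b \<in> K n"
        then show "1 / real (Suc n) \<le> dist a b"
          using infdist_le[of a F b] by (auto simp: K_def dist_commute)
      qed simp
      also have "\<dots> \<le> f A" by (rule mono) (auto simp: K_def)
      finally show ?thesis .
    qed
    have Rsep: "1 / Suc (Suc m) - 1 / Suc n \<le> dist a b" if "a \<in> R m" "b \<in> R n" for m n a b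
    proof -
      have "\<bar>infdist a F - infdist b F\<bar> \<le> dist a b" by (rule infdist_triangle_abs)
      then show ?thesis using that unfolding R_def by auto
    qed
    have even: "(\<Sum>i<n. f (R (2*i + k))) \<le> f (\<Union>i<n. R (2*i + k))" for n k
    proof (induction n)
      case 0 then show ?case by (simp add: empty)
    next
      case (Suc n)
      have "(\<Sum>i<Suc n. f (R (2*i + k))) \<le> f (\<Union>i<n. R (2*i + k)) + f (R (2*n+k))"
        using Suc by (simp add: add_mono)
      also have "\<dots> \<le> f ((\<Union>i<n. R (2*i + k)) \<union> R (2*n+k))"
      \<comment> \<open>For \<open>i < n\<close> an earlier shell has distance at least 1/(2i+k+2)
        \<ge> 1/(2n+k) from \<open>F\<close>, the new one less than 1/(2n+k+1). For
        \<open>n = 0\<close> there is no earlier shell and any positive number will do, while the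
        general expression would be negative for \<open>k = 0\<close>, where 1/0 = 0.\<close>
      proof (rule sep[of "if n = 0 then 1 else 1 / (2*n+k) - 1 / Suc (2*n+k)"])
        show "0 < (if n = 0 then 1 else 1 / (2*n+k) - 1 / Suc (2*n+k))"
          by (auto intro: divide_strict_left_mono)
        fix a b assume "a \<in> (\<Union>i<n. R (2*i + k))" and b: "b \<in> R (2*n+k)"
        then obtain i where i: "i < n" "a \<in> R (2*i + k)" by auto
        have "infdist a F \<ge> 1 / Suc (Suc (2*i+k))" using i by (auto simp: R_def)
        moreover have "1 / real (Suc (Suc (2*i+k))) \<ge> 1 / real (2*n+k)"
          using i by (intro divide_left_mono) auto
        moreover have "\<bar>infdist a F - infdist b F\<bar> \<le> dist a b" by (rule infdist_triangle_abs)
        moreover have "infdist b F < 1 / Suc (2*n+k)" using b by (auto simp: R_def)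
        ultimately show "(if n = 0 then 1 else 1 / (2*n+k) - 1 / Suc (2*n+k)) \<le> dist a b"
          using i by simp
      qed
      also have "(\<Union>i<n. R (2*i + k)) \<union> R (2*n+k) = (\<Union>i<Suc n. R (2*i + k))"
        by (auto simp: less_Suc_eq)
      finally show ?case .
    qed
    have even': "(\<Sum>i<n. f (R (2*i + k))) \<le> f A" for n k
      using even[of k n] by (rule order_trans) (auto intro!: mono simp: R_def)
    have "(\<Sum>i<2*n. f (R i)) = (\<Sum>i<n. f (R (2*i+0))) + (\<Sum>i<n. f (R (2*i+1)))" for n
      by (induction n) (auto simp: algebra_simps)
    then have "(\<Sum>i<2*n. f (R i)) \<le> f A + f A" for n
      using even'[of 0 n] even'[of 1 n] by (simp add: add_mono)
    moreover have "(\<Sum>i<n. f (R i)) \<le> (\<Sum>i<2*n. f (R i))" for n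
      by (rule sum_mono2) auto
    ultimately have "(\<Sum>i<n. f (R i)) \<le> f A + f A" for n
      using order_trans by blast
    then have "(\<Sum>i. f (R i)) \<le> f A + f A"
      by (intro suminf_le_const) auto
    then have Rfin: "(\<Sum>i. f (R i)) \<noteq> top" using fin
      by (auto simp: top_unique infinity_ennreal_def)
    define r where "r i = enn2real (f (R i))" for i
    have fR: "f (R i) = ennreal (r i)" and r0: "0 \<le> r i" for i
    proof -
      have "f (R i) \<le> f A" by (rule mono) (auto simp: R_def)
      then have "f (R i) < top" using fin by (simp add: less_top top_unique)
      then show "f (R i) = ennreal (r i)" by (simp add: r_def)
    qed (simp add: r_def)
    have sr: "summable r"
      using Rfin r0 by (intro summable_suminf_not_top) (auto simp: fR)
    show ?thesis
    proof (rule ennreal_le_epsilon)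
      fix e :: real assume e: "e > 0"
      obtain n where n: "norm (\<Sum>i. r (i + n)) < e"
        using suminf_exist_split[OF e sr] by blast
      have "A - F \<subseteq> K n \<union> (\<Union>i. R (i + n))"
      proof
        fix x assume x: "x \<in> A - F"
        then have pos: "infdist x F > 0"
          using infdist_pos_not_in_closed[OF F Fne, of x] by auto
        show "x \<in> K n \<union> (\<Union>i. R (i + n))"
        proof (cases "1 / Suc n \<le> infdist x F")
          case True then show ?thesis using x by (auto simp: K_def)
        next
          case False
          obtain m0 where "1 / Suc m0 < infdist x F"
            using pos nat_approx_posE by metis
          then have ex: "\<exists>m. 1 / Suc m \<le> infdist x F" by (intro exI[of _ m0]) auto
          \<comment> \<open>The least such index locates the shell: \<open>x\<close> lies in the
            shell number \<open>m - 1\<close>, and \<open>m > n\<close> because \<open>x\<close> is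
            outside \<open>K n\<close>.\<close>
          define m where "m = (LEAST m. 1 / Suc m \<le> infdist x F)"
          have m: "1 / Suc m \<le> infdist x F" unfolding m_def by (rule LeastI_ex[OF ex])
          have mm: "j < m \<Longrightarrow> infdist x F < 1 / Suc j" for j
            using not_less_Least[of j "\<lambda>m. 1 / Suc m \<le> infdist x F"] by (auto simp: m_def)
          have "n < m"
          proof (rule ccontr)
            assume "\<not> n < m"
            then have "1 / real (Suc n) \<le> 1 / Suc m" by (intro divide_left_mono) auto
            then show False using m False by simp
          qed
          then obtain j where j: "m = Suc (j + n)" by (metis add.commute less_imp_Suc_add add_Suc)
          have "x \<in> R (j + n)" using x m mm[of "j+n"] by (auto simp: R_def j)
          then show ?thesis by blast
        qed
      qed
      then have "f (A - F) \<le> f (K n) + f (\<Union>i. R (i + n))"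
        by (meson mono sub2 order_trans)
      also have "f (\<Union>i. R (i + n)) \<le> (\<Sum>i. f (R (i + n)))" by (rule csub)
      also have "(\<Sum>i. f (R (i + n))) = ennreal (\<Sum>i. r (i + n))"
        unfolding fR using sr r0 by (intro suminf_ennreal2) (auto simp: summable_iff_shift)
      also have "\<dots> \<le> ennreal e" using n by (intro ennreal_leI) auto
      finally have "f (A - F) \<le> f (K n) + ennreal e" by (simp add: add_left_mono)
      then have "f (A \<inter> F) + f (A - F) \<le> f (A \<inter> F) + (f (K n) + ennreal e)" by (rule add_left_mono)
      also have "\<dots> \<le> f A + ennreal e"
        using sepK[of n] by (simp add: add.assoc[symmetric] add_right_mono)
      finally show "f (A \<inter> F) + f (A - F) \<le> f A + ennreal e" .
    qed
  qed
  moreover have "f A \<le> f (A \<inter> F) + f (A - F)"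
    using sub2[of "A \<inter> F" "A - F"] by (simp add: Int_Diff_Un)
  ultimately show ?thesis by (rule antisym)
qed

text \<open>\<open>measure_of\<close> returns the zero measure unless it is given a measure on the
  sigma algebra, so this is what ties \<open>hausdorff_measure\<close> to
  \<open>hausdorff_outer\<close>. The sigma algebra of Caratheodory's theorem contains the closed
  sets by the previous lemma, hence all Borel sets.\<close>

lemma metric_outer_measure_borel:
  fixes f :: "'a::metric_space set \<Rightarrow> ennreal"
  assumes empty: "f {} = 0"
    and mono: "\<And>A B. A \<subseteq> B \<Longrightarrow> f A \<le> f B"
    and csub: "\<And>A :: nat \<Rightarrow> 'a set. f (\<Union>i. A i) \<le> (\<Sum>i. f (A i))"
    and sep: "\<And>A B e. e > 0 \<Longrightarrow> (\<And>a b. a \<in> A \<Longrightarrow> b \<in> B \<Longrightarrow> e \<le> dist a b) \<Longrightarrow> f A + f B \<le> f (A \<union> B)"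
  shows "measure_space UNIV (sets borel) f"
proof -
  interpret P: sigma_algebra "UNIV :: 'a set" "Pow UNIV" by (rule sigma_algebra_Pow)
  let ?L = "lambda_system UNIV (Pow UNIV) f"
  have "outer_measure_space (Pow UNIV) f"
    by (auto simp: outer_measure_space_def positive_def increasing_def countably_subadditive_def
        empty mono csub)
  then have ms: "measure_space UNIV ?L f" by (rule P.caratheodory_lemma)
  then have sa: "sigma_algebra UNIV ?L" by (simp add: measure_space_def)
  have "{S. closed S} \<subseteq> ?L"
  proof safe
    fix F :: "'a set" assume "closed F"
    then have "f (A \<inter> F) + f (A - F) = f A" for A
      by (intro metric_outer_measure_closed empty mono csub sep)
    then show "F \<in> ?L" unfolding P.lambda_system_eq by simp
  qed
  then have "sigma_sets UNIV {S. closed S} \<subseteq> ?L"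
    by (rule sigma_algebra.sigma_sets_subset[OF sa])
  then have sub: "sets borel \<subseteq> ?L" by (simp add: borel_eq_closed)
  have "sigma_algebra UNIV (sets borel :: 'a set set)"
    using sets.sigma_algebra_axioms[of "borel :: 'a measure"] by simp
  with ms sub show ?thesis
    unfolding measure_space_def positive_def countably_additive_def by (auto 4 3)
qed

section \<open>The Hausdorff outer measure is a metric outer measure\<close>

definition hausdorff_cost :: "nat \<Rightarrow> (real^'n::finite) set \<Rightarrow> ennreal" where
  "hausdorff_cost s C = (if C = {} then 0 else ennreal (unit_ball_vol s * (diameter C / 2) ^ s))"

definition delta_cover :: "real \<Rightarrow> (real^'n::finite) set \<Rightarrow> (nat \<Rightarrow> (real^'n) set) \<Rightarrow> bool" where
  "delta_cover \<delta> A C \<longleftrightarrow> A \<subseteq> (\<Union>n. C n) \<and> (\<forall>n. bounded (C n) \<and> diameter (C n) \<le> \<delta>)"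

lemma unit_ball_vol_pos: "unit_ball_vol s > 0"
  unfolding unit_ball_vol_def by (intro divide_pos_pos Gamma_real_pos) (auto intro: add_nonneg_pos)

lemma hausdorff_cost_empty [simp]: "hausdorff_cost s {} = 0"
  by (simp add: hausdorff_cost_def)

lemma hausdorff_delta_alt:
  "hausdorff_delta s \<delta> A = (INF C \<in> {C. delta_cover \<delta> A C}. \<Sum>n. hausdorff_cost s (C n))"
  by (simp add: hausdorff_delta_def delta_cover_def hausdorff_cost_def)

lemma hausdorff_delta_le:
  "delta_cover \<delta> A C \<Longrightarrow> hausdorff_delta s \<delta> A \<le> (\<Sum>n. hausdorff_cost s (C n))"
  unfolding hausdorff_delta_alt by (rule INF_lower) simp

lemma hausdorff_delta_greatest:
  "(\<And>C. delta_cover \<delta> A C \<Longrightarrow> x \<le> (\<Sum>n. hausdorff_cost s (C n))) \<Longrightarrow> x \<le> hausdorff_delta s \<delta> A"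
  unfolding hausdorff_delta_alt by (rule INF_greatest) simp

lemma hausdorff_delta_mono: "A \<subseteq> B \<Longrightarrow> hausdorff_delta s \<delta> A \<le> hausdorff_delta s \<delta> B"
  by (rule hausdorff_delta_greatest, rule hausdorff_delta_le) (auto simp: delta_cover_def)

lemma hausdorff_delta_antimono: "\<delta> \<le> \<delta>' \<Longrightarrow> hausdorff_delta s \<delta>' A \<le> hausdorff_delta s \<delta> A"
  by (rule hausdorff_delta_greatest, rule hausdorff_delta_le) (meson delta_cover_def order_trans)

lemma hausdorff_outer_mono: "A \<subseteq> B \<Longrightarrow> hausdorff_outer s A \<le> hausdorff_outer s B"
  unfolding hausdorff_outer_def by (intro SUP_mono) (auto intro: hausdorff_delta_mono)

lemma hausdorff_delta_le_outer: "\<delta> > 0 \<Longrightarrow> hausdorff_delta s \<delta> A \<le> hausdorff_outer s A"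
  unfolding hausdorff_outer_def by (rule SUP_upper) simp

lemma hausdorff_outer_le: "(\<And>\<delta>. \<delta> > 0 \<Longrightarrow> hausdorff_delta s \<delta> A \<le> x) \<Longrightarrow> hausdorff_outer s A \<le> x"
  unfolding hausdorff_outer_def by (rule SUP_least) simp

lemma hausdorff_outer_empty: "hausdorff_outer s {} = 0"
proof -
  have "hausdorff_delta s \<delta> {} \<le> 0" if "\<delta> > 0" for \<delta> :: real
    using hausdorff_delta_le[of \<delta> "{}" "\<lambda>_. {}" s] that by (simp add: delta_cover_def)
  then have "hausdorff_outer s {} \<le> 0" by (rule hausdorff_outer_le)
  then show ?thesis by simp
qed

lemma hausdorff_delta_countably_subadditive:
  "hausdorff_delta s \<delta> (\<Union>i. A i) \<le> (\<Sum>i::nat. hausdorff_delta s \<delta> (A i))"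
proof (cases "(\<Sum>i. hausdorff_delta s \<delta> (A i)) = top")
  case False
  show ?thesis
  proof (rule ennreal_le_epsilon)
    fix e :: real assume e: "0 < e"
    have "\<exists>C. delta_cover \<delta> (A i) C \<and>
        (\<Sum>n. hausdorff_cost s (C n)) \<le> hausdorff_delta s \<delta> (A i) + ennreal (e * (1/2) ^ Suc i)" for i
    proof -
      have "hausdorff_delta s \<delta> (A i) \<noteq> top"
        using False ennreal_suminf_lessD[of "\<lambda>i. hausdorff_delta s \<delta> (A i)" top i]
        by (auto simp: less_top)
      moreover have "ennreal (e * (1/2) ^ Suc i) > 0" using e by simp
      ultimately have "hausdorff_delta s \<delta> (A i) < hausdorff_delta s \<delta> (A i) + ennreal (e * (1/2) ^ Suc i)"
        using ennreal_add_left_cancel_less[of "hausdorff_delta s \<delta> (A i)" 0] by (simp add: infinity_ennreal_def)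
      then show ?thesis
        using INF_less_iff[of "\<lambda>C. \<Sum>n. hausdorff_cost s (C n)" "{C. delta_cover \<delta> (A i) C}"]
        unfolding hausdorff_delta_alt by (metis less_imp_le mem_Collect_eq)
    qed
    then obtain C where C: "\<And>i. delta_cover \<delta> (A i) (C i)"
      "\<And>i. (\<Sum>n. hausdorff_cost s (C i n)) \<le> hausdorff_delta s \<delta> (A i) + ennreal (e * (1/2) ^ Suc i)"
      by metis
    let ?C = "\<lambda>k. case prod_decode k of (i, n) \<Rightarrow> C i n"
    have "delta_cover \<delta> (\<Union>i. A i) ?C"
      unfolding delta_cover_def
    proof safe
      fix x i assume "x \<in> A i"
      then obtain n where "x \<in> C i n" using C(1)[of i] by (auto simp: delta_cover_def)
      then have "x \<in> ?C (prod_encode (i, n))" by simp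
      then show "x \<in> (\<Union>k. ?C k)" by (rule UN_I[OF UNIV_I])
    next
      show "bounded (?C k)" "diameter (?C k) \<le> \<delta>" for k
        using C(1) by (auto simp: delta_cover_def split: prod.split)
    qed
    then have "hausdorff_delta s \<delta> (\<Union>i. A i) \<le> (\<Sum>k. hausdorff_cost s (?C k))"
      by (rule hausdorff_delta_le)
    also have "\<dots> = (\<Sum>i. \<Sum>n. hausdorff_cost s (C i n))"
      using suminf_ennreal_2dimen[of "\<lambda>i. \<Sum>n. hausdorff_cost s (C i n)" "\<lambda>(i,n). hausdorff_cost s (C i n)"]
      by (simp add: case_prod_beta)
    also have "\<dots> \<le> (\<Sum>i. hausdorff_delta s \<delta> (A i) + ennreal (e * (1/2) ^ Suc i))"
      by (intro suminf_le C(2)) auto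
    also have "\<dots> = (\<Sum>i. hausdorff_delta s \<delta> (A i)) + (\<Sum>i. ennreal (e * (1/2) ^ Suc i))"
      by (rule suminf_add[symmetric]) auto
    also have "(\<Sum>i. ennreal (e * (1/2) ^ Suc i)) = ennreal e"
      using e sums_mult[OF power_half_series, of e] by (intro suminf_ennreal_eq) auto
    finally show "hausdorff_delta s \<delta> (\<Union>i. A i) \<le> (\<Sum>i. hausdorff_delta s \<delta> (A i)) + ennreal e" .
  qed
qed simp

lemma hausdorff_outer_countably_subadditive:
  "hausdorff_outer s (\<Union>i. A i) \<le> (\<Sum>i::nat. hausdorff_outer s (A i))"
proof (rule hausdorff_outer_le)
  fix \<delta> :: real assume "\<delta> > 0"
  then have "(\<Sum>i. hausdorff_delta s \<delta> (A i)) \<le> (\<Sum>i. hausdorff_outer s (A i))"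
    by (intro suminf_le hausdorff_delta_le_outer) auto
  with hausdorff_delta_countably_subadditive
  show "hausdorff_delta s \<delta> (\<Union>i. A i) \<le> (\<Sum>i. hausdorff_outer s (A i))"
    by (rule order_trans)
qed

text \<open>A set of diameter at most \<delta> cannot meet both \<open>A\<close> and
  \<open>B\<close>, so a cover of the union splits into covers of \<open>A\<close> and of
  \<open>B\<close> without paying for any set twice.\<close>

lemma hausdorff_delta_separated:
  assumes sep: "\<And>a b. a \<in> A \<Longrightarrow> b \<in> B \<Longrightarrow> \<delta> < dist a b"
  shows "hausdorff_delta s \<delta> A + hausdorff_delta s \<delta> B \<le> hausdorff_delta s \<delta> (A \<union> B)"
proof (rule hausdorff_delta_greatest)
  fix C assume C: "delta_cover \<delta> (A \<union> B) C"
  define CA where "CA n = (if C n \<inter> A = {} then {} else C n)" for n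
  define CB where "CB n = (if C n \<inter> B = {} then {} else C n)" for n
  have \<delta>: "\<delta> \<ge> 0" using C diameter_ge_0 by (meson delta_cover_def order_trans)
  have "C n \<inter> A = {} \<or> C n \<inter> B = {}" for n
  proof (rule ccontr)
    assume "\<not> ?thesis"
    then obtain a b where "a \<in> C n" "a \<in> A" "b \<in> C n" "b \<in> B" by blast
    moreover from this have "dist a b \<le> diameter (C n)"
      using C by (intro diameter_bounded_bound) (auto simp: delta_cover_def)
    ultimately show False using sep[of a b] C unfolding delta_cover_def by (meson not_le order_trans)
  qed
  then have cost: "hausdorff_cost s (CA n) + hausdorff_cost s (CB n) \<le> hausdorff_cost s (C n)" for n
    by (auto simp: CA_def CB_def)
  have "delta_cover \<delta> A CA"
    unfolding delta_cover_def
  proof safe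
    fix x assume "x \<in> A"
    then obtain n where "x \<in> C n" using C by (auto simp: delta_cover_def)
    then have "x \<in> CA n" using \<open>x \<in> A\<close> by (auto simp: CA_def)
    then show "x \<in> (\<Union>n. CA n)" by blast
  qed (use C \<delta> in \<open>auto simp: delta_cover_def CA_def\<close>)
  moreover have "delta_cover \<delta> B CB"
    unfolding delta_cover_def
  proof safe
    fix x assume "x \<in> B"
    then obtain n where "x \<in> C n" using C by (auto simp: delta_cover_def)
    then have "x \<in> CB n" using \<open>x \<in> B\<close> by (auto simp: CB_def)
    then show "x \<in> (\<Union>n. CB n)" by blast
  qed (use C \<delta> in \<open>auto simp: delta_cover_def CB_def\<close>)
  ultimately have "hausdorff_delta s \<delta> A + hausdorff_delta s \<delta> B
      \<le> (\<Sum>n. hausdorff_cost s (CA n)) + (\<Sum>n. hausdorff_cost s (CB n))"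
    by (intro add_mono hausdorff_delta_le)
  also have "\<dots> = (\<Sum>n. hausdorff_cost s (CA n) + hausdorff_cost s (CB n))"
    by (rule suminf_add) auto
  also have "\<dots> \<le> (\<Sum>n. hausdorff_cost s (C n))"
    by (intro suminf_le cost) auto
  finally show "hausdorff_delta s \<delta> A + hausdorff_delta s \<delta> B \<le> (\<Sum>n. hausdorff_cost s (C n))" .
qed

lemma hausdorff_outer_separated:
  assumes e: "e > 0" and sep: "\<And>a b. a \<in> A \<Longrightarrow> b \<in> B \<Longrightarrow> e \<le> dist a b"
  shows "hausdorff_outer s A + hausdorff_outer s B \<le> hausdorff_outer s (A \<union> B)"
proof -
  have "hausdorff_outer s A + hausdorff_outer s B
      = (SUP \<delta>\<in>{0<..}. hausdorff_delta s \<delta> A + hausdorff_delta s \<delta> B)"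
    unfolding hausdorff_outer_def
  \<comment> \<open>The values grow as \<delta> shrinks, so two choices of \<delta> are dominated by
    their minimum.\<close>
  proof (rule SUP_add_directed_ennreal[symmetric])
    fix i j :: real assume "i \<in> {0<..}" "j \<in> {0<..}"
    then show "\<exists>k\<in>{0<..}. hausdorff_delta s i A + hausdorff_delta s j B
        \<le> hausdorff_delta s k A + hausdorff_delta s k B"
      by (intro bexI[of _ "min i j"] add_mono hausdorff_delta_antimono) auto
  qed
  also have "\<dots> \<le> hausdorff_outer s (A \<union> B)"
  proof (rule SUP_least)
    fix \<delta> :: real assume "\<delta> \<in> {0<..}"
    then have \<delta>: "\<delta> > 0" by simp
    \<comment> \<open>Half of \<open>e\<close> makes the separation strict, as
      \<open>hausdorff_delta_separated\<close> requires.\<close>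
    let ?d = "min \<delta> (e/2)"
    have "hausdorff_delta s \<delta> A + hausdorff_delta s \<delta> B \<le> hausdorff_delta s ?d A + hausdorff_delta s ?d B"
      by (intro add_mono hausdorff_delta_antimono) auto
    also have "\<dots> \<le> hausdorff_delta s ?d (A \<union> B)"
      using sep e by (intro hausdorff_delta_separated) force
    also have "\<dots> \<le> hausdorff_outer s (A \<union> B)"
      using \<delta> e by (intro hausdorff_delta_le_outer) auto
    finally show "hausdorff_delta s \<delta> A + hausdorff_delta s \<delta> B \<le> hausdorff_outer s (A \<union> B)" .
  qed
  finally show ?thesis .
qed

lemma sets_hausdorff_measure [simp, measurable_cong]: "sets (hausdorff_measure s) = sets borel"
  unfolding hausdorff_measure_def using sets.sigma_sets_eq[of borel] by simp

lemma space_hausdorff_measure [simp]: "space (hausdorff_measure s) = UNIV"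
  unfolding hausdorff_measure_def by simp

lemma emeasure_hausdorff_measure:
  assumes "A \<in> sets borel"
  shows "emeasure (hausdorff_measure s) A = hausdorff_outer s A"
proof -
  have ms: "measure_space UNIV (sets borel) (hausdorff_outer s)"
    by (intro metric_outer_measure_borel hausdorff_outer_empty hausdorff_outer_mono
        hausdorff_outer_countably_subadditive hausdorff_outer_separated)
  show ?thesis
    using ms assms unfolding hausdorff_measure_def measure_space_def
    by (intro emeasure_measure_of_sigma) auto
qed

section \<open>Charts and volume growth\<close>

lemma norm_matrix_vector_mult_le:
  fixes A :: "real^'n^'m"
  shows "norm (A *v x) \<le> norm A * norm x"
proof -
  have "norm (A *v x) = L2_set (\<lambda>i. norm ((A *v x) $ i)) UNIV" by (simp add: norm_vec_def)
  also have "\<dots> \<le> L2_set (\<lambda>i. norm (A $ i) * norm x) UNIV"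
    by (rule L2_set_mono) (auto simp: matrix_vector_mul_component Cauchy_Schwarz_ineq2)
  also have "\<dots> = norm A * norm x"
    by (simp add: norm_vec_def L2_set_left_distrib)
  finally show ?thesis .
qed

lemma differentiable_at_linear_bound:
  fixes f :: "'a::euclidean_space \<Rightarrow> 'b::real_normed_vector"
  assumes "f differentiable (at u)"
  obtains e L where "e > 0" "L \<ge> 0" "\<And>v. v \<in> ball u e \<Longrightarrow> norm (f v - f u) \<le> L * norm (v - u)"
proof -
  obtain f' where f': "(f has_derivative f') (at u)" using assms by (auto simp: differentiable_def)
  then have lin: "linear f'" using has_derivative_linear by blast
  obtain B where B: "B > 0" "\<And>x. norm (f' x) \<le> B * norm x"
    using linear_bounded_pos[OF lin] by blast
  obtain d where d: "d > 0" "\<And>y. norm (y - u) < d \<Longrightarrow> norm (f y - f u - f' (y - u)) \<le> 1 * norm (y - u)"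
    using f' unfolding has_derivative_at_alt by (meson zero_less_one)
  show thesis
  proof (rule that[of d "B + 1"])
    fix v assume "v \<in> ball u d"
    then have "norm (f v - f u - f' (v - u)) \<le> norm (v - u)"
      using d(2)[of v] by (simp add: dist_norm norm_minus_commute)
    then show "norm (f v - f u) \<le> (B + 1) * norm (v - u)"
      using B(2)[of "v - u"] norm_triangle_ineq2[of "f v - f u" "f' (v - u)"] by (simp add: algebra_simps)
  qed (use d B in auto)
qed

text \<open>Mean value inequality for \<phi> minus its linear part at \<open>u\<close>.
  Differentiability of \<open>J\<close> at \<open>u\<close> gives |J v - J u| \<le> L |v - u|, so on
  the ball of radius \<open>r\<close> the derivative of the difference is at most
  \<open>L * r\<close>. With r = |v - u| this is the quadratic Taylor bound; with
  \<open>L * r\<close> at most half the injectivity constant of \<open>J u\<close> it makes \<phi>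
  bi-Lipschitz.\<close>

lemma chart_local_bounds:
  fixes M :: "(real^'D::finite) set"
  assumes ch: "is_chart TYPE('d::finite) M U \<phi> J W" and u: "u \<in> U"
  obtains e a b L where "e > 0" "a > 0" "b > 0" "L \<ge> 0" "ball u e \<subseteq> U"
    "\<And>v w. v \<in> ball u e \<Longrightarrow> w \<in> ball u e \<Longrightarrow>
        a * norm (v - w) \<le> norm (\<phi> v - \<phi> w) \<and> norm (\<phi> v - \<phi> w) \<le> b * norm (v - w)"
    "\<And>v. v \<in> ball u e \<Longrightarrow> norm (\<phi> v - \<phi> u - J u *v (v - u)) \<le> L * (norm (v - u))\<^sup>2"
proof -
  from ch have U: "open U" and der: "\<And>v. v \<in> U \<Longrightarrow> (\<phi> has_derivative (\<lambda>h. J v *v h)) (at v)"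
    and J: "J differentiable (at u)" and rk: "rank (J u) = CARD('d)"
    using u by (auto simp: is_chart_def)
  obtain e1 where e1: "e1 > 0" "ball u e1 \<subseteq> U" using U u open_contains_ball by blast
  obtain e2 L where e2: "e2 > 0" "L \<ge> 0" "\<And>v. v \<in> ball u e2 \<Longrightarrow> norm (J v - J u) \<le> L * norm (v - u)"
    using differentiable_at_linear_bound[OF J] by blast
  have lin: "linear ((*v) (J u))" by simp
  obtain c where c: "c > 0" "\<And>h. c * norm h \<le> norm (J u *v h)"
    using linear_inj_bounded_below_pos[OF lin] rk full_rank_injective by metis
  \<comment> \<open>The third entry forces \<open>L * r \<le> c / 2\<close> for
    \<open>r < e\<close>; the summand 1 keeps the denominator positive when
    \<open>L = 0\<close>.\<close>
  define e where "e = Min {e1, e2, c / (2 * (L + 1))}"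
  have e: "e > 0" "e \<le> e1" "e \<le> e2" "e \<le> c / (2 * (L + 1))"
    using e1 e2 c by (auto simp: e_def)
  have key: "norm ((\<phi> v - J u *v v) - (\<phi> w - J u *v w)) \<le> L * r * norm (v - w)"
    if r: "r < e" and v: "v \<in> cball u r" and w: "w \<in> cball u r" for v w r
  proof (rule differentiable_bound[where S = "cball u r" and f' = "\<lambda>y h. J y *v h - J u *v h"])
    fix y assume y: "y \<in> cball u r"
    have "y \<in> U" using y r e e1 by (auto simp: subset_iff)
    then show "((\<lambda>v. \<phi> v - J u *v v) has_derivative (\<lambda>h. J y *v h - J u *v h)) (at y within cball u r)"
      by (intro has_derivative_diff has_derivative_at_withinI[OF der] linear_imp_has_derivative lin)
    have "norm (J y - J u) \<le> L * norm (y - u)" using y r e by (intro e2) auto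
    also have "\<dots> \<le> L * r" using y e2 by (intro mult_left_mono) (auto simp: dist_norm norm_minus_commute)
    finally have "norm (J y - J u) \<le> L * r" .
    then show "onorm (\<lambda>h. J y *v h - J u *v h) \<le> L * r"
    proof (intro onorm_le)
      fix h
      have "norm (J y *v h - J u *v h) \<le> norm (J y - J u) * norm h"
        using norm_matrix_vector_mult_le[of "J y - J u" h] by (simp add: matrix_vector_mult_diff_rdistrib)
      also have "\<dots> \<le> L * r * norm h" using \<open>norm (J y - J u) \<le> L * r\<close> by (rule mult_right_mono) simp
      finally show "norm (J y *v h - J u *v h) \<le> L * r * norm h" .
    qed
  qed (use v w in auto)
  have Lr: "L * r \<le> c / 2" if "r < e" "r \<ge> 0" for r
  proof -
    have "L * r \<le> (L + 1) * e" using that e2 by (intro mult_mono) auto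
    also have "\<dots> \<le> (L + 1) * (c / (2 * (L + 1)))" using e e2 by (intro mult_left_mono) auto
    also have "\<dots> = c / 2" using e2 by (simp add: add_pos_nonneg field_simps)
    finally show ?thesis .
  qed
  obtain B where B: "B > 0" "\<And>h. norm (J u *v h) \<le> B * norm h"
    using linear_bounded_pos[OF lin] by blast
  show thesis
  proof (rule that[of e "c/2" "B + c" L])
    fix v w assume v: "v \<in> ball u e" and w: "w \<in> ball u e"
    let ?r = "max (dist u v) (dist u w)"
    have "norm ((\<phi> v - J u *v v) - (\<phi> w - J u *v w)) \<le> L * ?r * norm (v - w)"
      using v w by (intro key) auto
    also have "\<dots> \<le> c / 2 * norm (v - w)"
      using v w by (intro mult_right_mono Lr) (auto simp: le_max_iff_disj)
    finally have *: "norm ((\<phi> v - \<phi> w) - J u *v (v - w)) \<le> c / 2 * norm (v - w)"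
      by (simp add: algebra_simps matrix_vector_mult_diff_distrib)
    show "c / 2 * norm (v - w) \<le> norm (\<phi> v - \<phi> w) \<and> norm (\<phi> v - \<phi> w) \<le> (B + c) * norm (v - w)"
    proof
      have "norm (J u *v (v - w)) \<le> norm (\<phi> v - \<phi> w) + norm ((\<phi> v - \<phi> w) - J u *v (v - w))"
        by (metis norm_minus_commute norm_triangle_sub add.commute norm_triangle_ineq4 diff_diff_eq2 add_diff_cancel_left' )
      then show "c / 2 * norm (v - w) \<le> norm (\<phi> v - \<phi> w)"
        using * c(2)[of "v - w"] by linarith
      have "norm (\<phi> v - \<phi> w) \<le> norm (J u *v (v - w)) + norm ((\<phi> v - \<phi> w) - J u *v (v - w))"
        by (rule norm_triangle_sub)
      also have "\<dots> \<le> B * norm (v - w) + c * norm (v - w)"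
      proof (rule add_mono)
        have "c / 2 * norm (v - w) \<le> c * norm (v - w)" using c(1) by (intro mult_right_mono) auto
        with * show "norm ((\<phi> v - \<phi> w) - J u *v (v - w)) \<le> c * norm (v - w)" by linarith
      qed (rule B)
      finally show "norm (\<phi> v - \<phi> w) \<le> (B + c) * norm (v - w)" by (simp add: algebra_simps)
    qed
  next
    fix v assume v: "v \<in> ball u e"
    have "norm ((\<phi> v - J u *v v) - (\<phi> u - J u *v u)) \<le> L * dist u v * norm (v - u)"
      using v by (intro key) auto
    then show "norm (\<phi> v - \<phi> u - J u *v (v - u)) \<le> L * (norm (v - u))\<^sup>2"
      by (simp add: algebra_simps matrix_vector_mult_diff_distrib power2_eq_square dist_norm norm_minus_commute)
  qed (use e e1 c e2 B in auto)
qed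

text \<open>Continuity of the inverse chart excludes that \<open>M\<close> returns close to
  \<open>\<phi> u\<close> from a remote part of the parameter domain.\<close>

lemma chart_image_ball:
  fixes M :: "(real^'D::finite) set"
  assumes ch: "is_chart TYPE('d::finite) M U \<phi> J W" and u: "u \<in> U" and e: "e > 0"
  obtains r where "r > 0" "M \<inter> ball (\<phi> u) r \<subseteq> \<phi> ` (U \<inter> ball u e)"
proof -
  from ch have W: "open W" "\<phi> ` U = M \<inter> W" "inj_on \<phi> U" "continuous_on (M \<inter> W) (inv_into U \<phi>)"
    by (auto simp: is_chart_def)
  have pu: "\<phi> u \<in> M \<inter> W" using W u by blast
  obtain r1 where r1: "r1 > 0" "ball (\<phi> u) r1 \<subseteq> W" using W(1) pu open_contains_ball by blast
  obtain r2 where r2: "r2 > 0" "\<And>x. x \<in> M \<inter> W \<Longrightarrow> dist x (\<phi> u) < r2 \<Longrightarrow> dist (inv_into U \<phi> x) (inv_into U \<phi> (\<phi> u)) < e"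
    using W(4) pu e unfolding continuous_on_iff by meson
  show thesis
  proof (rule that[of "min r1 r2"])
    show "M \<inter> ball (\<phi> u) (min r1 r2) \<subseteq> \<phi> ` (U \<inter> ball u e)"
    proof
      fix x assume x: "x \<in> M \<inter> ball (\<phi> u) (min r1 r2)"
      then have xW: "x \<in> M \<inter> W" using r1 by auto
      then have "x \<in> \<phi> ` U" using W by simp
      then have "inv_into U \<phi> x \<in> U" "\<phi> (inv_into U \<phi> x) = x"
        by (auto intro: inv_into_into f_inv_into_f)
      moreover have "dist (inv_into U \<phi> x) u < e"
        using r2(2)[OF xW] x u W(3) by (simp add: dist_commute)
      ultimately show "x \<in> \<phi> ` (U \<inter> ball u e)" by (metis IntI dist_commute image_eqI mem_ball)
    qed
  qed (use r1 r2 in auto)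
qed

lemma submanifold_local_parametrization:
  fixes M :: "(real^'D::finite) set"
  assumes "C2_submanifold TYPE('d::finite) M" and "p \<in> M"
  obtains \<phi> :: "real^'d \<Rightarrow> real^'D" and u e a b r where
    "e > 0" "a > 0" "b > 0" "r > 0" "\<phi> u = p" "\<phi> ` ball u e \<subseteq> M" "M \<inter> ball p r \<subseteq> \<phi> ` ball u e"
    "\<And>v w. v \<in> ball u e \<Longrightarrow> w \<in> ball u e \<Longrightarrow>
        a * norm (v - w) \<le> norm (\<phi> v - \<phi> w) \<and> norm (\<phi> v - \<phi> w) \<le> b * norm (v - w)"
proof -
  obtain U \<phi> J W where ch: "is_chart TYPE('d) M U \<phi> J W" and "p \<in> W"
    using assms unfolding C2_submanifold_def by blast
  then have "p \<in> \<phi> ` U" using assms by (simp add: is_chart_def)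
  then obtain u where u: "u \<in> U" "\<phi> u = p" by blast
  obtain e a b L where *: "e > 0" "a > 0" "b > 0" "ball u e \<subseteq> U"
    "\<And>v w. v \<in> ball u e \<Longrightarrow> w \<in> ball u e \<Longrightarrow>
        a * norm (v - w) \<le> norm (\<phi> v - \<phi> w) \<and> norm (\<phi> v - \<phi> w) \<le> b * norm (v - w)"
    using chart_local_bounds[OF ch u(1)] by metis
  obtain r where r: "r > 0" "M \<inter> ball (\<phi> u) r \<subseteq> \<phi> ` (U \<inter> ball u e)"
    using chart_image_ball[OF ch u(1) *(1)] by blast
  have "\<phi> ` ball u e \<subseteq> M" using *(4) ch by (auto simp: is_chart_def)
  then show thesis
    using that[of e a b r \<phi> u] * r u by blast
qed

lemma hausdorff_delta_finite_cover:
  fixes A :: "(real^'D::finite) set"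
  assumes fin: "finite I" and cov: "A \<subseteq> (\<Union>i\<in>I. C i)" and \<delta>: "\<delta> \<ge> 0"
    and C: "\<And>i. i \<in> I \<Longrightarrow> bounded (C i) \<and> diameter (C i) \<le> \<delta>"
  shows "hausdorff_delta s \<delta> A \<le> (\<Sum>i\<in>I. hausdorff_cost s (C i))"
proof -
  obtain h where h: "bij_betw h {0..<card I} I" using ex_bij_betw_nat_finite[OF fin] by blast
  let ?C = "\<lambda>n. if n < card I then C (h n) else {}"
  have "delta_cover \<delta> A ?C"
    unfolding delta_cover_def
  proof safe
    fix x assume "x \<in> A"
    then obtain i where "i \<in> I" "x \<in> C i" using cov by blast
    moreover then have "i \<in> h ` {0..<card I}" using h by (simp add: bij_betw_def)
    then obtain n where "n < card I" "h n = i" by auto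
    ultimately have "x \<in> ?C n" by simp
    then show "x \<in> (\<Union>n. ?C n)" by (rule UN_I[OF UNIV_I])
  qed (use C \<delta> bij_betwE[OF h] in auto)
  then have "hausdorff_delta s \<delta> A \<le> (\<Sum>n. hausdorff_cost s (?C n))" by (rule hausdorff_delta_le)
  also have "\<dots> = (\<Sum>n\<in>{0..<card I}. hausdorff_cost s (?C n))"
    by (rule suminf_finite) auto
  also have "\<dots> = (\<Sum>n\<in>{0..<card I}. hausdorff_cost s (C (h n)))" by simp
  also have "\<dots> = (\<Sum>i\<in>I. hausdorff_cost s (C i))"
    using sum.reindex_bij_betw[OF h] .
  finally show ?thesis .
qed

section \<open>Hausdorff measure of bi-Lipschitz images\<close>

lemma emeasure_cball_unit_ball_vol:
  fixes v :: "real^'d::finite"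
  shows "r \<ge> 0 \<Longrightarrow> emeasure lborel (cball v r) = ennreal (unit_ball_vol CARD('d) * r ^ CARD('d))"
  by (simp add: emeasure_cball unit_ball_vol_def Ball_Volume.unit_ball_vol_def)

lemma emeasure_ball_unit_ball_vol:
  fixes v :: "real^'d::finite"
  shows "r \<ge> 0 \<Longrightarrow> emeasure lborel (ball v r) = ennreal (unit_ball_vol CARD('d) * r ^ CARD('d))"
  by (simp add: emeasure_ball unit_ball_vol_def Ball_Volume.unit_ball_vol_def)

text \<open>A cover of the image is pulled back: the points of \<open>S\<close> that are mapped into
  \<open>C n\<close> lie within \<open>diameter (C n) / a\<close> of any one of them, and a ball of
  that radius has volume (2/a)^d times the cost of \<open>C n\<close>. Taking the full diameter as
  radius costs the factor 2^d but replaces the isodiametric inequality.\<close>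

lemma hausdorff_outer_expanding_image_ge:
  fixes \<phi> :: "real^'d::finite \<Rightarrow> real^'D::finite"
  assumes a: "a > 0" and S: "S \<in> sets borel"
    and lb: "\<And>x y. x \<in> S \<Longrightarrow> y \<in> S \<Longrightarrow> a * norm (x - y) \<le> norm (\<phi> x - \<phi> y)"
  shows "ennreal ((a/2) ^ CARD('d)) * emeasure lborel S \<le> hausdorff_outer CARD('d) (\<phi> ` S)"
proof -
  have "ennreal ((a/2) ^ CARD('d)) * emeasure lborel S \<le> hausdorff_delta CARD('d) 1 (\<phi> ` S)"
  proof (rule hausdorff_delta_greatest)
    fix C assume C: "delta_cover 1 (\<phi> ` S) C"
    define E where "E n = {x\<in>S. \<phi> x \<in> C n}" for n
    define B where "B n = (if E n = {} then {} else cball (SOME x. x \<in> E n) (diameter (C n) / a))" for n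
    have "S \<subseteq> (\<Union>n. B n)"
    proof
      fix x assume x: "x \<in> S"
      then obtain n where n: "x \<in> E n" using C by (auto simp: delta_cover_def E_def)
      define w where "w = (SOME x. x \<in> E n)"
      have w: "w \<in> E n" unfolding w_def using n by (rule someI)
      have "a * norm (w - x) \<le> norm (\<phi> w - \<phi> x)" using w n by (intro lb) (auto simp: E_def)
      also have "\<dots> \<le> diameter (C n)"
        using diameter_bounded_bound[of "C n" "\<phi> w" "\<phi> x"] C w n
        by (auto simp: E_def delta_cover_def dist_norm)
      finally have "x \<in> cball w (diameter (C n) / a)"
        using a by (simp add: dist_norm field_simps)
      then have "x \<in> B n" using n by (auto simp: B_def w_def)
      then show "x \<in> (\<Union>n. B n)" by blast
    qed
    then have "emeasure lborel S \<le> emeasure lborel (\<Union>n. B n)"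
      by (rule emeasure_mono) (auto simp: B_def)
    also have "\<dots> \<le> (\<Sum>n. emeasure lborel (B n))"
      by (rule emeasure_subadditive_countably) (auto simp: B_def)
    also have "\<dots> \<le> (\<Sum>n. ennreal ((2/a) ^ CARD('d)) * hausdorff_cost CARD('d) (C n))"
    proof (rule suminf_le)
      fix n
      show "emeasure lborel (B n) \<le> ennreal ((2/a) ^ CARD('d)) * hausdorff_cost CARD('d) (C n)"
      proof (cases "E n = {}")
        case False
        then have "C n \<noteq> {}" by (auto simp: E_def)
        have d0: "diameter (C n) \<ge> 0" using C by (auto simp: delta_cover_def intro: diameter_ge_0)
        have "(2/a) ^ CARD('d) * (unit_ball_vol CARD('d) * (diameter (C n) / 2) ^ CARD('d))
            = unit_ball_vol CARD('d) * (diameter (C n) / a) ^ CARD('d)"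
          using a by (simp add: power_divide)
        then show ?thesis
          using False \<open>C n \<noteq> {}\<close> d0 a unit_ball_vol_pos[of "CARD('d)"]
          by (simp add: B_def emeasure_cball_unit_ball_vol hausdorff_cost_def ennreal_mult[symmetric])
      qed (simp add: B_def)
    qed auto
    also have "\<dots> = ennreal ((2/a) ^ CARD('d)) * (\<Sum>n. hausdorff_cost CARD('d) (C n))"
      by (rule ennreal_suminf_cmult)
    finally have "ennreal ((a/2) ^ CARD('d)) * emeasure lborel S
       \<le> ennreal ((a/2) ^ CARD('d)) * (ennreal ((2/a) ^ CARD('d)) * (\<Sum>n. hausdorff_cost CARD('d) (C n)))"
      by (rule mult_left_mono) simp
    also have "\<dots> = (\<Sum>n. hausdorff_cost CARD('d) (C n))"
      using a by (simp add: mult.assoc[symmetric] ennreal_mult[symmetric] power_mult_distrib[symmetric])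
    finally show "ennreal ((a/2) ^ CARD('d)) * emeasure lborel S \<le> (\<Sum>n. hausdorff_cost CARD('d) (C n))" .
  qed
  also have "\<dots> \<le> hausdorff_outer CARD('d) (\<phi> ` S)" by (rule hausdorff_delta_le_outer) simp
  finally show ?thesis .
qed

text \<open>A grid of cubes of side \<open>s / N\<close> about \<open>v\<close> has of the order of
  N^d cells, and each image has diameter at most \<open>b * d * s / N\<close>. The powers of
  \<open>N\<close> cancel in the total cost, so \<open>N\<close> can be as large as \<delta>
  demands.\<close>

lemma hausdorff_outer_lipschitz_image_le:
  fixes \<phi> :: "real^'d::finite \<Rightarrow> real^'D::finite"
  assumes b: "b > 0" and s: "s > 0" and S: "S \<subseteq> cball v s"
    and ub: "\<And>x y. x \<in> S \<Longrightarrow> y \<in> S \<Longrightarrow> norm (\<phi> x - \<phi> y) \<le> b * norm (x - y)"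
  shows "hausdorff_outer CARD('d) (\<phi> ` S)
    \<le> ennreal (unit_ball_vol CARD('d) * (3 * b * CARD('d) / 2) ^ CARD('d) * s ^ CARD('d))"
proof (rule hausdorff_outer_le)
  fix \<delta> :: real assume \<delta>: "\<delta> > 0"
  let ?d = "CARD('d)"
  obtain N :: nat where N: "N > b * ?d * s / \<delta>" using reals_Archimedean2 by blast
  have "N > 0" using N \<delta> b s by (metis divide_pos_pos mult_pos_pos of_nat_0_less_iff zero_less_card_finite order.strict_trans)
  \<comment> \<open>A coordinate equal to \<open>v $ i + s\<close> has index \<open>N\<close>
    itself, so 2N + 1 indices occur in each direction. They are bounded by 3N below, which is the 3
    in the constant.\<close>
  define I where "I = (Pi\<^sub>E UNIV (\<lambda>_::'d. {- int N..int N}))"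
  define E where "E k = {x\<in>S. \<forall>i. \<lfloor>(x $ i - v $ i) * N / s\<rfloor> = k i}" for k :: "'d \<Rightarrow> int"
  have cov: "\<phi> ` S \<subseteq> (\<Union>k\<in>I. \<phi> ` E k)"
  proof safe
    fix x assume x: "x \<in> S"
    define k where "k i = \<lfloor>(x $ i - v $ i) * N / s\<rfloor>" for i
    have "k i \<in> {- int N..int N}" for i
    proof -
      have "\<bar>x $ i - v $ i\<bar> \<le> norm (x - v)" using component_le_norm_cart[of "x - v" i] by simp
      also have "\<dots> \<le> s" using x S by (auto simp: dist_norm norm_minus_commute)
      finally have *: "\<bar>x $ i - v $ i\<bar> * N / s \<le> N" using s \<open>N > 0\<close>
        by (simp add: field_simps mult_right_mono)
      moreover have "\<bar>(x $ i - v $ i) * N / s\<bar> = \<bar>x $ i - v $ i\<bar> * N / s" using s by (simp add: abs_mult)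
      ultimately have "\<bar>(x $ i - v $ i) * N / s\<bar> \<le> N" by simp
      then have "- of_int N \<le> (x $ i - v $ i) * N / s" "(x $ i - v $ i) * N / s \<le> of_int N" by linarith+
      then show ?thesis unfolding k_def by (auto simp: le_floor_iff floor_le_iff)
    qed
    then have "k \<in> I" by (auto simp: I_def)
    moreover have "x \<in> E k" using x by (simp add: E_def k_def)
    ultimately show "\<phi> x \<in> (\<Union>k\<in>I. \<phi> ` E k)" by blast
  qed
  have diam: "norm (\<phi> x - \<phi> y) \<le> b * ?d * s / N" if "x \<in> E k" "y \<in> E k" for x y k
  proof -
    have "\<bar>x $ i - y $ i\<bar> \<le> s / N" for i
    proof -
      have "\<bar>(x $ i - v $ i) * N / s - (y $ i - v $ i) * N / s\<bar> < 1"
      proof -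
        have "\<lfloor>(x $ i - v $ i) * N / s\<rfloor> = \<lfloor>(y $ i - v $ i) * N / s\<rfloor>"
          using that unfolding E_def by simp
        then show ?thesis by linarith
      qed
      also have "(x $ i - v $ i) * N / s - (y $ i - v $ i) * N / s = (x $ i - y $ i) * N / s"
        by (simp add: diff_divide_distrib left_diff_distrib)
      finally have "\<bar>x $ i - y $ i\<bar> * N / s < 1" using s by (simp add: abs_mult)
      then show ?thesis using s \<open>N > 0\<close> by (simp add: field_simps)
    qed
    then have "(\<Sum>i\<in>UNIV. \<bar>(x - y) $ i\<bar>) \<le> (\<Sum>i\<in>(UNIV::'d set). s / N)"
      by (intro sum_mono) simp
    then have "norm (x - y) \<le> ?d * (s / N)"
      using norm_le_l1_cart[of "x - y"] by simp
    then have "b * norm (x - y) \<le> b * (?d * (s / N))" using b by (intro mult_left_mono) auto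
    then show ?thesis using ub[of x y] that by (auto simp: E_def intro: order_trans)
  qed
  have bd: "bounded (\<phi> ` E k) \<and> diameter (\<phi> ` E k) \<le> b * ?d * s / N" for k
  proof
    show "bounded (\<phi> ` E k)"
    proof (cases "E k = {}")
      case False
      then obtain x0 where "x0 \<in> E k" by blast
      then show ?thesis unfolding bounded_def
        using diam by (intro exI[of _ "\<phi> x0"] exI[of _ "b * ?d * s / N"]) (auto simp: dist_norm)
    qed simp
    show "diameter (\<phi> ` E k) \<le> b * ?d * s / N"
      using b s by (intro diameter_le) (auto intro: diam)
  qed
  have N\<delta>: "b * ?d * s / N \<le> \<delta>" using N \<open>N > 0\<close> \<delta> by (simp add: field_simps)
  have finI: "finite I" unfolding I_def by (intro finite_PiE) auto
  have "hausdorff_delta ?d \<delta> (\<phi> ` S) \<le> (\<Sum>k\<in>I. hausdorff_cost ?d (\<phi> ` E k))"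
    using cov \<delta> bd N\<delta> finI by (intro hausdorff_delta_finite_cover) (auto intro: order_trans)
  also have "\<dots> \<le> (\<Sum>k\<in>I. ennreal (unit_ball_vol ?d * (b * ?d * s / (2 * N)) ^ ?d))"
  proof (intro sum_mono)
    fix k
    have "(diameter (\<phi> ` E k) / 2) ^ ?d \<le> (b * ?d * s / (2 * N)) ^ ?d"
      using bd[of k] diameter_ge_0[of "\<phi> ` E k"] by (intro power_mono) (auto simp: field_simps)
    then show "hausdorff_cost ?d (\<phi> ` E k) \<le> ennreal (unit_ball_vol ?d * (b * ?d * s / (2 * N)) ^ ?d)"
      using unit_ball_vol_pos[of ?d] by (auto simp: hausdorff_cost_def intro!: ennreal_leI mult_left_mono)
  qed
  also have "\<dots> = ennreal (real (card I) * (unit_ball_vol ?d * (b * ?d * s / (2 * N)) ^ ?d))"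
    using unit_ball_vol_pos[of ?d] b s by (simp add: ennreal_mult[symmetric] ennreal_of_nat_eq_real_of_nat)
  also have "\<dots> \<le> ennreal (unit_ball_vol ?d * (3 * b * ?d / 2) ^ ?d * s ^ ?d)"
  proof (rule ennreal_leI)
    have "card I = (2 * N + 1) ^ ?d" unfolding I_def by (simp add: card_PiE nat_add_distrib nat_mult_distrib)
    then have "card I \<le> (3 * N) ^ ?d" using \<open>N > 0\<close> by (simp only:) (rule power_mono, auto)
    then have "real (card I) \<le> (3 * N) ^ ?d" by (metis of_nat_le_iff of_nat_power)
    then have "real (card I) * (unit_ball_vol ?d * (b * ?d * s / (2 * N)) ^ ?d)
       \<le> (3 * N) ^ ?d * (unit_ball_vol ?d * (b * ?d * s / (2 * N)) ^ ?d)"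
      using unit_ball_vol_pos[of ?d] b s by (intro mult_right_mono) auto
    also have "\<dots> = unit_ball_vol ?d * ((3 * N) * (b * ?d * s / (2 * N))) ^ ?d"
      by (simp only: power_mult_distrib) (simp add: mult_ac)
    also have "(3 * N) * (b * ?d * s / (2 * N)) = (3 * b * ?d / 2) * s" using \<open>N > 0\<close> by (simp add: field_simps)
    finally show "real (card I) * (unit_ball_vol ?d * (b * ?d * s / (2 * N)) ^ ?d)
       \<le> unit_ball_vol ?d * (3 * b * ?d / 2) ^ ?d * s ^ ?d" by (simp only: power_mult_distrib mult.assoc)
  qed
  finally show "hausdorff_delta ?d \<delta> (\<phi> ` S) \<le> ennreal (unit_ball_vol ?d * (3 * b * ?d / 2) ^ ?d * s ^ ?d)" .
qed

lemma submanifold_volume_bounds_local: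
  fixes M :: "(real^'D::finite) set"
  assumes M: "C2_submanifold TYPE('d::finite) M" and p: "p \<in> M"
  obtains \<delta> c C r0 where "\<delta> > 0" "c > 0" "C > 0" "r0 > 0"
    "\<And>x r. x \<in> M \<inter> ball p \<delta> \<Longrightarrow> 0 < r \<Longrightarrow> r \<le> r0 \<Longrightarrow>
        ennreal (c * r ^ CARD('d)) \<le> hausdorff_outer CARD('d) (M \<inter> ball x r) \<and>
        hausdorff_outer CARD('d) (M \<inter> ball x r) \<le> ennreal (C * r ^ CARD('d))"
proof -
  let ?d = "CARD('d)"
  obtain \<phi> :: "real^'d \<Rightarrow> real^'D" and u e a b R where
    pos: "e > 0" "a > 0" "b > 0" "R > 0" and \<phi>: "\<phi> u = p" "\<phi> ` ball u e \<subseteq> M" "M \<inter> ball p R \<subseteq> \<phi> ` ball u e"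
    and bl: "\<And>v w. v \<in> ball u e \<Longrightarrow> w \<in> ball u e \<Longrightarrow>
        a * norm (v - w) \<le> norm (\<phi> v - \<phi> w) \<and> norm (\<phi> v - \<phi> w) \<le> b * norm (v - w)"
    using submanifold_local_parametrization[OF M p] by metis
  show thesis
  \<comment> \<open>Points of \<open>M\<close> within \<open>a*e/2\<close> of \<open>p\<close> have
    parameters within \<open>e/2\<close> of \<open>u\<close>, and \<open>r \<le> b*e/2\<close>
    leaves room for a parameter ball of radius \<open>r/b\<close> around them, whose image gives the
    lower bound. The two halves of \<open>R\<close> keep \<open>M \<inter> ball x r\<close> inside
    the region covered by \<phi>; there its parameters lie within \<open>r/a\<close>, which gives
    the upper bound.\<close>
  proof (rule that[of "min (R/2) (a*e/2)" "(a/2) ^ ?d * (unit_ball_vol ?d * (1/b) ^ ?d)"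
        "unit_ball_vol ?d * (3 * b * ?d / 2) ^ ?d * (1/a) ^ ?d" "min (R/2) (b*e/2)"])
    fix x r assume x: "x \<in> M \<inter> ball p (min (R/2) (a*e/2))" and r: "0 < r" "r \<le> min (R/2) (b*e/2)"
    have "x \<in> M \<inter> ball p R" using x pos by auto
    then obtain v where v: "v \<in> ball u e" "x = \<phi> v" using \<phi> by blast
    have "a * norm (u - v) < a * (e/2)"
    proof -
      have "a * norm (u - v) \<le> norm (\<phi> u - \<phi> v)" using bl[of u v] v pos by auto
      moreover have "norm (\<phi> u - \<phi> v) < a * e / 2" using x v \<phi> by (auto simp: dist_norm)
      ultimately show ?thesis by simp
    qed
    then have vu: "dist u v < e/2" using pos mult_less_cancel_left_pos by (metis dist_norm)
    have rb: "r/b \<le> e/2" using r pos by (simp add: field_simps)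
    have sub: "ball v (r/b) \<subseteq> ball u e"
    proof
      fix w assume "w \<in> ball v (r/b)"
      then show "w \<in> ball u e" using vu rb dist_triangle[of u w v] unfolding mem_ball by linarith
    qed
    have "\<phi> ` ball v (r/b) \<subseteq> M \<inter> ball x r"
    proof safe
      fix w assume w: "w \<in> ball v (r/b)"
      then show "\<phi> w \<in> M" using sub \<phi> by blast
      have "norm (\<phi> v - \<phi> w) \<le> b * norm (v - w)" using bl[of v w] v w sub by blast
      also have "\<dots> < r" using w pos by (simp add: dist_norm field_simps)
      finally show "\<phi> w \<in> ball x r" by (simp add: v dist_norm)
    qed
    then have "hausdorff_outer ?d (\<phi> ` ball v (r/b)) \<le> hausdorff_outer ?d (M \<inter> ball x r)"
      by (rule hausdorff_outer_mono)
    moreover have "ennreal ((a/2) ^ ?d) * emeasure lborel (ball v (r/b)) \<le> hausdorff_outer ?d (\<phi> ` ball v (r/b))"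
      using bl sub pos by (intro hausdorff_outer_expanding_image_ge) (auto simp only: subset_iff borel_open open_ball)
    moreover have "ennreal ((a/2) ^ ?d) * emeasure lborel (ball v (r/b))
        = ennreal ((a/2) ^ ?d * (unit_ball_vol ?d * (1/b) ^ ?d) * r ^ ?d)"
      using pos r unit_ball_vol_pos[of ?d]
      by (simp add: emeasure_ball_unit_ball_vol ennreal_mult[symmetric] power_divide mult.assoc)
    ultimately have lower: "ennreal ((a/2) ^ ?d * (unit_ball_vol ?d * (1/b) ^ ?d) * r ^ ?d)
        \<le> hausdorff_outer ?d (M \<inter> ball x r)" by simp
    have "M \<inter> ball x r \<subseteq> \<phi> ` (ball u e \<inter> cball v (r/a))"
    proof
      fix y assume y: "y \<in> M \<inter> ball x r"
      then have "y \<in> M \<inter> ball p R" using x r dist_triangle[of p y x] by auto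
      then obtain w where w: "w \<in> ball u e" "y = \<phi> w" using \<phi> by blast
      have "a * norm (v - w) \<le> norm (\<phi> v - \<phi> w)" using bl[of v w] v w by blast
      also have "\<dots> \<le> r" using y v w by (auto simp: dist_norm)
      finally have "norm (v - w) \<le> r/a" using pos by (simp add: field_simps)
      then show "y \<in> \<phi> ` (ball u e \<inter> cball v (r/a))" using w by (auto simp: dist_norm)
    qed
    then have "hausdorff_outer ?d (M \<inter> ball x r) \<le> hausdorff_outer ?d (\<phi> ` (ball u e \<inter> cball v (r/a)))"
      by (rule hausdorff_outer_mono)
    also have "\<dots> \<le> ennreal (unit_ball_vol ?d * (3 * b * ?d / 2) ^ ?d * (r/a) ^ ?d)"
      using bl pos r by (intro hausdorff_outer_lipschitz_image_le) auto
    also have "\<dots> = ennreal (unit_ball_vol ?d * (3 * b * ?d / 2) ^ ?d * (1/a) ^ ?d * r ^ ?d)"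
      by (simp add: power_divide)
    finally show "ennreal ((a/2) ^ ?d * (unit_ball_vol ?d * (1/b) ^ ?d) * r ^ ?d)
        \<le> hausdorff_outer ?d (M \<inter> ball x r) \<and> hausdorff_outer ?d (M \<inter> ball x r)
        \<le> ennreal (unit_ball_vol ?d * (3 * b * ?d / 2) ^ ?d * (1/a) ^ ?d * r ^ ?d)"
      using lower by blast
  qed (use pos unit_ball_vol_pos[of ?d] in auto)
qed

text \<open>A finite subcover makes the local constants uniform. The upper bound is extended to all
  radii because later Gaussian integrals run over the whole of \<open>M\<close>; beyond
  \<open>r0\<close> the total volume is compared with \<open>r0 ^ d\<close>.\<close>

theorem submanifold_volume_bounds:
  fixes M :: "(real^'D::finite) set"
  assumes M: "C2_submanifold TYPE('d::finite) M" and cpt: "compact M"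
    and fin: "hausdorff_outer CARD('d) M < top"
  obtains c C r0 where "c > 0" "C > 0" "r0 > 0"
    "\<And>x r. x \<in> M \<Longrightarrow> 0 < r \<Longrightarrow> r \<le> r0 \<Longrightarrow>
        ennreal (c * r ^ CARD('d)) \<le> hausdorff_outer CARD('d) (M \<inter> ball x r)"
    "\<And>x r. x \<in> M \<Longrightarrow> 0 < r \<Longrightarrow>
        hausdorff_outer CARD('d) (M \<inter> ball x r) \<le> ennreal (C * r ^ CARD('d))"
proof -
  let ?d = "CARD('d)"
  let ?H = "\<lambda>A. hausdorff_outer ?d A"
  define P where "P X \<longleftrightarrow> (\<exists>c>0. \<exists>C>0. \<exists>r0>0. \<forall>x\<in>X. \<forall>r. 0 < r \<and> r \<le> r0 \<longrightarrow>
     ennreal (c * r ^ ?d) \<le> ?H (M \<inter> ball x r) \<and> ?H (M \<inter> ball x r) \<le> ennreal (C * r ^ ?d))" for X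
  have "\<forall>p\<in>M. \<exists>\<delta>>0. P (M \<inter> ball p \<delta>)"
  proof
    fix p assume "p \<in> M"
    then obtain \<delta> c C r0 where "\<delta> > 0" "c > 0" "C > 0" "r0 > 0"
      "\<And>x r. x \<in> M \<inter> ball p \<delta> \<Longrightarrow> 0 < r \<Longrightarrow> r \<le> r0 \<Longrightarrow>
        ennreal (c * r ^ ?d) \<le> ?H (M \<inter> ball x r) \<and> ?H (M \<inter> ball x r) \<le> ennreal (C * r ^ ?d)"
      using submanifold_volume_bounds_local[OF M, of p] by metis
    then show "\<exists>\<delta>>0. P (M \<inter> ball p \<delta>)" unfolding P_def by blast
  qed
  then obtain \<delta> where \<delta>: "\<And>p. p \<in> M \<Longrightarrow> \<delta> p > 0" "\<And>p. p \<in> M \<Longrightarrow> P (M \<inter> ball p (\<delta> p))"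
    by metis
  have "M \<subseteq> (\<Union>p\<in>M. ball p (\<delta> p))" using \<delta>(1) by auto
  then obtain T where T: "T \<subseteq> M" "finite T" "M \<subseteq> (\<Union>p\<in>T. ball p (\<delta> p))"
    using compactE_image[OF cpt, of M "\<lambda>p. ball p (\<delta> p)"] by auto
  have Pun: "P (X \<union> Y)" if PX: "P X" and PY: "P Y" for X Y
  proof -
    obtain c C r where X: "c > 0" "C > 0" "r > 0" "\<And>x \<rho>. x \<in> X \<Longrightarrow> 0 < \<rho> \<Longrightarrow> \<rho> \<le> r \<Longrightarrow>
      ennreal (c * \<rho> ^ ?d) \<le> ?H (M \<inter> ball x \<rho>) \<and> ?H (M \<inter> ball x \<rho>) \<le> ennreal (C * \<rho> ^ ?d)"
      using PX unfolding P_def by metis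
    obtain c' C' r' where Y: "c' > 0" "C' > 0" "r' > 0" "\<And>x \<rho>. x \<in> Y \<Longrightarrow> 0 < \<rho> \<Longrightarrow> \<rho> \<le> r' \<Longrightarrow>
      ennreal (c' * \<rho> ^ ?d) \<le> ?H (M \<inter> ball x \<rho>) \<and> ?H (M \<inter> ball x \<rho>) \<le> ennreal (C' * \<rho> ^ ?d)"
      using PY unfolding P_def by metis
    have "ennreal (min c c' * \<rho> ^ ?d) \<le> ?H (M \<inter> ball x \<rho>) \<and> ?H (M \<inter> ball x \<rho>) \<le> ennreal (max C C' * \<rho> ^ ?d)"
      if x: "x \<in> X \<union> Y" and \<rho>: "0 < \<rho>" "\<rho> \<le> min r r'" for x \<rho>
    proof -
      have p: "\<rho> ^ ?d \<ge> 0" using \<rho> by simp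
      have "ennreal (min c c' * \<rho> ^ ?d) \<le> ennreal (c * \<rho> ^ ?d)" "ennreal (min c c' * \<rho> ^ ?d) \<le> ennreal (c' * \<rho> ^ ?d)"
        "ennreal (C * \<rho> ^ ?d) \<le> ennreal (max C C' * \<rho> ^ ?d)" "ennreal (C' * \<rho> ^ ?d) \<le> ennreal (max C C' * \<rho> ^ ?d)"
        using p by (auto intro!: ennreal_leI mult_right_mono)
      moreover have "x \<in> X \<or> x \<in> Y" using x by blast
      ultimately show ?thesis using X(4)[of x \<rho>] Y(4)[of x \<rho>] \<rho> by (auto intro: order_trans)
    qed
    moreover have "min c c' > 0" "max C C' > 0" "min r r' > 0" using X(1-3) Y(1-3) by auto
    ultimately show ?thesis unfolding P_def by blast
  qed
  have "P (\<Union>p\<in>T. M \<inter> ball p (\<delta> p))" using T(2,1)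
  proof (induction T rule: finite_induct)
    case empty
    then show ?case by (auto simp: P_def intro!: exI[of _ 1])
  next
    case (insert p T)
    then show ?case using Pun[of "M \<inter> ball p (\<delta> p)"] \<delta>(2)[of p] by simp
  qed
  moreover have "(\<Union>p\<in>T. M \<inter> ball p (\<delta> p)) = M" using T by auto
  ultimately obtain c C r0 where c: "c > 0" "C > 0" "r0 > 0"
    "\<And>x r. x \<in> M \<Longrightarrow> 0 < r \<Longrightarrow> r \<le> r0 \<Longrightarrow>
      ennreal (c * r ^ ?d) \<le> ?H (M \<inter> ball x r) \<and> ?H (M \<inter> ball x r) \<le> ennreal (C * r ^ ?d)"
    unfolding P_def by auto
  define V where "V = enn2real (?H M)"
  have V: "?H M = ennreal V" "V \<ge> 0" using fin by (auto simp: V_def)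
  show thesis
  proof (rule that[of c "C + V / r0 ^ ?d" r0])
    show "?H (M \<inter> ball x r) \<le> ennreal ((C + V / r0 ^ ?d) * r ^ ?d)" if x: "x \<in> M" "0 < r" for x r
    proof (cases "r \<le> r0")
      case True
      then have "?H (M \<inter> ball x r) \<le> ennreal (C * r ^ ?d)" using c x by blast
      also have "\<dots> \<le> ennreal ((C + V / r0 ^ ?d) * r ^ ?d)"
        using V c x by (intro ennreal_leI mult_right_mono) auto
      finally show ?thesis .
    next
      case False
      have "?H (M \<inter> ball x r) \<le> ennreal V" using hausdorff_outer_mono[of "M \<inter> ball x r" M ?d] by (simp add: V)
      also have "V \<le> (V / r0 ^ ?d) * r ^ ?d"
        using V c False by (simp add: field_simps mult_left_mono power_mono)
      then have "ennreal V \<le> ennreal ((C + V / r0 ^ ?d) * r ^ ?d)"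
        using c x by (intro ennreal_leI) (auto simp: distrib_right intro: add_nonneg_nonneg order_trans)
      finally show ?thesis .
    qed
  qed (use c V in \<open>auto intro: add_pos_nonneg\<close>)
qed

section \<open>Positive reach\<close>

lemma dist_eq_infdist_iff:
  assumes "x \<in> M"
  shows "dist y x = infdist y M \<longleftrightarrow> (\<forall>w\<in>M. dist y x \<le> dist y w)"
proof
  assume "\<forall>w\<in>M. dist y x \<le> dist y w"
  then have "dist y x \<le> infdist y M"
    using assms by (auto simp: infdist_def intro!: cINF_greatest)
  then show "dist y x = infdist y M" using infdist_le[OF assms, of y] by simp
qed (auto intro: infdist_le)

lemma proj_onto:
  assumes "compact M" "M \<noteq> {}"
  shows "proj_onto M z \<in> M" "dist z (proj_onto M z) = infdist z M"
proof -
  obtain x where "x \<in> M" "infdist z M = dist z x"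
    using infdist_attains_inf[OF compact_imp_closed[OF assms(1)] assms(2)] by blast
  then have "proj_onto M z \<in> M \<and> dist z (proj_onto M z) = infdist z M"
    unfolding proj_onto_def using someI[of "\<lambda>x. x \<in> M \<and> dist z x = infdist z M" x] by simp
  then show "proj_onto M z \<in> M" "dist z (proj_onto M z) = infdist z M" by auto
qed

lemma reach_ge_unique:
  assumes "reach_ge M \<tau>" "infdist y M < \<tau>" "x \<in> M" "dist y x = infdist y M" "x' \<in> M" "dist y x' = infdist y M"
  shows "x = x'"
  using assms unfolding reach_ge_def by blast

text \<open>A limit of foot points is a foot point of the limit, and within the reach there is only
  one; compactness of \<open>M\<close> supplies the convergent subsequence. Brouwer's theorem is
  applied to a map built from this projection.\<close>

lemma continuous_on_proj_onto:
  fixes M :: "(real^'D::finite) set"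
  assumes cpt: "compact M" "M \<noteq> {}" and reach: "reach_ge M \<tau>"
    and S: "\<And>y. y \<in> S \<Longrightarrow> infdist y M < \<tau>"
  shows "continuous_on S (proj_onto M)"
proof (rule continuous_on_sequentiallyI)
  fix y l assume y: "\<forall>n. y n \<in> S" and l: "l \<in> S" and lim: "y \<longlonglongrightarrow> l"
  let ?p = "proj_onto M"
  show "(\<lambda>n. ?p (y n)) \<longlonglongrightarrow> ?p l"
  proof (rule ccontr)
    assume "\<not> ?thesis"
    then obtain e where e: "e > 0" "\<And>N. \<exists>n\<ge>N. dist (?p (y n)) (?p l) \<ge> e"
      unfolding lim_sequentially by (meson not_le)
    have "\<exists>r :: nat \<Rightarrow> nat. strict_mono r \<and> (\<forall>n. dist (?p (y (r n))) (?p l) \<ge> e)"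
      using infinite_enumerate[of "{n. dist (?p (y n)) (?p l) \<ge> e}"] e(2)
      by (auto simp: infinite_nat_iff_unbounded_le)
    then obtain r :: "nat \<Rightarrow> nat" where r': "strict_mono r \<and> (\<forall>n. e \<le> dist (?p (y (r n))) (?p l))" ..
    then have r: "strict_mono r" "\<And>n. e \<le> dist (?p (y (r n))) (?p l)" by auto
    have "\<forall>n. ?p (y (r n)) \<in> M" using proj_onto[OF cpt] by auto
    then obtain q s where q: "q \<in> M" "strict_mono s" "((\<lambda>n. ?p (y (r n))) \<circ> s) \<longlonglongrightarrow> q"
      using cpt(1) unfolding compact_def by metis
    have lim': "(\<lambda>n. y (r (s n))) \<longlonglongrightarrow> l"
      using LIMSEQ_subseq_LIMSEQ[OF LIMSEQ_subseq_LIMSEQ[OF lim r(1)] q(2)] by (simp add: o_def)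
    have q': "(\<lambda>n. ?p (y (r (s n)))) \<longlonglongrightarrow> q" using q(3) by (simp add: o_def)
    have "(\<lambda>n. dist (y (r (s n))) (?p (y (r (s n))))) \<longlonglongrightarrow> dist l q"
      by (intro tendsto_dist lim' q')
    moreover have "(\<lambda>n. infdist (y (r (s n))) M) \<longlonglongrightarrow> infdist l M"
      by (intro tendsto_infdist lim')
    ultimately have "dist l q = infdist l M"
      using proj_onto[OF cpt] LIMSEQ_unique by auto
    then have "q = ?p l"
      using reach_ge_unique[OF reach S[OF l] q(1)] proj_onto[OF cpt, of l] by blast
    then have "(\<lambda>n. dist (?p (y (r (s n)))) (?p l)) \<longlonglongrightarrow> 0"
      using q' by (simp add: tendsto_dist_iff[symmetric])
    then have "e \<le> 0" using r(2) by (intro LIMSEQ_le_const) auto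
    with e(1) show False by simp
  qed
qed

text \<open>Extending a normal segment: a fixed point w of the map sending w to the point at distance
  e behind y, seen from the foot point of w, has y between w and its foot point, so both have the
  same foot point.\<close>

lemma normal_segment_extend:
  fixes M :: "(real^'D::finite) set"
  assumes cpt: "compact M" "M \<noteq> {}" and reach: "reach_ge M \<tau>"
    and p: "p \<in> M" and v: "norm v = 1" and s: "s > 0" "infdist (p + s *\<^sub>R v) M = s"
    and e: "e > 0" "s + e < \<tau>"
  shows "infdist (p + (s + e) *\<^sub>R v) M = s + e"
proof -
  define y where "y = p + s *\<^sub>R v"
  let ?p = "proj_onto M"
  have inf: "infdist w M < \<tau>" if "w \<in> cball y e" for w
    using infdist_triangle[of w M y] that s e by (simp add: y_def dist_commute)
  \<comment> \<open>Keeps the denominator in \<open>g\<close> away from 0.\<close>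
  have yn: "y \<noteq> q" if "q \<in> M" for q
    using infdist_le[OF that, of y] s by (auto simp: y_def)
  define g where "g w = y + e *\<^sub>R ((y - ?p w) /\<^sub>R norm (y - ?p w))" for w
  have "continuous_on (cball y e) g" unfolding g_def
    using yn proj_onto(1)[OF cpt] inf
    by (intro continuous_intros continuous_on_proj_onto[OF cpt reach]) auto
  moreover have "g \<in> cball y e \<rightarrow> cball y e"
  proof
    fix w
    have "norm ((y - ?p w) /\<^sub>R norm (y - ?p w)) = 1" using yn[OF proj_onto(1)[OF cpt]] by simp
    then have "norm (g w - y) \<le> e" using e unfolding g_def by simp
    then show "g w \<in> cball y e" by (simp add: dist_norm norm_minus_commute)
  qed
  ultimately obtain w where w: "w \<in> cball y e" "g w = w"
    using brouwer[of "cball y e" g] e by (metis compact_cball convex_cball cball_eq_empty not_le order.asym)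
  define q where "q = ?p w"
  define u where "u = (y - q) /\<^sub>R norm (y - q)"
  have q: "q \<in> M" "dist w q = infdist w M" using proj_onto[OF cpt] by (auto simp: q_def)
  have npos: "norm (y - q) > 0" using yn[OF q(1)] by simp
  then have u: "norm u = 1" "y - q = norm (y - q) *\<^sub>R u" by (auto simp: u_def)
  have wy: "w = y + e *\<^sub>R u" using w(2) by (simp add: g_def q_def u_def)
  have "w - q = (y - q) + e *\<^sub>R u" by (simp add: wy)
  also have "\<dots> = (norm (y - q) + e) *\<^sub>R u" by (subst u(2)) (simp add: scaleR_add_left)
  finally have wq: "norm (w - q) = norm (y - q) + e" using u(1) e by simp
  \<comment> \<open>\<open>y\<close> lies on the segment from \<open>w\<close> to \<open>q\<close>
    at distance \<open>e\<close> from \<open>w\<close>, so a point of \<open>M\<close> closer to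
    \<open>y\<close> than \<open>q\<close> would also be closer to \<open>w\<close>.\<close>
  have "dist y q \<le> dist y x" if "x \<in> M" for x
  proof -
    have "dist w q \<le> dist w x" using q(2) infdist_le[OF that, of w] by simp
    also have "\<dots> \<le> dist w y + dist y x" by (rule dist_triangle)
    also have "dist w y = e" using u(1) e by (simp add: wy dist_norm)
    finally show ?thesis using wq by (simp add: dist_norm)
  qed
  then have "dist y q = infdist y M" using dist_eq_infdist_iff[OF q(1)] by blast
  moreover have "dist y p = infdist y M" using s v by (simp add: y_def dist_norm)
  ultimately have "q = p"
    using reach_ge_unique[OF reach inf[of y] q(1) _ p] e by auto
  then have "u = v" using s v by (simp add: u_def y_def)
  then have "w = p + (s + e) *\<^sub>R v" by (simp add: wy y_def scaleR_add_left)
  moreover have "infdist w M = s + e"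
    using q(2) wq \<open>q = p\<close> s v by (simp add: dist_norm y_def)
  ultimately show ?thesis by simp
qed

text \<open>The parameters for which \<open>p\<close> is a foot point form an interval starting at
  0, since a move towards \<open>p\<close> shortens the distance to \<open>M\<close> by at most its
  length (\<open>down\<close>). The interval is closed, and if its largest element \<open>s\<close>
  in [0, t] were below \<open>t\<close>, the extension lemma with step \<open>t - s\<close> would
  still reach \<open>t\<close>.\<close>

lemma normal_segment_full:
  fixes M :: "(real^'D::finite) set"
  assumes cpt: "compact M" "M \<noteq> {}" and reach: "reach_ge M \<tau>"
    and p: "p \<in> M" and v: "norm v = 1" and t0: "t0 > 0" "infdist (p + t0 *\<^sub>R v) M = t0"
    and t: "0 < t" "t < \<tau>"
  shows "infdist (p + t *\<^sub>R v) M = t"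
proof (rule ccontr)
  assume neg: "\<not> ?thesis"
  have down: "infdist (p + s *\<^sub>R v) M = s" if "0 \<le> s" "s \<le> s'" "infdist (p + s' *\<^sub>R v) M = s'" for s s'
  proof (rule antisym)
    show "infdist (p + s *\<^sub>R v) M \<le> s"
      using infdist_le[OF p, of "p + s *\<^sub>R v"] v that by (simp add: dist_norm)
    have "dist (p + s' *\<^sub>R v) (p + s *\<^sub>R v) = s' - s"
      using v that by (simp add: dist_norm scaleR_diff_left[symmetric])
    then show "s \<le> infdist (p + s *\<^sub>R v) M"
      using infdist_triangle[of "p + s' *\<^sub>R v" M "p + s *\<^sub>R v"] that by linarith
  qed
  define S where "S = {0..t} \<inter> {s. infdist (p + s *\<^sub>R v) M = s}"
  have tt0: "t0 < t" using neg down[of t t0] t t0 by force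
  have "closed {s. infdist (p + s *\<^sub>R v) M = s}"
    by (intro closed_Collect_eq continuous_intros)
  then have "closed S" unfolding S_def by (intro closed_Int) auto
  moreover have "bounded S" using bounded_closed_interval[of 0 t] by (rule bounded_subset) (auto simp: S_def)
  moreover have "t0 \<in> S" using tt0 t0 by (auto simp: S_def)
  ultimately obtain s where s: "s \<in> S" "\<And>r. r \<in> S \<Longrightarrow> r \<le> s"
    using compact_attains_sup[of S] by (auto simp: compact_eq_bounded_closed)
  have "s \<ge> t0" using s \<open>t0 \<in> S\<close> by blast
  moreover have "s < t" using s(1) neg by (auto simp: S_def less_le)
  ultimately have "infdist (p + (s + (t - s)) *\<^sub>R v) M = s + (t - s)"
    using s(1) t t0 by (intro normal_segment_extend[OF cpt reach p v]) (auto simp: S_def)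
  with neg show False by simp
qed

text \<open>Federer's inequality up to a factor 2. A quadratic bound with any \<open>K\<close>
  whatever shows that some small ball touching \<open>M\<close> at \<open>p\<close> has no point of
  \<open>M\<close> in its interior. Prolonging the normal segment gives the same for radius
  \<tau>/2, and expanding the squared distance from the centre of that ball to \<open>x\<close>
  replaces \<open>K\<close> by 1/\<tau>.\<close>

lemma normal_inner_le:
  fixes M :: "(real^'D::finite) set"
  assumes cpt: "compact M" "M \<noteq> {}" and reach: "reach_ge M \<tau>" "\<tau> > 0"
    and p: "p \<in> M" and v: "norm v = 1"
    and K: "\<And>x. x \<in> M \<Longrightarrow> v \<bullet> (x - p) \<le> K * (norm (x - p))\<^sup>2" and x: "x \<in> M"
  shows "v \<bullet> (x - p) \<le> (norm (x - p))\<^sup>2 / \<tau>"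
proof -
  have expand: "(norm (p + t *\<^sub>R v - x))\<^sup>2 = (norm (x - p))\<^sup>2 - 2 * t * (v \<bullet> (x - p)) + t\<^sup>2" for t x
  proof -
    have "p + t *\<^sub>R v - x = t *\<^sub>R v - (x - p)" by simp
    then have "(norm (p + t *\<^sub>R v - x))\<^sup>2 = (norm (t *\<^sub>R v))\<^sup>2 - 2 * (t *\<^sub>R v \<bullet> (x - p)) + (norm (x - p))\<^sup>2"
      by (simp only: power2_norm_eq_inner inner_diff_left inner_diff_right inner_commute) simp
    then show ?thesis using v by simp
  qed
  \<comment> \<open>Makes \<open>2 * t0 * (\<bar>K\<bar> + 1)\<close> equal to 1, so that the cross
    term in \<open>expand\<close> is at most the square of |w - p|.\<close>
  define t0 where "t0 = 1 / (2 * (\<bar>K\<bar> + 1))"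
  have t0: "t0 > 0" by (simp add: t0_def add_nonneg_pos)
  have "infdist (p + t0 *\<^sub>R v) M = dist (p + t0 *\<^sub>R v) p"
  proof (rule sym, subst dist_eq_infdist_iff[OF p], safe)
    fix w assume w: "w \<in> M"
    have "2 * t0 * (v \<bullet> (w - p)) \<le> 2 * t0 * (K * (norm (w - p))\<^sup>2)"
      using K[OF w] t0 by (intro mult_left_mono) auto
    also have "\<dots> \<le> 2 * t0 * ((\<bar>K\<bar> + 1) * (norm (w - p))\<^sup>2)"
      using t0 by (intro mult_left_mono mult_right_mono) auto
    also have "\<dots> = (2 * t0 * (\<bar>K\<bar> + 1)) * (norm (w - p))\<^sup>2" by simp
    also have "2 * t0 * (\<bar>K\<bar> + 1) = 1" by (simp add: t0_def)
    finally have "t0\<^sup>2 \<le> (norm (p + t0 *\<^sub>R v - w))\<^sup>2" by (simp add: expand)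
    then have "t0 \<le> norm (p + t0 *\<^sub>R v - w)" by (rule power2_le_imp_le) simp
    then show "dist (p + t0 *\<^sub>R v) p \<le> dist (p + t0 *\<^sub>R v) w" using v t0 by (simp add: dist_norm)
  qed
  also have "\<dots> = t0" using v t0 by (simp add: dist_norm)
  finally have "infdist (p + t0 *\<^sub>R v) M = t0" .
  then have "infdist (p + (\<tau>/2) *\<^sub>R v) M = \<tau>/2"
    by (rule normal_segment_full[OF cpt reach(1) p v t0]) (use reach(2) in simp_all)
  then have "\<tau>/2 \<le> norm (p + (\<tau>/2) *\<^sub>R v - x)"
    using infdist_le[OF x, of "p + (\<tau>/2) *\<^sub>R v"] by (simp add: dist_norm)
  then have "(\<tau>/2)\<^sup>2 \<le> (norm (p + (\<tau>/2) *\<^sub>R v - x))\<^sup>2" using reach by (intro power_mono) auto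
  then have "\<tau> * (v \<bullet> (x - p)) \<le> (norm (x - p))\<^sup>2" by (simp add: expand)
  then show ?thesis using reach by (simp add: field_simps)
qed

section \<open>Normal projections\<close>

lemma frob_norm_eq_norm: "frob_norm A = norm A"
  unfolding frob_norm_def norm_vec_def L2_set_def by (simp add: sum_nonneg)

lemma orth_projD:
  fixes P :: "real^'D::finite^'D"
  assumes "orth_proj P"
  shows "P *v (P *v x) = P *v x" and "(P *v x) \<bullet> y = x \<bullet> (P *v y)"
proof -
  show "P *v (P *v x) = P *v x" using assms by (simp add: orth_proj_def matrix_vector_mul_assoc)
  have "(P *v x) \<bullet> y = (x v* transpose P) \<bullet> y" by simp
  also have "\<dots> = x \<bullet> (P *v y)" using assms by (simp add: orth_proj_def dot_lmul_matrix)
  finally show "(P *v x) \<bullet> y = x \<bullet> (P *v y)" .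
qed

lemma orth_proj_inner_self:
  fixes P :: "real^'D::finite^'D"
  assumes "orth_proj P"
  shows "(P *v x) \<bullet> x = (norm (P *v x))\<^sup>2"
  using orth_projD[OF assms] by (metis power2_norm_eq_inner)

lemma orth_proj_complement:
  fixes P :: "real^'D::finite^'D"
  assumes "orth_proj P"
  shows "orth_proj (mat 1 - P)"
  unfolding orth_proj_def
proof
  have "((mat 1 - P) ** (mat 1 - P)) *v x = (mat 1 - P) *v x" for x
    using orth_projD(1)[OF assms, of x]
    by (simp add: matrix_vector_mul_assoc[symmetric] matrix_vector_mult_diff_rdistrib matrix_vector_mult_diff_distrib)
  then show "(mat 1 - P) ** (mat 1 - P) = mat 1 - P" by (simp add: matrix_eq)
  have "transpose (mat 1 - P) = mat 1 - transpose P"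
    by (simp add: vec_eq_iff transpose_def mat_def)
  then show "transpose (mat 1 - P) = mat 1 - P" using assms by (simp add: orth_proj_def)
qed

lemma orth_proj_norm_le:
  fixes P :: "real^'D::finite^'D"
  assumes "orth_proj P"
  shows "norm (P *v x) \<le> norm x"
proof -
  have "(norm (P *v x))\<^sup>2 \<le> norm (P *v x) * norm x"
    using orth_proj_inner_self[OF assms, of x] norm_cauchy_schwarz[of "P *v x" x] by simp
  then show ?thesis by (cases "norm (P *v x) = 0") (auto simp: power2_eq_square)
qed

text \<open>Each projection fixes the range of the other, so Q P = P and P Q = Q; transposing the
  first identity gives P Q = P.\<close>

lemma orth_proj_unique:
  fixes P Q :: "real^'D::finite^'D"
  assumes P: "orth_proj P" and Q: "orth_proj Q" and r: "range ((*v) P) = range ((*v) Q)"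
  shows "P = Q"
proof -
  have fix1: "A *v (B *v x) = B *v x"
    if A: "orth_proj A" and r: "range ((*v) A) = range ((*v) B)" for A B :: "real^'D^'D" and x
  proof -
    obtain y where "B *v x = A *v y" using r by (metis rangeI image_iff)
    then show ?thesis using orth_projD(1)[OF A] by simp
  qed
  have "P *v x = Q *v x" for x
  proof -
    have "(P *v x) \<bullet> y = (Q *v x) \<bullet> y" for y
    proof -
      have "(P *v x) \<bullet> y = (Q *v (P *v x)) \<bullet> y" using fix1[OF Q, of P] r by simp
      also have "\<dots> = x \<bullet> (P *v (Q *v y))" using orth_projD(2)[OF P] orth_projD(2)[OF Q] by simp
      also have "\<dots> = x \<bullet> (Q *v y)" using fix1[OF P r] by simp
      also have "\<dots> = (Q *v x) \<bullet> y" using orth_projD(2)[OF Q] by simp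
      finally show ?thesis .
    qed
    then show ?thesis by (metis vector_eq_rdot)
  qed
  then show ?thesis by (simp add: matrix_eq)
qed

lemma orth_proj_exists:
  fixes S :: "(real^'D::finite) set"
  assumes S: "subspace S"
  shows "\<exists>P. orth_proj P \<and> range ((*v) P) = S"
proof -
  obtain B where B: "B \<subseteq> S" "pairwise orthogonal B" "\<And>x. x \<in> B \<Longrightarrow> norm x = 1"
    "independent B" "span B = S"
    using orthonormal_basis_subspace[OF S] by metis
  have fin: "finite B" using B(4) by (rule independent_imp_finite)
  define f where "f x = (\<Sum>b\<in>B. (x \<bullet> b) *\<^sub>R b)" for x
  have lin: "linear f"
    unfolding f_def by (intro linearI) (simp_all add: inner_add_left scaleR_add_left sum.distrib scaleR_sum_right)
  have fS: "f x \<in> S" for x unfolding f_def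
    using S B(1) by (intro subspace_sum subspace_scale) auto
  have fb: "f x \<bullet> b = x \<bullet> b" if b: "b \<in> B" for x b
  proof -
    have "f x \<bullet> b = (\<Sum>c\<in>B. (x \<bullet> c) * (c \<bullet> b))" by (simp add: f_def inner_sum_left)
    also have "\<dots> = (\<Sum>c\<in>B. if c = b then x \<bullet> b else 0)"
      using B(2,3) b by (intro sum.cong) (auto simp: pairwise_def orthogonal_def norm_eq_1)
    finally show ?thesis using fin b by simp
  qed
  have fid: "f x = x" if x: "x \<in> S" for x
  proof -
    have "orthogonal (f x - x) y" if "y \<in> span B" for y
      using that fb by (intro orthogonal_to_span[of y B]) (auto simp: orthogonal_def inner_diff_left)
    moreover have "f x - x \<in> span B" using x fS B(5) S by (auto intro: subspace_diff)
    ultimately have "orthogonal (f x - x) (f x - x)" by blast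
    then show ?thesis by (simp add: orthogonal_self)
  qed
  have sym: "f x \<bullet> y = x \<bullet> f y" for x y
    by (simp add: f_def inner_sum_left inner_sum_right inner_commute mult.commute)
  define P where "P = matrix f"
  have Pf: "P *v x = f x" for x unfolding P_def using lin by simp
  have "orth_proj P" unfolding orth_proj_def
  proof
    have "(P ** P) *v x = P *v x" for x
      using fid[OF fS, of x] by (simp add: matrix_vector_mul_assoc[symmetric] Pf)
    then show "P ** P = P" by (simp add: matrix_eq)
    have "f (axis i 1) $ j = f (axis j 1) $ i" for i j
      using sym[of "axis i 1" "axis j 1"] by (simp add: cart_eq_inner_axis inner_commute)
    then show "transpose P = P" by (simp add: P_def vec_eq_iff transpose_def matrix_def)
  qed
  moreover have "range ((*v) P) = S"
    using fS fid by (auto simp: Pf image_iff) metis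
  ultimately show ?thesis by blast
qed

text \<open>\<open>normal_proj\<close> is a definite description and says nothing before existence
  and uniqueness are known. Existence rests on the fact that the orthogonal complement of any set is
  a subspace, here applied to a set of velocities gathered from all charts.\<close>

lemma normal_proj_spec:
  fixes M :: "(real^'D::finite) set"
  shows "orth_proj (normal_proj T M x)"
    and "range ((*v) (normal_proj T M x)) = orthogonal_comp (tangent_space T M x)"
proof -
  have "\<exists>!P. orth_proj P \<and> range ((*v) P) = orthogonal_comp (tangent_space T M x)"
    using orth_proj_exists[OF subspace_orthogonal_comp, of "tangent_space T M x"] orth_proj_unique by metis
  from theI'[OF this] show "orth_proj (normal_proj T M x)"
    "range ((*v) (normal_proj T M x)) = orthogonal_comp (tangent_space T M x)"
    unfolding normal_proj_def by auto
qed

lemma normal_proj_fixes: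
  fixes M :: "(real^'D::finite) set"
  assumes "v \<in> orthogonal_comp (tangent_space T M x)"
  shows "normal_proj T M x *v v = v"
  using assms normal_proj_spec[of T M x] orth_projD(1)[of "normal_proj T M x"] by (metis imageE)

section \<open>First and second order contact of M with its tangent space\<close>

lemma orthogonal_comp_tangent:
  assumes "v \<in> orthogonal_comp (tangent_space T M p)" "is_chart T M U \<phi> J W" "u \<in> U" "\<phi> u = p"
  shows "v \<bullet> (J u *v h) = 0"
proof -
  have "J u *v h \<in> tangent_space T M p" using assms unfolding tangent_space_def by blast
  then show ?thesis using assms(1) by (auto simp: orthogonal_comp_def orthogonal_def inner_commute)
qed

lemma chart_at:
  assumes "C2_submanifold TYPE('d::finite) M" "p \<in> M"
  obtains U \<phi> J W u where "is_chart TYPE('d) M U \<phi> J W" "u \<in> U" "\<phi> u = p"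
proof -
  obtain U \<phi> J W where ch: "is_chart TYPE('d) M U \<phi> J W" "p \<in> W"
    using assms unfolding C2_submanifold_def by blast
  then have "p \<in> \<phi> ` U" using assms by (simp add: is_chart_def)
  then show thesis using ch that by blast
qed

text \<open>Near \<open>p\<close> the linear part of the chart is orthogonal to \<open>v\<close> and
  only the quadratic Taylor remainder is left; outside \<open>ball p r\<close> the length |x - p| is
  at most |x - p|^2 / r. There is no control on how \<open>K\<close> depends on \<open>p\<close> and
  \<open>v\<close>, and \<open>normal_inner_le\<close> trades it for 1/\<tau>.\<close>

lemma normal_quadratic_bound:
  fixes M :: "(real^'D::finite) set"
  assumes M: "C2_submanifold TYPE('d::finite) M" and p: "p \<in> M"
    and v: "v \<in> orthogonal_comp (tangent_space TYPE('d) M p)" "norm v = 1"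
  obtains K where "\<And>x. x \<in> M \<Longrightarrow> v \<bullet> (x - p) \<le> K * (norm (x - p))\<^sup>2"
proof -
  obtain U \<phi> J W u where ch: "is_chart TYPE('d) M U \<phi> J W" and u: "u \<in> U" "\<phi> u = p"
    using chart_at[OF M p] .
  obtain e a b L where e: "e > 0" and a: "a > 0" and L: "L \<ge> 0"
    and bl: "\<And>v w. v \<in> ball u e \<Longrightarrow> w \<in> ball u e \<Longrightarrow>
        a * norm (v - w) \<le> norm (\<phi> v - \<phi> w) \<and> norm (\<phi> v - \<phi> w) \<le> b * norm (v - w)"
    and quad: "\<And>v. v \<in> ball u e \<Longrightarrow> norm (\<phi> v - \<phi> u - J u *v (v - u)) \<le> L * (norm (v - u))\<^sup>2"
    using chart_local_bounds[OF ch u(1)] by metis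
  obtain r where r: "r > 0" "M \<inter> ball (\<phi> u) r \<subseteq> \<phi> ` (U \<inter> ball u e)"
    using chart_image_ball[OF ch u(1) e] .
  show thesis
  proof (rule that[of "L / a\<^sup>2 + 1 / r"])
    fix x assume x: "x \<in> M"
    have r0: "(1 / r) * (norm (x - p))\<^sup>2 \<ge> 0" using r by simp
    have a0: "L / a\<^sup>2 * (norm (x - p))\<^sup>2 \<ge> 0" using L by simp
    have le: "v \<bullet> y \<le> norm y" for y using norm_cauchy_schwarz[of v y] v(2) by simp
    show "v \<bullet> (x - p) \<le> (L / a\<^sup>2 + 1 / r) * (norm (x - p))\<^sup>2"
    proof (cases "x \<in> ball p r")
      case True
      then obtain w where w: "w \<in> ball u e" "x = \<phi> w" using r x u by blast
      have "v \<bullet> (x - p) = v \<bullet> (\<phi> w - \<phi> u - J u *v (w - u))"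
        using orthogonal_comp_tangent[OF v(1) ch u] w u by (simp add: inner_diff_right)
      also have "\<dots> \<le> L * (norm (w - u))\<^sup>2" using le quad[OF w(1)] by (rule order_trans)
      also have "\<dots> \<le> L * (norm (x - p) / a)\<^sup>2"
        using bl[of w u] w e u a L by (intro mult_left_mono power_mono) (auto simp: field_simps)
      finally show ?thesis using r0 by (simp add: power_divide algebra_simps)
    next
      case False
      then have far: "r \<le> norm (x - p)" by (simp add: dist_norm norm_minus_commute)
      have "v \<bullet> (x - p) \<le> norm (x - p)" by (rule le)
      also have "\<dots> \<le> (1 / r) * (norm (x - p))\<^sup>2"
        using far r by (simp add: power2_eq_square field_simps mult_right_mono)
      finally show ?thesis using a0 by (simp add: algebra_simps)
    qed
  qed
qed

text \<open>First order condition: in any chart the squared distance to \<open>z\<close> has a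
  minimum at the parameter of \<open>p\<close>, an interior point of the chart domain.\<close>

lemma nearest_point_normal:
  fixes M :: "(real^'D::finite) set"
  assumes p: "p \<in> M" and near: "dist z p = infdist z M"
  shows "z - p \<in> orthogonal_comp (tangent_space TYPE('d::finite) M p)"
proof -
  have "(J u *v h) \<bullet> (z - p) = 0" if ch: "is_chart TYPE('d) M U \<phi> J W" and u: "u \<in> U" "\<phi> u = p" for U \<phi> J W u h
  proof -
    have U: "open U" and der: "(\<phi> has_derivative (\<lambda>h. J u *v h)) (at u)" and im: "\<phi> ` U = M \<inter> W"
      using ch u by (auto simp: is_chart_def)
    have "((\<lambda>v. (z - \<phi> v) \<bullet> (z - \<phi> v)) has_derivative
        (\<lambda>h. (z - \<phi> u) \<bullet> (0 - J u *v h) + (0 - J u *v h) \<bullet> (z - \<phi> u))) (at u)"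
      by (intro has_derivative_inner has_derivative_diff has_derivative_const der)
    then have "(\<lambda>h. (z - \<phi> u) \<bullet> (0 - J u *v h) + (0 - J u *v h) \<bullet> (z - \<phi> u)) = (\<lambda>h. 0)"
    proof (rule differential_zero_maxmin[OF u(1) U], intro disjI2 ballI)
      fix y assume "y \<in> U"
      then have "\<phi> y \<in> M" using im by blast
      then have "dist z p \<le> dist z (\<phi> y)" using near infdist_le by metis
      then show "(z - \<phi> u) \<bullet> (z - \<phi> u) \<le> (z - \<phi> y) \<bullet> (z - \<phi> y)"
        using u(2) by (simp add: dist_norm norm_le)
    qed
    from fun_cong[OF this, of h] show ?thesis using u(2) by (simp add: inner_commute)
  qed
  then show ?thesis unfolding orthogonal_comp_def tangent_space_def orthogonal_def by auto
qed

text \<open>For the unit vector \<open>v\<close> in the direction of the projected difference, the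
  inner product with x - p is the norm of that projection, so the bound for inner products becomes
  one for the norm.\<close>

lemma normal_proj_diff_le:
  fixes M :: "(real^'D::finite) set"
  assumes M: "C2_submanifold TYPE('d::finite) M" and cpt: "compact M"
    and reach: "reach_ge M \<tau>" "\<tau> > 0" and p: "p \<in> M" and x: "x \<in> M"
  shows "norm (normal_proj TYPE('d) M p *v (x - p)) \<le> (norm (x - p))\<^sup>2 / \<tau>"
proof (cases "normal_proj TYPE('d) M p *v (x - p) = 0")
  case False
  let ?N = "normal_proj TYPE('d) M p"
  let ?w = "?N *v (x - p)"
  define v where "v = ?w /\<^sub>R norm ?w"
  have v: "norm v = 1" using False by (simp add: v_def)
  have "?w \<in> orthogonal_comp (tangent_space TYPE('d) M p)" using normal_proj_spec(2) by blast
  then have vn: "v \<in> orthogonal_comp (tangent_space TYPE('d) M p)"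
    unfolding v_def by (intro subspace_scale subspace_orthogonal_comp)
  obtain K where K: "\<And>x. x \<in> M \<Longrightarrow> v \<bullet> (x - p) \<le> K * (norm (x - p))\<^sup>2"
    using normal_quadratic_bound[OF M p vn v] by blast
  have "v \<bullet> (x - p) = (norm ?w)\<^sup>2 / norm ?w"
    using orth_proj_inner_self[OF normal_proj_spec(1), of "TYPE('d)" M p "x - p"]
    by (simp add: v_def divide_inverse mult.commute)
  also have "\<dots> = norm ?w" using False by (simp add: power2_eq_square)
  finally show ?thesis
    using normal_inner_le[OF cpt _ reach p v K x] p by auto
qed (use reach in simp)

section \<open>Gaussian integrals\<close>

lemma lborel_distr_reflect: "distr lborel borel (\<lambda>x. c - x) = (lborel :: 'a::euclidean_space measure)"
  using lborel_affine[of "-1" c] by (simp add: density_1)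

lemma nn_integral_lborel_reflect:
  fixes h :: "'a::euclidean_space \<Rightarrow> ennreal"
  assumes [measurable]: "h \<in> borel_measurable borel"
  shows "(\<integral>\<^sup>+x. h (c - x) \<partial>lborel) = (\<integral>\<^sup>+x. h x \<partial>lborel)"
proof -
  have "(\<integral>\<^sup>+x. h x \<partial>lborel) = (\<integral>\<^sup>+x. h x \<partial>distr lborel borel (\<lambda>x. c - x))"
    by (simp add: lborel_distr_reflect)
  also have "\<dots> = (\<integral>\<^sup>+x. h (c - x) \<partial>lborel)" by (rule nn_integral_distr) auto
  finally show ?thesis ..
qed

lemma nn_integral_lborel_shift:
  fixes h :: "'a::euclidean_space \<Rightarrow> ennreal"
  assumes [measurable]: "h \<in> borel_measurable borel"
  shows "(\<integral>\<^sup>+x. h (c + x) \<partial>lborel) = (\<integral>\<^sup>+x. h x \<partial>lborel)"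
proof -
  have "(\<integral>\<^sup>+x. h x \<partial>lborel) = (\<integral>\<^sup>+x. h x \<partial>distr lborel borel ((+) c))"
    by (simp add: lborel_distr_plus)
  also have "\<dots> = (\<integral>\<^sup>+x. h (c + x) \<partial>lborel)" by (rule nn_integral_distr) auto
  finally show ?thesis ..
qed

lemma integral_lborel_shift:
  fixes h :: "'a::euclidean_space \<Rightarrow> 'b::{banach, second_countable_topology}"
  assumes [measurable]: "h \<in> borel_measurable borel"
  shows "(\<integral>x. h (c + x) \<partial>lborel) = (\<integral>x. h x \<partial>lborel)"
proof -
  have "(\<integral>x. h x \<partial>lborel) = (\<integral>x. h x \<partial>distr lborel borel ((+) c))"
    by (simp add: lborel_distr_plus)
  also have "\<dots> = (\<integral>x. h (c + x) \<partial>lborel)" by (rule integral_distr) auto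
  finally show ?thesis ..
qed

text \<open>Uniqueness of Haar measure: both sides are translation invariant and agree on the unit
  ball.  The library's change of variables for linear maps needs a well-ordered index type.\<close>

lemma lborel_distr_orthogonal_transformation:
  fixes f :: "'a::euclidean_space \<Rightarrow> 'a"
  assumes f: "orthogonal_transformation f"
  shows "distr lborel borel f = lborel"
proof (rule measure_eqI)
  have lin: "linear f" using f by (simp add: orthogonal_transformation_linear)
  then have [measurable]: "f \<in> borel_measurable borel"
    by (intro borel_measurable_continuous_onI linear_continuous_on linear_conv_bounded_linear[THEN iffD1])
  fix A :: "'a set" assume "A \<in> sets (distr lborel borel f)"
  then have A[measurable]: "A \<in> sets borel" by simp
  define B where "B = (ball 0 1 :: 'a set)"
  have [measurable]: "B \<in> sets borel" by (simp add: B_def)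
  have fB: "indicator B (f u) = (indicator B u :: ennreal)" for u
    using f by (simp add: B_def indicator_def orthogonal_transformation_norm)
  have shift: "(\<integral>\<^sup>+u. h (f u - x) \<partial>lborel) = (\<integral>\<^sup>+u. h (f u) \<partial>lborel)"
    if [measurable]: "h \<in> borel_measurable borel" for x and h :: "'a \<Rightarrow> ennreal"
  proof -
    obtain v where "x = f v" using orthogonal_transformation_surj[OF f] by (metis surjD)
    then have "f u - x = f (- v + u)" for u using lin by (simp add: linear_diff)
    then show ?thesis using nn_integral_lborel_shift[of "\<lambda>u. h (f u)" "- v"] by simp
  qed
  have "emeasure (distr lborel borel f) A * emeasure lborel B
      = (\<integral>\<^sup>+x. (\<integral>\<^sup>+u. indicator A (f u) \<partial>lborel) * indicator B x \<partial>lborel)"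
  proof -
    have "emeasure (distr lborel borel f) A = (\<integral>\<^sup>+u. indicator A u \<partial>distr lborel borel f)" by simp
    also have "\<dots> = (\<integral>\<^sup>+u. indicator A (f u) \<partial>lborel)" by (rule nn_integral_distr) auto
    finally show ?thesis by (simp add: nn_integral_cmult)
  qed
  also have "\<dots> = (\<integral>\<^sup>+x. (\<integral>\<^sup>+u. indicator A (f u - x) * indicator B x \<partial>lborel) \<partial>lborel)"
    by (simp add: nn_integral_multc shift)
  also have "\<dots> = (\<integral>\<^sup>+u. (\<integral>\<^sup>+x. indicator A (f u - x) * indicator B x \<partial>lborel) \<partial>lborel)"
    by (rule lborel_pair.Fubini') auto
  \<comment> \<open>The substitution of \<open>f u - x\<close> for \<open>x\<close> exchanges the
    arguments of the two indicators: now \<open>f\<close> acts inside \<open>B\<close>, which it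
    preserves, and no longer inside \<open>A\<close>.\<close>
  also have "\<dots> = (\<integral>\<^sup>+u. (\<integral>\<^sup>+x. indicator A x * indicator B (f u - x) \<partial>lborel) \<partial>lborel)"
  proof (rule nn_integral_cong)
    fix u
    show "(\<integral>\<^sup>+x. indicator A (f u - x) * indicator B x \<partial>lborel)
        = (\<integral>\<^sup>+x. indicator A x * indicator B (f u - x) \<partial>lborel)"
      using nn_integral_lborel_reflect[of "\<lambda>x. indicator A x * indicator B (f u - x)" "f u"] by simp
  qed
  also have "\<dots> = (\<integral>\<^sup>+x. (\<integral>\<^sup>+u. indicator A x * indicator B (f u - x) \<partial>lborel) \<partial>lborel)"
    by (rule lborel_pair.Fubini') auto
  also have "\<dots> = emeasure lborel A * emeasure lborel B"
    by (simp add: nn_integral_cmult nn_integral_multc shift fB)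
  finally have "emeasure (distr lborel borel f) A * emeasure lborel B = emeasure lborel A * emeasure lborel B" .
  moreover have "emeasure lborel B \<noteq> 0" "emeasure lborel B \<noteq> top"
    by (auto simp: B_def emeasure_ball less_imp_neq[OF Ball_Volume.unit_ball_vol_pos, symmetric])
  ultimately show "emeasure (distr lborel borel f) A = emeasure lborel A"
    by (simp add: ennreal_mult_cancel_left mult.commute[of _ "emeasure lborel B"])
qed simp

section \<open>Mass and tails of the isotropic Gaussian\<close>

lemma gauss_density_eq_prod:
  fixes u :: "real^'D::finite"
  assumes "\<sigma> > 0"
  shows "gauss_density \<sigma> u = (\<Prod>b\<in>Basis. normal_density 0 \<sigma> (u \<bullet> b))"
proof -
  have n: "(norm u)\<^sup>2 = (\<Sum>b\<in>Basis. (u \<bullet> b)\<^sup>2)"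
    unfolding power2_norm_eq_inner by (subst euclidean_inner) (simp only: power2_eq_square)
  have "(\<Prod>b\<in>(Basis::(real^'D) set). normal_density 0 \<sigma> (u \<bullet> b))
      = (1 / sqrt (2 * pi * \<sigma>\<^sup>2)) ^ CARD('D) * exp (\<Sum>b\<in>Basis. - (u \<bullet> b)\<^sup>2 / (2 * \<sigma>\<^sup>2))"
    by (simp add: normal_density_def prod_dividef prod.distrib exp_sum power_one_over)
  also have "(\<Sum>b\<in>Basis. - (u \<bullet> b)\<^sup>2 / (2 * \<sigma>\<^sup>2)) = - (norm u)\<^sup>2 / (2 * \<sigma>\<^sup>2)"
    unfolding n by (simp add: sum_divide_distrib[symmetric] sum_negf)
  also have "(1 / sqrt (2 * pi * \<sigma>\<^sup>2)) ^ CARD('D) = (2 * pi * \<sigma>\<^sup>2) powr (- real CARD('D) / 2)"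
  proof -
    have "1 / sqrt (2 * pi * \<sigma>\<^sup>2) = (2 * pi * \<sigma>\<^sup>2) powr (-1/2)"
      using assms by (simp add: powr_minus_divide powr_half_sqrt)
    then have "(1 / sqrt (2 * pi * \<sigma>\<^sup>2)) ^ CARD('D) = ((2 * pi * \<sigma>\<^sup>2) powr (-1/2)) powr CARD('D)"
      using assms by (subst powr_realpow) auto
    then show ?thesis by (simp add: powr_powr)
  qed
  finally show ?thesis by (simp add: gauss_density_def)
qed

lemma gauss_density_measurable [measurable]: "gauss_density \<sigma> \<in> borel_measurable borel"
  unfolding gauss_density_def by measurable

lemma gauss_density_nonneg: "gauss_density \<sigma> u \<ge> 0"
  by (simp add: gauss_density_def)

lemma gauss_density_norm_cong:
  fixes u v :: "real^'D::finite"
  shows "norm u = norm v \<Longrightarrow> gauss_density \<sigma> u = gauss_density \<sigma> v"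
  by (simp add: gauss_density_def)

lemma nn_integral_gauss_density:
  assumes "\<sigma> > 0"
  shows "(\<integral>\<^sup>+u. ennreal (gauss_density \<sigma> (u :: real^'D::finite)) \<partial>lborel) = 1"
proof -
  have "(\<integral>\<^sup>+u. ennreal (gauss_density \<sigma> (u :: real^'D)) \<partial>lborel)
      = (\<integral>\<^sup>+u. (\<Prod>b\<in>Basis. ennreal (normal_density 0 \<sigma> (u \<bullet> b))) \<partial>(lborel :: (real^'D) measure))"
    by (intro nn_integral_cong, subst gauss_density_eq_prod[OF assms]) (simp add: prod_ennreal)
  also have "\<dots> = (\<Prod>b\<in>(Basis::(real^'D) set). (\<integral>\<^sup>+x. ennreal (normal_density 0 \<sigma> x) \<partial>lborel))"
    by (rule nn_integral_lborel_prod) auto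
  also have "(\<integral>\<^sup>+x. ennreal (normal_density 0 \<sigma> x) \<partial>lborel) = 1"
    using assms by (subst nn_integral_eq_integral) auto
  finally show ?thesis by simp
qed

lemma gauss_density_integral:
  assumes "\<sigma> > 0"
  shows "integrable lborel (gauss_density \<sigma> :: real^'D::finite \<Rightarrow> real)"
    and "(\<integral>u. gauss_density \<sigma> (u :: real^'D) \<partial>lborel) = 1"
proof -
  show *: "integrable lborel (gauss_density \<sigma> :: real^'D \<Rightarrow> real)"
    using nn_integral_gauss_density[OF assms, where 'D = 'D]
    by (intro integrableI_nonneg) (auto simp: gauss_density_nonneg)
  show "(\<integral>u. gauss_density \<sigma> (u :: real^'D) \<partial>lborel) = 1"
    using nn_integral_gauss_density[OF assms, where 'D = 'D]
      nn_integral_eq_integral[OF * AE_I2[OF gauss_density_nonneg]] by simp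
qed

text \<open>One half of the exponent stays in a Gaussian of variance 2 \<sigma>^2, which integrates
  to 1; the other half is a pointwise factor that supplies the tail bounds.\<close>

lemma gauss_density_split:
  fixes u :: "real^'D::finite"
  assumes "\<sigma> > 0"
  shows "gauss_density \<sigma> u
    = 2 powr (CARD('D) / 2) * gauss_density (sqrt 2 * \<sigma>) u * exp (- (norm u)\<^sup>2 / (4 * \<sigma>\<^sup>2))"
proof -
  have "(2 * pi * (sqrt 2 * \<sigma>)\<^sup>2) powr (- real CARD('D) / 2)
      = 2 powr (- real CARD('D) / 2) * (2 * pi * \<sigma>\<^sup>2) powr (- real CARD('D) / 2)"
    using assms by (simp add: powr_mult[symmetric] power_mult_distrib)
  moreover have "2 powr (real CARD('D) / 2) * 2 powr (- real CARD('D) / 2) = (1::real)"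
    by (simp add: powr_add[symmetric])
  moreover have "exp (- (norm u)\<^sup>2 / (2 * (sqrt 2 * \<sigma>)\<^sup>2)) * exp (- (norm u)\<^sup>2 / (4 * \<sigma>\<^sup>2))
      = exp (- (norm u)\<^sup>2 / (2 * \<sigma>\<^sup>2))"
    unfolding exp_add[symmetric] by (rule arg_cong[where f = exp]) (simp add: power_mult_distrib field_simps)
  moreover have "p * q = 1 \<Longrightarrow> X = q * Y \<Longrightarrow> e1 * e2 = e \<Longrightarrow> Y * e = p * (X * e1) * e2"
    for p q X Y e1 e2 e :: real by (simp add: mult_ac)
  ultimately show ?thesis unfolding gauss_density_def by blast
qed

lemma mult_exp_neg_square_le:
  fixes t :: real
  assumes "a > 0"
  shows "t * exp (- t\<^sup>2 / a\<^sup>2) \<le> a"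
proof -
  have "t / a \<le> 1 + (t / a)\<^sup>2"
    using sum_squares_bound[of "t / a" 1] zero_le_power2[of "t / a"]
    unfolding power_one mult_1_right by linarith
  also have "\<dots> \<le> exp ((t / a)\<^sup>2)" by simp
  finally have "t / a \<le> exp (t\<^sup>2 / a\<^sup>2)" by (simp add: power_divide)
  then have "t * exp (- t\<^sup>2 / a\<^sup>2) \<le> a * exp (t\<^sup>2 / a\<^sup>2) * exp (- t\<^sup>2 / a\<^sup>2)"
    using assms by (intro mult_right_mono) (auto simp: field_simps)
  also have "\<dots> = a" by (simp add: mult.assoc exp_add[symmetric])
  finally show ?thesis .
qed

lemma square_mult_exp_neg_square_le:
  fixes t :: real
  assumes "a > 0"
  shows "t\<^sup>2 * exp (- t\<^sup>2 / a\<^sup>2) \<le> a\<^sup>2"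
proof -
  have "(t / a)\<^sup>2 \<le> exp ((t / a)\<^sup>2)" using exp_ge_add_one_self[of "(t / a)\<^sup>2"] by linarith
  then have "t\<^sup>2 / a\<^sup>2 \<le> exp (t\<^sup>2 / a\<^sup>2)" by (simp add: power_divide)
  then have "t\<^sup>2 * exp (- t\<^sup>2 / a\<^sup>2) \<le> a\<^sup>2 * exp (t\<^sup>2 / a\<^sup>2) * exp (- t\<^sup>2 / a\<^sup>2)"
    using assms by (intro mult_right_mono) (auto simp: field_simps)
  also have "\<dots> = a\<^sup>2" by (simp add: mult.assoc exp_add[symmetric])
  finally show ?thesis .
qed

lemma gauss_density_tail:
  fixes S :: "(real^'D::finite) set"
  assumes \<sigma>: "\<sigma> > 0" and S[measurable]: "S \<in> sets borel" and s: "s \<ge> 0" "\<And>u. u \<in> S \<Longrightarrow> s \<le> norm u"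
  shows "(\<integral>u. indicator S u * gauss_density \<sigma> u \<partial>lborel) \<le> 2 powr (CARD('D) / 2) * exp (- s\<^sup>2 / (4 * \<sigma>\<^sup>2))"
proof -
  let ?g = "gauss_density (sqrt 2 * \<sigma>) :: real^'D \<Rightarrow> real"
  have g: "integrable lborel ?g" "(\<integral>u. ?g u \<partial>lborel) = 1" using \<sigma> by (auto intro: gauss_density_integral)
  have "(\<integral>u. indicator S u * gauss_density \<sigma> u \<partial>lborel)
     \<le> (\<integral>u. 2 powr (CARD('D) / 2) * exp (- s\<^sup>2 / (4 * \<sigma>\<^sup>2)) * ?g u \<partial>lborel)"
  proof (rule integral_mono)
    show "integrable lborel (\<lambda>u. indicator S u * gauss_density \<sigma> u)"
      using integrable_mult_indicator[OF _ gauss_density_integral(1)[OF \<sigma>, where 'D='D], of S] by simp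
    show "integrable lborel (\<lambda>u. 2 powr (CARD('D) / 2) * exp (- s\<^sup>2 / (4 * \<sigma>\<^sup>2)) * ?g u)"
      using g by simp
    fix u :: "real^'D"
    show "indicator S u * gauss_density \<sigma> u \<le> 2 powr (CARD('D) / 2) * exp (- s\<^sup>2 / (4 * \<sigma>\<^sup>2)) * ?g u"
    proof (cases "u \<in> S")
      case True
      have "s\<^sup>2 \<le> (norm u)\<^sup>2" using s True by (intro power_mono) auto
      then have "exp (- (norm u)\<^sup>2 / (4 * \<sigma>\<^sup>2)) \<le> exp (- s\<^sup>2 / (4 * \<sigma>\<^sup>2))"
        using \<sigma> by (simp add: divide_right_mono)
      then have "2 powr (CARD('D) / 2) * ?g u * exp (- (norm u)\<^sup>2 / (4 * \<sigma>\<^sup>2))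
          \<le> 2 powr (CARD('D) / 2) * ?g u * exp (- s\<^sup>2 / (4 * \<sigma>\<^sup>2))"
        by (intro mult_left_mono) (auto simp: gauss_density_nonneg)
      then show ?thesis using True gauss_density_split[OF \<sigma>, of u] by (simp add: mult_ac)
    qed (auto simp: gauss_density_nonneg)
  qed
  then show ?thesis using g by simp
qed

text \<open>Of the pointwise factor with exponent |u|^2 / (4 \<sigma>^2), one half absorbs
  \<open>norm u\<close> at the price of \<open>sqrt 8 * \<sigma> \<le> 3 * \<sigma>\<close>, and the
  other half is small on \<open>S\<close>. Hence the 8 in the exponent where
  \<open>gauss_density_tail\<close> has 4.\<close>

lemma gauss_density_norm_tail:
  fixes S :: "(real^'D::finite) set"
  assumes \<sigma>: "\<sigma> > 0" and S[measurable]: "S \<in> sets borel" and s: "s \<ge> 0" "\<And>u. u \<in> S \<Longrightarrow> s \<le> norm u"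
  shows "integrable lborel (\<lambda>u::real^'D. norm u * gauss_density \<sigma> u)" (is ?int)
    and "(\<integral>u. indicator S u * (norm u * gauss_density \<sigma> u) \<partial>lborel)
      \<le> 2 powr (CARD('D) / 2) * (3 * \<sigma>) * exp (- s\<^sup>2 / (8 * \<sigma>\<^sup>2))"
proof -
  let ?g = "gauss_density (sqrt 2 * \<sigma>) :: real^'D \<Rightarrow> real"
  have g: "integrable lborel ?g" "(\<integral>u. ?g u \<partial>lborel) = 1" using \<sigma> by (auto intro: gauss_density_integral)
  have bound: "norm u * gauss_density \<sigma> u \<le> 2 powr (CARD('D) / 2) * (3 * \<sigma>) * exp (- r\<^sup>2 / (8 * \<sigma>\<^sup>2)) * ?g u"
    if r: "0 \<le> r" "r \<le> norm u" for u :: "real^'D" and r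
  proof -
    have sq: "(sqrt 8 * \<sigma>)\<^sup>2 = 8 * \<sigma>\<^sup>2" by (simp add: power_mult_distrib)
    have s8: "sqrt 8 \<le> 3" by (rule real_le_lsqrt) auto
    have "norm u * exp (- (norm u)\<^sup>2 / (8 * \<sigma>\<^sup>2)) \<le> sqrt 8 * \<sigma>"
      using mult_exp_neg_square_le[of "sqrt 8 * \<sigma>" "norm u"] \<sigma> by (simp add: sq)
    also have "\<dots> \<le> 3 * \<sigma>" using s8 \<sigma> by simp
    finally have 1: "norm u * exp (- (norm u)\<^sup>2 / (8 * \<sigma>\<^sup>2)) \<le> 3 * \<sigma>" .
    have "r\<^sup>2 \<le> (norm u)\<^sup>2" using r by (intro power_mono) auto
    then have 2: "exp (- (norm u)\<^sup>2 / (8 * \<sigma>\<^sup>2)) \<le> exp (- r\<^sup>2 / (8 * \<sigma>\<^sup>2))"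
      using \<sigma> by (simp add: divide_right_mono)
    have "exp (- (norm u)\<^sup>2 / (4 * \<sigma>\<^sup>2)) = exp (- (norm u)\<^sup>2 / (8 * \<sigma>\<^sup>2)) * exp (- (norm u)\<^sup>2 / (8 * \<sigma>\<^sup>2))"
      unfolding exp_add[symmetric] by simp
    then have "norm u * exp (- (norm u)\<^sup>2 / (4 * \<sigma>\<^sup>2)) \<le> (3 * \<sigma>) * exp (- r\<^sup>2 / (8 * \<sigma>\<^sup>2))"
      using mult_mono[OF 1 2] \<sigma> by (simp add: mult.assoc)
    then have "(2 powr (CARD('D) / 2) * ?g u) * (norm u * exp (- (norm u)\<^sup>2 / (4 * \<sigma>\<^sup>2)))
       \<le> (2 powr (CARD('D) / 2) * ?g u) * ((3 * \<sigma>) * exp (- r\<^sup>2 / (8 * \<sigma>\<^sup>2)))"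
      by (rule mult_left_mono) (simp add: gauss_density_nonneg)
    then show ?thesis by (simp add: gauss_density_split[OF \<sigma>, of u] mult_ac)
  qed
  show int: ?int
  proof (rule Bochner_Integration.integrable_bound)
    show "integrable lborel (\<lambda>u. 2 powr (CARD('D) / 2) * (3 * \<sigma>) * ?g u)" using g by simp
    show "AE u in lborel. norm (norm u * gauss_density \<sigma> u) \<le> norm (2 powr (CARD('D) / 2) * (3 * \<sigma>) * ?g u)"
      using bound[of 0] \<sigma> by (auto simp: gauss_density_nonneg abs_mult)
  qed simp
  have "(\<integral>u. indicator S u * (norm u * gauss_density \<sigma> u) \<partial>lborel)
     \<le> (\<integral>u. 2 powr (CARD('D) / 2) * (3 * \<sigma>) * exp (- s\<^sup>2 / (8 * \<sigma>\<^sup>2)) * ?g u \<partial>lborel)"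
  proof (rule integral_mono)
    show "integrable lborel (\<lambda>u. indicator S u * (norm u * gauss_density \<sigma> u))"
      using integrable_mult_indicator[OF _ int, of S] by simp
    show "integrable lborel (\<lambda>u. 2 powr (CARD('D) / 2) * (3 * \<sigma>) * exp (- s\<^sup>2 / (8 * \<sigma>\<^sup>2)) * ?g u)"
      using g by simp
    fix u :: "real^'D"
    show "indicator S u * (norm u * gauss_density \<sigma> u) \<le> 2 powr (CARD('D) / 2) * (3 * \<sigma>) * exp (- s\<^sup>2 / (8 * \<sigma>\<^sup>2)) * ?g u"
      using bound[of s u] s \<sigma> by (cases "u \<in> S") (auto simp: gauss_density_nonneg)
  qed
  then show "(\<integral>u. indicator S u * (norm u * gauss_density \<sigma> u) \<partial>lborel)
      \<le> 2 powr (CARD('D) / 2) * (3 * \<sigma>) * exp (- s\<^sup>2 / (8 * \<sigma>\<^sup>2))" using g by simp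
qed

section \<open>Conditioning on the window\<close>

lemma borel_measurable_matrix_vector_mult [measurable]: "(*v) (A :: real^'n::finite^'m::finite) \<in> borel_measurable borel"
  by (intro borel_measurable_continuous_onI linear_continuous_on linear_conv_bounded_linear[THEN iffD1]) simp

lemma closed_window: "closed (window (P :: real^'D::finite^'D) z r1 r2)"
proof -
  have c: "continuous_on UNIV (\<lambda>w. A *v (w - z))" for A :: "real^'D^'D"
    by (intro matrix_vector_mult_linear_continuous_on continuous_on_compose2[of UNIV "(*v) A" UNIV "\<lambda>w. w - z"] continuous_intros) auto
  show ?thesis unfolding window_def Collect_conj_eq
    by (intro closed_Int closed_Collect_le continuous_on_norm c continuous_on_const)
qed

lemma window_borel [measurable]: "window (P :: real^'D::finite^'D) z r1 r2 \<in> sets borel"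
  by (rule borel_closed[OF closed_window])

lemma window_dist_le:
  fixes P :: "real^'D::finite^'D"
  assumes "w \<in> window P z r1 r2"
  shows "norm (w - z) \<le> r1 + r2"
proof -
  have "w - z = (mat 1 - P) *v (w - z) + P *v (w - z)"
    by (simp add: matrix_vector_mult_diff_rdistrib)
  then have "norm (w - z) \<le> norm ((mat 1 - P) *v (w - z)) + norm (P *v (w - z))"
    by (metis norm_triangle_ineq)
  then show ?thesis using assms by (simp add: window_def)
qed

text \<open>\<open>2 * w\<close> is a componentwise product with a constant vector, so rules for
  \<open>*\<^sub>R\<close> do not match it.\<close>

lemma matrix_vector_mult_double: "A *v (2 * w) = 2 * (A *v w)" for A :: "real^'n::finite^'m::finite"
  by (simp only: mult_2 matrix_vector_right_distrib)

text \<open>The reflection leaves the component in the kernel of \<open>P\<close> unchanged, so only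
  the normal constraint can be violated; the violation reads r2 < |P (x - z) - P u|.\<close>

lemma window_reflect:
  fixes P :: "real^'D::finite^'D"
  assumes P: "orth_proj P" and u: "x + u \<in> window P z r1 r2" and nu: "x + (u - 2 *\<^sub>R (P *v u)) \<notin> window P z r1 r2"
  shows "r2 - norm (P *v (x - z)) \<le> norm u"
proof -
  have PP: "P *v (P *v y) = P *v y" for y using orth_projD(1)[OF P] .
  have two: "u - 2 *\<^sub>R (P *v u) = u - P *v u - P *v u" by (simp add: scaleR_2)
  have e1: "(mat 1 - P) *v (x + (u - 2 *\<^sub>R (P *v u)) - z) = (mat 1 - P) *v (x + u - z)"
    unfolding two by (simp add: matrix_vector_mult_diff_rdistrib matrix_vector_mult_diff_distrib
        matrix_vector_right_distrib PP matrix_vector_mult_double)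
  have e2: "P *v (x + (u - 2 *\<^sub>R (P *v u)) - z) = P *v (x - z) - P *v u"
    unfolding two by (simp add: matrix_vector_mult_diff_distrib matrix_vector_right_distrib PP
        matrix_vector_mult_double)
  have "r2 < norm (P *v (x - z) - P *v u)"
    using u nu by (simp add: window_def e1 e2)
  also have "\<dots> \<le> norm (P *v (x - z)) + norm (P *v u)" by (rule norm_triangle_ineq4)
  also have "norm (P *v u) \<le> norm u" by (rule orth_proj_norm_le[OF P])
  finally show ?thesis by simp
qed

section \<open>One fixed hidden point x: mass and normal noise in the window\<close>

lemma integrable_gauss_density_shift:
  fixes x :: "real^'D::finite"
  assumes \<sigma>: "\<sigma> > 0"
  shows "integrable lborel (\<lambda>y. gauss_density \<sigma> (y - x))"
proof -
  have "integrable (distr lborel borel ((+) (- x))) (gauss_density \<sigma> :: real^'D \<Rightarrow> real)"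
    using gauss_density_integral(1)[OF \<sigma>, where 'D='D] by (simp add: lborel_distr_plus)
  then have "integrable lborel (\<lambda>y. gauss_density \<sigma> (- x + y))" by (subst (asm) integrable_distr_eq) auto
  then show ?thesis by simp
qed

lemma gauss_mass_away_le:
  fixes V :: "(real^'D::finite) set"
  assumes \<sigma>: "\<sigma> > 0" and V[measurable]: "V \<in> sets borel" and s: "s \<ge> 0" "\<And>y. y \<in> V \<Longrightarrow> s \<le> norm (y - x)"
  shows "(\<integral>y. indicator V y * gauss_density \<sigma> (y - x) \<partial>lborel) \<le> 2 powr (CARD('D) / 2) * exp (- s\<^sup>2 / (4 * \<sigma>\<^sup>2))"
proof -
  have "(\<integral>y. indicator V y * gauss_density \<sigma> (y - x) \<partial>lborel) = (\<integral>u. indicator V (x + u) * gauss_density \<sigma> u \<partial>lborel)"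
    using integral_lborel_shift[of "\<lambda>y. indicator V y * gauss_density \<sigma> (y - x)" x] by simp
  also have "\<dots> = (\<integral>u. indicator {u. x + u \<in> V} u * gauss_density \<sigma> u \<partial>lborel)"
    by (simp add: indicator_def)
  also have "\<dots> \<le> 2 powr (CARD('D) / 2) * exp (- s\<^sup>2 / (4 * \<sigma>\<^sup>2))"
  proof (rule gauss_density_tail[OF \<sigma> _ s(1)])
    fix u assume "u \<in> {u. x + u \<in> V}"
    then show "s \<le> norm u" using s(2)[of "x + u"] by simp
  qed measurable
  finally show ?thesis .
qed

text \<open>The integrand is odd under the isometric involution \<open>R\<close>, so its integral
  over \<open>B\<close>, the largest subset of \<open>A\<close> invariant under \<open>R\<close>,
  vanishes. What remains of \<open>A\<close> has norm at least \<open>s\<close> and falls under the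
  tail bound.\<close>

lemma gauss_reflected_moment_le:
  fixes P :: "real^'D::finite^'D"
  assumes P: "orth_proj P" and \<sigma>: "\<sigma> > 0" and A[measurable]: "A \<in> sets borel"
    and s: "s \<ge> 0" "\<And>u. u \<in> A \<Longrightarrow> u - 2 *\<^sub>R (P *v u) \<notin> A \<Longrightarrow> s \<le> norm u"
  shows "norm (\<integral>u. indicator A u *\<^sub>R (gauss_density \<sigma> u *\<^sub>R (P *v u)) \<partial>lborel)
    \<le> 2 powr (CARD('D) / 2) * (3 * \<sigma>) * exp (- s\<^sup>2 / (8 * \<sigma>\<^sup>2))"
proof -
  define R where "R u = u - 2 *\<^sub>R (P *v u)" for u
  define G where "G u = gauss_density \<sigma> u *\<^sub>R (P *v u)" for u
  have lin: "linear R" unfolding R_def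
    by (intro linearI) (simp_all add: matrix_vector_right_distrib matrix_vector_mult_scaleR algebra_simps)
  have PP: "P *v (P *v y) = P *v y" for y using orth_projD(1)[OF P] .
  have R2: "R u = u - P *v u - P *v u" for u by (simp add: R_def scaleR_2)
  have RR: "R (R u) = u" for u
    by (simp add: R2 matrix_vector_mult_diff_distrib PP matrix_vector_mult_double)
  have nR: "norm (R u) = norm u" for u
  proof -
    have "(norm (R u))\<^sup>2 = (norm u)\<^sup>2 - 4 * ((P *v u) \<bullet> u) + 4 * (norm (P *v u))\<^sup>2"
      unfolding R_def power2_norm_eq_inner by (simp add: inner_diff inner_commute algebra_simps)
    also have "\<dots> = (norm u)\<^sup>2" using orth_proj_inner_self[OF P, of u] by simp
    finally show ?thesis by simp
  qed
  have ort: "orthogonal_transformation R" using lin nR by (simp add: orthogonal_transformation)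
  have [measurable]: "R \<in> borel_measurable borel" unfolding R_def by measurable
  have [measurable]: "G \<in> borel_measurable borel" unfolding G_def by measurable
  have GR: "G (R u) = - G u" for u
  proof -
    have "P *v R u = - (P *v u)"
      by (simp add: R2 matrix_vector_mult_diff_distrib PP matrix_vector_mult_double)
    then show ?thesis using gauss_density_norm_cong[OF nR, of \<sigma> u] by (simp add: G_def)
  qed
  have Gn: "norm (G u) \<le> norm u * gauss_density \<sigma> u" for u
    using orth_proj_norm_le[OF P, of u] gauss_density_nonneg[of \<sigma> u]
    by (simp add: G_def mult.commute[of "norm u"] mult_left_mono)
  have int0: "integrable lborel (\<lambda>u::real^'D. norm u * gauss_density \<sigma> u)"
    using gauss_density_norm_tail(1)[OF \<sigma>, of "{}" 0] by simp
  have intG: "integrable lborel G"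
    by (rule Bochner_Integration.integrable_bound[OF int0])
      (use Gn in \<open>auto simp: abs_mult abs_of_nonneg[OF gauss_density_nonneg]\<close>)
  define B where "B = {u\<in>A. R u \<in> A}"
  have B[measurable]: "B \<in> sets borel" unfolding B_def by measurable
  have iB: "indicator B (R u) = (indicator B u :: real)" for u by (auto simp: B_def indicator_def RR)
  have "(\<integral>u. indicator B u *\<^sub>R G u \<partial>lborel) = (\<integral>u. indicator B u *\<^sub>R G u \<partial>distr lborel borel R)"
    by (simp add: lborel_distr_orthogonal_transformation[OF ort])
  also have "\<dots> = (\<integral>u. indicator B (R u) *\<^sub>R G (R u) \<partial>lborel)"
    by (rule integral_distr) auto
  also have "\<dots> = - (\<integral>u. indicator B u *\<^sub>R G u \<partial>lborel)" by (simp add: iB GR)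
  finally have "2 *\<^sub>R (\<integral>u. indicator B u *\<^sub>R G u \<partial>lborel) = 0" by (metis scaleR_2 add.right_inverse)
  then have B0: "(\<integral>u. indicator B u *\<^sub>R G u \<partial>lborel) = 0" unfolding scaleR_eq_0_iff by simp
  have iA: "integrable lborel (\<lambda>u. indicator S u *\<^sub>R G u)" if [measurable]: "S \<in> sets borel" for S
    by (rule integrable_mult_indicator[OF _ intG]) simp
  have "(\<integral>u. indicator A u *\<^sub>R G u \<partial>lborel) = (\<integral>u. indicator (A - B) u *\<^sub>R G u + indicator B u *\<^sub>R G u \<partial>lborel)"
    by (intro Bochner_Integration.integral_cong) (auto simp: indicator_def B_def)
  also have "\<dots> = (\<integral>u. indicator (A - B) u *\<^sub>R G u \<partial>lborel)"
    using B0 by (subst Bochner_Integration.integral_add) (auto intro!: iA)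
  also have "norm \<dots> \<le> (\<integral>u. norm (indicator (A - B) u *\<^sub>R G u) \<partial>lborel)" by (rule integral_norm_bound)
  also have "\<dots> \<le> (\<integral>u. indicator (A - B) u * (norm u * gauss_density \<sigma> u) \<partial>lborel)"
  proof (rule integral_mono)
    show "integrable lborel (\<lambda>u. norm (indicator (A - B) u *\<^sub>R G u))" by (intro integrable_norm iA) auto
    show "integrable lborel (\<lambda>u. indicator (A - B) u * (norm u * gauss_density \<sigma> u))"
      using integrable_mult_indicator[OF _ int0, of "A - B"] by simp
    show "norm (indicator (A - B) u *\<^sub>R G u) \<le> indicator (A - B) u * (norm u * gauss_density \<sigma> u)" for u
      using Gn[of u] by (simp add: mult_left_mono)
  qed
  also have "\<dots> \<le> 2 powr (CARD('D) / 2) * (3 * \<sigma>) * exp (- s\<^sup>2 / (8 * \<sigma>\<^sup>2))"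
  proof (rule gauss_density_norm_tail(2)[OF \<sigma> _ s(1)])
    fix u assume "u \<in> A - B"
    then show "s \<le> norm u" using s(2)[of u] by (auto simp: B_def R_def)
  qed simp
  finally show ?thesis by (simp add: G_def)
qed

text \<open>For \<open>x\<close> near \<open>p\<close>, \<open>geo\<close> makes the tangential part
  of x - p at least half of its length, while the window and the offset of \<open>z\<close> account
  for at most (Cz + c1) \<sigma> of tangential motion; the noise y - x must supply the rest. For |x
  - p| > \<tau>/4 the normal side of the window is at most \<tau>/8 < |x - p| / 2, and the triangle
  inequality gives the same bound.\<close>

lemma window_far:
  fixes P :: "real^'D::finite^'D"
  assumes P: "orth_proj P" and \<sigma>: "\<sigma> > 0" and \<tau>: "\<tau> > 0"
    and z: "norm (z - p) \<le> Cz * \<sigma>" and \<theta>: "\<theta> \<le> 1/4" and r2: "r2 \<le> \<tau> / 8"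
    and geo: "norm (P *v (x - p)) \<le> \<theta> * norm (x - p) + (norm (x - p))\<^sup>2 / \<tau>"
    and y: "y \<in> window P z (c1 * \<sigma>) r2"
  shows "norm (x - p) / 2 - (Cz + c1) * \<sigma> \<le> norm (y - x)"
proof (cases "norm (x - p) \<le> \<tau> / 4")
  case True
  let ?Q = "mat 1 - P"
  note Q = orth_proj_complement[OF P]
  have "(norm (x - p))\<^sup>2 / \<tau> \<le> norm (x - p) / 4"
    using True \<tau> mult_left_mono[OF True, of "norm (x - p)"] by (simp add: power2_eq_square field_simps)
  moreover have "\<theta> * norm (x - p) \<le> 1/4 * norm (x - p)" using \<theta> by (rule mult_right_mono) simp
  ultimately have a: "norm (P *v (x - p)) \<le> norm (x - p) / 2" using geo by linarith
  have "x - p = ?Q *v (x - p) + P *v (x - p)" by (simp add: matrix_vector_mult_diff_rdistrib)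
  then have "norm (x - p) \<le> norm (?Q *v (x - p)) + norm (P *v (x - p))" by (metis norm_triangle_ineq)
  with a have b: "norm (x - p) / 2 \<le> norm (?Q *v (x - p))" by linarith
  have "?Q *v (x - p) = ?Q *v (y - z) + ?Q *v (z - p) - ?Q *v (y - x)"
    by (simp add: matrix_vector_mult_diff_distrib)
  then have "norm (?Q *v (x - p)) \<le> norm (?Q *v (y - z)) + norm (?Q *v (z - p)) + norm (?Q *v (y - x))"
    using norm_triangle_ineq4[of "?Q *v (y - z) + ?Q *v (z - p)" "?Q *v (y - x)"]
      norm_triangle_ineq[of "?Q *v (y - z)" "?Q *v (z - p)"] by (simp only:)
  moreover have "norm (?Q *v (y - z)) \<le> c1 * \<sigma>" using y by (simp add: window_def)
  moreover have "norm (?Q *v (z - p)) \<le> Cz * \<sigma>" using orth_proj_norm_le[OF Q, of "z - p"] z by simp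
  moreover have "norm (?Q *v (y - x)) \<le> norm (y - x)" by (rule orth_proj_norm_le[OF Q])
  ultimately show ?thesis using b by (simp add: algebra_simps)
next
  case False
  have "norm (x - p) \<le> norm (y - x) + norm (y - z) + norm (z - p)"
    using norm_triangle_ineq4[of "y - p" "y - x"] norm_triangle_ineq[of "y - z" "z - p"] by simp
  moreover have "norm (y - z) \<le> c1 * \<sigma> + r2" by (rule window_dist_le[OF y])
  ultimately show ?thesis using z r2 False by (simp add: algebra_simps)
qed

lemma window_mass_upper:
  fixes P :: "real^'D::finite^'D"
  assumes P: "orth_proj P" and \<sigma>: "\<sigma> > 0" and \<tau>: "\<tau> > 0"
    and z: "norm (z - p) \<le> Cz * \<sigma>" and \<theta>: "\<theta> \<le> 1/4" and r2: "r2 \<le> \<tau> / 8"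
    and K: "K = Cz + c1" "K > 0"
    and geo: "norm (P *v (x - p)) \<le> \<theta> * norm (x - p) + (norm (x - p))\<^sup>2 / \<tau>"
  shows "(\<integral>y. indicator (window P z (c1 * \<sigma>) r2) y * gauss_density \<sigma> (y - x) \<partial>lborel)
    \<le> 2 powr (CARD('D) / 2) * exp (K\<^sup>2 / 4) * exp (- (norm (x - p))\<^sup>2 / (32 * \<sigma>\<^sup>2))"
proof -
  let ?\<rho> = "norm (x - p)"
  \<comment> \<open>The cut at 0 keeps \<open>s\<close> non-negative for \<open>x\<close> close to
    \<open>p\<close>. The exponent then comes from (a/2 - b)^2 \<ge> a^2/8 - b^2, and 32 is 8 times
    4.\<close>
  define s where "s = max 0 (?\<rho> / 2 - K * \<sigma>)"
  have "(\<integral>y. indicator (window P z (c1 * \<sigma>) r2) y * gauss_density \<sigma> (y - x) \<partial>lborel)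
      \<le> 2 powr (CARD('D) / 2) * exp (- s\<^sup>2 / (4 * \<sigma>\<^sup>2))"
    using window_far[OF P \<sigma> \<tau> z \<theta> r2 geo]
    by (intro gauss_mass_away_le[OF \<sigma>]) (auto simp: s_def K)
  also have "\<dots> \<le> 2 powr (CARD('D) / 2) * exp (K\<^sup>2 / 4 + (- ?\<rho>\<^sup>2 / (32 * \<sigma>\<^sup>2)))"
  proof (intro mult_left_mono iffD2[OF exp_le_cancel_iff])
    have "?\<rho>\<^sup>2 / 8 - (K * \<sigma>)\<^sup>2 \<le> s\<^sup>2"
    proof (cases "?\<rho> / 2 \<ge> K * \<sigma>")
      case True
      then have "s\<^sup>2 = (?\<rho> / 2 - K * \<sigma>)\<^sup>2" by (simp add: s_def)
      moreover have "(?\<rho> / 2 - K * \<sigma>)\<^sup>2 = ?\<rho>\<^sup>2 / 8 - (K * \<sigma>)\<^sup>2 + 2 * (?\<rho> / 4 - K * \<sigma>)\<^sup>2"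
        by (simp add: power2_eq_square field_simps)
      ultimately show ?thesis by simp
    next
      case False
      then have "(?\<rho> / 2)\<^sup>2 \<le> (K * \<sigma>)\<^sup>2" by (intro power_mono) auto
      moreover have "(?\<rho> / 2)\<^sup>2 = ?\<rho>\<^sup>2 / 4" by (simp add: power_divide)
      ultimately have "?\<rho>\<^sup>2 / 8 - (K * \<sigma>)\<^sup>2 \<le> 0"
        using zero_le_power2[of "K * \<sigma>"] by linarith
      then show ?thesis by (rule order_trans) simp
    qed
    then have "- s\<^sup>2 / (4 * \<sigma>\<^sup>2) \<le> - (?\<rho>\<^sup>2 / 8 - (K * \<sigma>)\<^sup>2) / (4 * \<sigma>\<^sup>2)"
      by (intro divide_right_mono) auto
    also have "\<dots> = K\<^sup>2 / 4 + (- ?\<rho>\<^sup>2 / (32 * \<sigma>\<^sup>2))"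
      using \<sigma> by (simp add: power_mult_distrib field_simps)
    finally show "- s\<^sup>2 / (4 * \<sigma>\<^sup>2) \<le> K\<^sup>2 / 4 + (- ?\<rho>\<^sup>2 / (32 * \<sigma>\<^sup>2))" .
  qed simp
  finally show ?thesis by (simp only: exp_add mult.assoc)
qed

text \<open>If |P (x - z)| \<le> r2/2, the reflection can leave the window only when |u| \<ge> r2/2.
  Otherwise \<open>x\<close> is so far from \<open>p\<close> that by \<open>window_far\<close> every
  noise vector that reaches the window is long: |u| \<ge> r2/4 - (3/2) K \<sigma>, which the
  hypothesis \<open>12 * K * \<sigma> \<le> r2\<close> turns into r2/8.\<close>

lemma window_normal_moment_le:
  fixes P :: "real^'D::finite^'D"
  assumes P: "orth_proj P" and \<sigma>: "\<sigma> > 0" and \<tau>: "\<tau> > 0"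
    and z: "norm (z - p) \<le> Cz * \<sigma>" and \<theta>: "\<theta> \<le> 1/4" and r2: "r2 \<le> \<tau> / 8"
    and K: "K = Cz + c1" "K > 0" "c1 \<ge> 0" and r2K: "12 * K * \<sigma> \<le> r2"
    and geo: "norm (P *v (x - p)) \<le> \<theta> * norm (x - p) + (norm (x - p))\<^sup>2 / \<tau>"
  shows "norm (\<integral>y. indicator (window P z (c1 * \<sigma>) r2) y *\<^sub>R (gauss_density \<sigma> (y - x) *\<^sub>R (P *v (y - x))) \<partial>lborel)
    \<le> 2 powr (CARD('D) / 2) * (3 * \<sigma>) * exp (- (r2 / 8)\<^sup>2 / (8 * \<sigma>\<^sup>2))"
proof -
  let ?V = "window P z (c1 * \<sigma>) r2"
  let ?h = "\<lambda>y. indicator ?V y *\<^sub>R (gauss_density \<sigma> (y - x) *\<^sub>R (P *v (y - x)))"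
  have r2pos: "r2 \<ge> 0" using r2K K \<sigma> by (smt (verit) mult_nonneg_nonneg)
  have [measurable]: "(\<lambda>y. P *v (y - x)) \<in> borel_measurable borel"
    by (rule measurable_compose[OF _ borel_measurable_matrix_vector_mult]) measurable
  have "(\<integral>y. ?h y \<partial>lborel) = (\<integral>u. ?h (x + u) \<partial>lborel)"
    by (rule integral_lborel_shift[symmetric]) measurable
  also have "\<dots> = (\<integral>u. indicator {u. x + u \<in> ?V} u *\<^sub>R (gauss_density \<sigma> u *\<^sub>R (P *v u)) \<partial>lborel)"
    by (simp add: indicator_def)
  also have "norm \<dots> \<le> 2 powr (CARD('D) / 2) * (3 * \<sigma>) * exp (- (r2 / 8)\<^sup>2 / (8 * \<sigma>\<^sup>2))"
  proof (rule gauss_reflected_moment_le[OF P \<sigma>])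
    fix u assume u: "u \<in> {u. x + u \<in> ?V}" and nu: "u - 2 *\<^sub>R (P *v u) \<notin> {u. x + u \<in> ?V}"
    show "r2 / 8 \<le> norm u"
    proof (cases "norm (P *v (x - z)) \<le> r2 / 2")
      case True
      then show ?thesis using window_reflect[OF P, of x u z "c1 * \<sigma>" r2] u nu r2pos by auto
    next
      case False
      have "norm (P *v (x - z)) \<le> norm (x - z)" by (rule orth_proj_norm_le[OF P])
      also have "\<dots> \<le> norm (x - p) + norm (z - p)"
        using norm_triangle_ineq4[of "x - p" "z - p"] by simp
      finally have "r2 / 2 < norm (x - p) + Cz * \<sigma>" using False z by linarith
      moreover have "norm (x - p) / 2 - K * \<sigma> \<le> norm u"
        using window_far[OF P \<sigma> \<tau> z \<theta> r2 geo, of "x + u" c1] u by (simp add: K)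
      moreover have "Cz * \<sigma> \<le> K * \<sigma>" using K \<sigma> by (intro mult_right_mono) auto
      ultimately show ?thesis using r2K by (simp add: algebra_simps)
    qed
  qed (use r2pos in \<open>measurable, simp\<close>)
  finally show ?thesis .
qed

text \<open>The window contains the ball of radius c1 \<sigma> about \<open>z\<close>, on which the
  density is at least a constant times \<sigma>^(-D). The volume of the ball cancels this power, so
  the bound is free of \<sigma>.\<close>

lemma window_mass_lower:
  fixes P :: "real^'D::finite^'D"
  assumes P: "orth_proj P" and \<sigma>: "\<sigma> > 0" and z: "norm (z - p) \<le> Cz * \<sigma>"
    and K: "K = Cz + c1" and c1: "c1 > 0" and r2: "c1 * \<sigma> \<le> r2" and x: "norm (x - p) < \<sigma>"
  shows "(2 * pi) powr (- real CARD('D) / 2) * exp (- (K + 1)\<^sup>2 / 2) * unit_ball_vol CARD('D) * c1 ^ CARD('D)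
    \<le> (\<integral>y. indicator (window P z (c1 * \<sigma>) r2) y * gauss_density \<sigma> (y - x) \<partial>lborel)"
proof -
  let ?V = "window P z (c1 * \<sigma>) r2"
  let ?B = "ball z (c1 * \<sigma>)"
  let ?m = "(2 * pi * \<sigma>\<^sup>2) powr (- real CARD('D) / 2) * exp (- (K + 1)\<^sup>2 / 2)"
  have BV: "y \<in> ?V" if "y \<in> ?B" for y
    using that orth_proj_norm_le[OF P, of "y - z"] orth_proj_norm_le[OF orth_proj_complement[OF P], of "y - z"] r2
    by (auto simp: window_def dist_norm norm_minus_commute)
  have g: "?m \<le> gauss_density \<sigma> (y - x)" if "y \<in> ?B" for y
  proof -
    have "norm (y - x) \<le> norm (y - z) + norm (z - p) + norm (x - p)"
      using norm_triangle_ineq4[of "y - p" "x - p"] norm_triangle_ineq[of "y - z" "z - p"] by simp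
    also have "\<dots> \<le> (K + 1) * \<sigma>" using that z x by (simp add: K algebra_simps dist_norm norm_minus_commute)
    finally have "(norm (y - x))\<^sup>2 \<le> ((K + 1) * \<sigma>)\<^sup>2" by (intro power_mono) auto
    then have "- ((K + 1) * \<sigma>)\<^sup>2 / (2 * \<sigma>\<^sup>2) \<le> - (norm (y - x))\<^sup>2 / (2 * \<sigma>\<^sup>2)"
      by (intro divide_right_mono) auto
    moreover have "- ((K + 1) * \<sigma>)\<^sup>2 / (2 * \<sigma>\<^sup>2) = - (K + 1)\<^sup>2 / 2" using \<sigma> by (simp add: power_mult_distrib)
    ultimately show ?thesis unfolding gauss_density_def by (intro mult_left_mono) auto
  qed
  note int = integrable_gauss_density_shift[OF \<sigma>, of x]
  have vol: "measure lborel ?B = unit_ball_vol CARD('D) * (c1 * \<sigma>) ^ CARD('D)"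
    using c1 \<sigma> unit_ball_vol_pos[of "CARD('D)"] by (simp add: measure_def emeasure_ball_unit_ball_vol)
  have "(2 * pi * \<sigma>\<^sup>2) powr (- real CARD('D) / 2) = (2 * pi) powr (- real CARD('D) / 2) * (\<sigma>\<^sup>2) powr (- real CARD('D) / 2)"
    using \<sigma> by (subst powr_mult) auto
  also have "(\<sigma>\<^sup>2) powr (- real CARD('D) / 2) = 1 / \<sigma> ^ CARD('D)"
  proof -
    have "\<sigma>\<^sup>2 = \<sigma> powr 2" using \<sigma> by simp
    then have "(\<sigma>\<^sup>2) powr (- real CARD('D) / 2) = \<sigma> powr (- real CARD('D))" by (simp add: powr_powr)
    then show ?thesis using \<sigma> by (simp only: powr_minus powr_realpow divide_inverse mult_1)
  qed
  finally have "(2 * pi) powr (- real CARD('D) / 2) * exp (- (K + 1)\<^sup>2 / 2) * unit_ball_vol CARD('D) * c1 ^ CARD('D)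
      = ?m * measure lborel ?B"
    using \<sigma> by (simp add: vol power_mult_distrib)
  also have "\<dots> = (\<integral>y. indicator ?B y * ?m \<partial>lborel)" by (simp add: mult.commute)
  also have "\<dots> \<le> (\<integral>y. indicator ?V y * gauss_density \<sigma> (y - x) \<partial>lborel)"
  proof (rule integral_mono)
    show "integrable lborel (\<lambda>y. indicator ?B y * ?m)"
      by (intro integrable_mult_left integrable_real_indicator) (use emeasure_lborel_ball_finite[of z "c1 * \<sigma>"] in auto)
    show "integrable lborel (\<lambda>y. indicator ?V y * gauss_density \<sigma> (y - x))"
      using integrable_mult_indicator[OF _ int, of ?V] by simp
    show "indicator ?B y * ?m \<le> indicator ?V y * gauss_density \<sigma> (y - x)" for y
      using g[of y] BV[of y] gauss_density_nonneg[of \<sigma> "y - x"] by (auto simp: indicator_def)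
  qed
  finally show ?thesis .
qed

section \<open>Gaussian integrals against measures of polynomial ball growth\<close>

definition annuli_sum :: "nat \<Rightarrow> real" where
  "annuli_sum d = (\<Sum>k. exp (- (real k)\<^sup>2 / 64) * (real k + 1) ^ d)"

lemma power_le_fact_mult_exp:
  fixes x :: real
  assumes "x \<ge> 0"
  shows "x ^ d \<le> fact d * exp x"
proof -
  have "(\<Sum>n\<in>{d}. x ^ n /\<^sub>R fact n) \<le> (\<Sum>n. x ^ n /\<^sub>R fact n)"
    using assms by (intro sum_le_suminf[OF summable_exp_generic]) auto
  then have "x ^ d /\<^sub>R fact d \<le> exp x" by (simp add: exp_def)
  then show ?thesis by (simp add: field_simps)
qed

lemma annuli_summable: "summable (\<lambda>k. exp (- (real k)\<^sup>2 / 64) * (real k + 1) ^ d)"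
proof (rule summable_comparison_test')
  show "summable (\<lambda>k. (exp 65 * 2 ^ d * fact d) * exp (-1/2 :: real) ^ k)"
    by (intro summable_mult summable_geometric) simp
  fix k :: nat
  let ?x = "(real k + 1) / 2"
  have "?x ^ d \<le> fact d * exp ?x" by (rule power_le_fact_mult_exp) simp
  then have "2 ^ d * ?x ^ d \<le> 2 ^ d * (fact d * exp ?x)" by (rule mult_left_mono) simp
  moreover have "2 ^ d * ?x ^ d = (real k + 1) ^ d"
    unfolding power_mult_distrib[symmetric] by (rule arg_cong[where f = "\<lambda>t. t ^ d"]) simp
  ultimately have "(real k + 1) ^ d \<le> 2 ^ d * fact d * exp ?x" by (simp only: mult.assoc)
  \<comment> \<open>Completing the square: k^2/64 \<ge> k - 16. Against the growth exp((k+1)/2) of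
    the power, a geometric decay exp(-k/2) is left; 65 is a generous bound for 16 + 1/2.\<close>
  moreover have "0 \<le> (real k / 8 - 4)\<^sup>2" by simp
  then have "- (real k)\<^sup>2 / 64 \<le> 16 - real k" by (simp add: power2_diff power_divide)
  then have "exp (- (real k)\<^sup>2 / 64) \<le> exp (16 - real k)" by simp
  ultimately have "exp (- (real k)\<^sup>2 / 64) * (real k + 1) ^ d \<le> exp (16 - real k) * (2 ^ d * fact d * exp ?x)"
    by (intro mult_mono) auto
  also have "\<dots> = 2 ^ d * fact d * exp (16 - real k + ?x)" by (simp add: exp_add)
  also have "\<dots> \<le> 2 ^ d * fact d * (exp 65 * exp (-1/2) ^ k)"
  proof (rule mult_left_mono)
    have "exp 65 * exp (-1/2) ^ k = exp (65 + real k * (-1/2))"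
      by (simp only: exp_add exp_of_nat_mult)
    then show "exp (16 - real k + ?x) \<le> exp 65 * exp (-1/2) ^ k" by (simp add: field_simps)
  qed simp
  finally show "norm (exp (- (real k)\<^sup>2 / 64) * (real k + 1) ^ d) \<le> (exp 65 * 2 ^ d * fact d) * exp (-1/2) ^ k"
    by (simp add: mult_ac)
qed

lemma annuli_sum_nonneg: "annuli_sum d \<ge> 0"
  unfolding annuli_sum_def by (rule suminf_nonneg[OF annuli_summable]) simp

text \<open>For k the integer part of |x - p| / \<sigma>, the integrand is at most exp(-k^2/64) and
  \<open>x\<close> lies in the ball of radius (k+1) \<sigma>. Full balls in place of annuli only
  overcount, so upper bounds on ball volumes are enough.\<close>

lemma gauss_integral_ball_growth:
  fixes \<mu> :: "'a::euclidean_space measure"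
  assumes sets[measurable_cong]: "sets \<mu> = sets borel" and \<sigma>: "\<sigma> > 0" and C: "C \<ge> 0"
    and up: "\<And>r. r > 0 \<Longrightarrow> emeasure \<mu> (ball p r) \<le> ennreal (C * r ^ d)"
  shows "integrable \<mu> (\<lambda>x. exp (- (norm (x - p))\<^sup>2 / (64 * \<sigma>\<^sup>2)))" (is ?int)
    and "(\<integral>x. exp (- (norm (x - p))\<^sup>2 / (64 * \<sigma>\<^sup>2)) \<partial>\<mu>) \<le> C * annuli_sum d * \<sigma> ^ d"
proof -
  let ?f = "\<lambda>x. exp (- (norm (x - p))\<^sup>2 / (64 * \<sigma>\<^sup>2))"
  let ?e = "\<lambda>k::nat. exp (- (real k)\<^sup>2 / 64)"
  have pw: "ennreal (?f x) \<le> (\<Sum>k. ennreal (?e k) * indicator (ball p ((real k + 1) * \<sigma>)) x)" for x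
  proof -
    define k where "k = nat \<lfloor>norm (x - p) / \<sigma>\<rfloor>"
    have k: "real k \<le> norm (x - p) / \<sigma>" "norm (x - p) / \<sigma> < real k + 1"
      using \<sigma> by (auto simp: k_def)
    have "x \<in> ball p ((real k + 1) * \<sigma>)" using k \<sigma> by (simp add: dist_norm norm_minus_commute field_simps)
    moreover have "(real k)\<^sup>2 \<le> (norm (x - p) / \<sigma>)\<^sup>2" using k by (intro power_mono) auto
    then have "?f x \<le> ?e k" by (simp add: power_divide)
    ultimately have "ennreal (?f x) \<le> (\<Sum>j\<in>{k}. ennreal (?e j) * indicator (ball p ((real j + 1) * \<sigma>)) x)"
      by (simp add: ennreal_leI)
    also have "\<dots> \<le> (\<Sum>j. ennreal (?e j) * indicator (ball p ((real j + 1) * \<sigma>)) x)"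
      by (rule sum_le_suminf) auto
    finally show ?thesis .
  qed
  have "(\<integral>\<^sup>+x. ennreal (?f x) \<partial>\<mu>) \<le> (\<integral>\<^sup>+x. (\<Sum>k. ennreal (?e k) * indicator (ball p ((real k + 1) * \<sigma>)) x) \<partial>\<mu>)"
    by (rule nn_integral_mono) (rule pw)
  also have "\<dots> = (\<Sum>k. ennreal (?e k) * emeasure \<mu> (ball p ((real k + 1) * \<sigma>)))"
    by (subst nn_integral_suminf)
      (auto simp: nn_integral_cmult_indicator sets intro!: borel_measurable_times_ennreal borel_measurable_indicator)
  also have "\<dots> \<le> (\<Sum>k. ennreal (C * \<sigma> ^ d * (?e k * (real k + 1) ^ d)))"
  proof (rule suminf_le)
    fix k :: nat
    have "ennreal (?e k) * emeasure \<mu> (ball p ((real k + 1) * \<sigma>)) \<le> ennreal (?e k) * ennreal (C * ((real k + 1) * \<sigma>) ^ d)"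
      using \<sigma> by (intro mult_left_mono up) auto
    also have "\<dots> = ennreal (C * \<sigma> ^ d * (?e k * (real k + 1) ^ d))"
      using C \<sigma> by (simp add: ennreal_mult[symmetric] power_mult_distrib mult_ac)
    finally show "ennreal (?e k) * emeasure \<mu> (ball p ((real k + 1) * \<sigma>)) \<le> ennreal (C * \<sigma> ^ d * (?e k * (real k + 1) ^ d))" .
  qed auto
  also have "\<dots> = ennreal (C * \<sigma> ^ d * annuli_sum d)"
    unfolding annuli_sum_def using C \<sigma> sums_mult[OF summable_sums[OF annuli_summable[of d]], of "C * \<sigma> ^ d"]
    by (intro suminf_ennreal_eq) auto
  finally have *: "(\<integral>\<^sup>+x. ennreal (?f x) \<partial>\<mu>) \<le> ennreal (C * \<sigma> ^ d * annuli_sum d)" .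
  show int: ?int
    by (rule integrableI_nonneg) (use * in \<open>auto intro: le_less_trans\<close>)
  have "ennreal (\<integral>x. ?f x \<partial>\<mu>) \<le> ennreal (C * \<sigma> ^ d * annuli_sum d)"
    using * nn_integral_eq_integral[OF int] by simp
  then show "(\<integral>x. ?f x \<partial>\<mu>) \<le> C * annuli_sum d * \<sigma> ^ d"
    using C \<sigma> annuli_sum_nonneg[of d] by (subst (asm) ennreal_le_iff) (auto simp: mult_ac)
qed

section \<open>Averaging over the hidden point\<close>

lemma gauss_density_le: "gauss_density \<sigma> (u :: real^'D::finite) \<le> (2 * pi * \<sigma>\<^sup>2) powr (- real CARD('D) / 2)"
  unfolding gauss_density_def by (rule mult_left_le) auto

text \<open>Used with constant \<open>k\<close> for the mass of the window and with
  \<open>P *v (y - p)\<close> for its normal moment. The integrand is bounded and lives on a product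
  of finite measure, hence is integrable.\<close>

lemma convolution_Fubini:
  fixes \<mu> :: "(real^'D::finite) measure" and k :: "real^'D \<Rightarrow> 'b::{banach, second_countable_topology}"
  assumes fin: "finite_measure \<mu>" and sets[measurable_cong]: "sets \<mu> = sets borel"
    and V[measurable]: "V \<in> sets borel" and Vb: "bounded V"
    and k[measurable]: "k \<in> borel_measurable borel" and B: "\<And>y. y \<in> V \<Longrightarrow> norm (k y) \<le> B"
  shows "(\<integral>y. indicator V y *\<^sub>R ((\<integral>x. gauss_density \<sigma> (y - x) \<partial>\<mu>) *\<^sub>R k y) \<partial>lborel)
      = (\<integral>x. (\<integral>y. indicator V y *\<^sub>R (gauss_density \<sigma> (y - x) *\<^sub>R k y) \<partial>lborel) \<partial>\<mu>)"
    and "integrable \<mu> (\<lambda>x. \<integral>y. indicator V y *\<^sub>R (gauss_density \<sigma> (y - x) *\<^sub>R k y) \<partial>lborel)"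
proof -
  interpret finite_measure \<mu> by (rule fin)
  interpret P: pair_sigma_finite \<mu> "lborel :: (real^'D) measure" by standard
  let ?F = "\<lambda>x y. indicator V y *\<^sub>R (gauss_density \<sigma> (y - x) *\<^sub>R k y)"
  let ?g = "(2 * pi * \<sigma>\<^sup>2) powr (- real CARD('D) / 2)"
  have "emeasure lborel V < \<infinity>" using Vb by (rule emeasure_bounded_finite)
  then have fV: "emeasure (\<mu> \<Otimes>\<^sub>M lborel) (UNIV \<times> V) < \<infinity>"
    using emeasure_finite[of UNIV]
    by (subst lborel.emeasure_pair_measure_Times) (auto simp: sets ennreal_mult_eq_top_iff less_top[symmetric])
  have int: "integrable (\<mu> \<Otimes>\<^sub>M lborel) (case_prod ?F)"
  proof (rule integrableI_bounded_set[OF _ _ fV])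
    show "AE x in \<mu> \<Otimes>\<^sub>M lborel. x \<in> UNIV \<times> V \<longrightarrow> norm (case_prod ?F x) \<le> ?g * B"
    proof (rule AE_I2, safe)
      fix x y assume y: "y \<in> V"
      have "gauss_density \<sigma> (y - x) * norm (k y) \<le> ?g * B"
        using B[OF y] gauss_density_nonneg[of \<sigma> "y - x"] gauss_density_le[of \<sigma> "y - x"] by (intro mult_mono) auto
      then show "norm (?F x y) \<le> ?g * B"
        using y gauss_density_nonneg[of \<sigma> "y - x"] by simp
    qed
    show "AE x in \<mu> \<Otimes>\<^sub>M lborel. x \<notin> UNIV \<times> V \<longrightarrow> case_prod ?F x = 0" by (rule AE_I2) (auto simp: indicator_def)
  qed (auto simp: sets)
  have intg: "integrable \<mu> (\<lambda>x. gauss_density \<sigma> (y - x))" for y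
  proof (rule integrable_const_bound[where B = ?g])
    show "AE x in \<mu>. norm (gauss_density \<sigma> (y - x)) \<le> ?g"
      by (rule AE_I2) (simp only: real_norm_def abs_of_nonneg[OF gauss_density_nonneg] gauss_density_le)
  qed measurable
  have "(\<integral>y. indicator V y *\<^sub>R ((\<integral>x. gauss_density \<sigma> (y - x) \<partial>\<mu>) *\<^sub>R k y) \<partial>lborel)
      = (\<integral>y. (\<integral>x. ?F x y \<partial>\<mu>) \<partial>lborel)"
    by (intro Bochner_Integration.integral_cong) (auto simp: intg)
  also have "\<dots> = (\<integral>x. (\<integral>y. ?F x y \<partial>lborel) \<partial>\<mu>)" by (rule P.Fubini_integral[OF int])
  finally show "(\<integral>y. indicator V y *\<^sub>R ((\<integral>x. gauss_density \<sigma> (y - x) \<partial>\<mu>) *\<^sub>R k y) \<partial>lborel)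
      = (\<integral>x. (\<integral>y. ?F x y \<partial>lborel) \<partial>\<mu>)" .
  show "integrable \<mu> (\<lambda>x. \<integral>y. ?F x y \<partial>lborel)" using P.integrable_fst'[OF int] by simp
qed

text \<open>For fixed \<open>x\<close> the splitting y - p = (x - p) + (y - x) divides the moment
  \<open>m x\<close> into a signal part, \<open>q x\<close> times \<open>P *v (x - p)\<close>, and a
  noise part \<open>I\<close>. The signal part inherits Gaussian decay in \<open>x\<close> from
  \<open>q\<close> and integrates to a multiple of \<sigma>^d. The bound for the noise part is
  uniform in \<open>x\<close> and therefore carries the total mass of \<mu>.\<close>

lemma window_convolution_estimates:
  fixes \<mu> :: "(real^'D::finite) measure" and P :: "real^'D^'D"
  assumes fin: "finite_measure \<mu>" and sets[measurable_cong]: "sets \<mu> = sets borel" and M: "AE x in \<mu>. x \<in> M"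
    and P: "orth_proj P" and \<sigma>: "\<sigma> > 0" and \<tau>: "\<tau> > 0"
    and z: "norm (z - p) \<le> Cz * \<sigma>" and \<theta>: "0 \<le> \<theta>" "\<theta> \<le> 1/4" and r2: "r2 \<le> \<tau> / 8"
    and K: "K = Cz + c1" "K > 0" "c1 > 0" and r2K: "12 * K * \<sigma> \<le> r2" and r21: "c1 * \<sigma> \<le> r2"
    and geo: "\<And>x. x \<in> M \<Longrightarrow> norm (P *v (x - p)) \<le> \<theta> * norm (x - p) + (norm (x - p))\<^sup>2 / \<tau>"
    and C: "C \<ge> 0" and up: "\<And>r. r > 0 \<Longrightarrow> emeasure \<mu> (ball p r) \<le> ennreal (C * r ^ d)"
  defines "V \<equiv> window P z (c1 * \<sigma>) r2"
    and "G \<equiv> \<lambda>y. \<integral>x. gauss_density \<sigma> (y - x) \<partial>\<mu>"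
  shows "(2 * pi) powr (- real CARD('D) / 2) * exp (- (K + 1)\<^sup>2 / 2) * unit_ball_vol CARD('D) * c1 ^ CARD('D)
        * measure \<mu> (ball p \<sigma>) \<le> (\<integral>y. indicator V y * G y \<partial>lborel)" (is "?q0 * _ \<le> _")
    and "norm (\<integral>y. indicator V y *\<^sub>R (G y *\<^sub>R (P *v (y - p))) \<partial>lborel)
      \<le> 2 powr (CARD('D) / 2) * exp (K\<^sup>2 / 4) * (8 * \<theta> * \<sigma> + 64 * \<sigma>\<^sup>2 / \<tau>) * (C * annuli_sum d * \<sigma> ^ d)
        + 2 powr (CARD('D) / 2) * (3 * \<sigma>) * exp (- (r2 / 8)\<^sup>2 / (8 * \<sigma>\<^sup>2)) * measure \<mu> UNIV"
proof -
  interpret finite_measure \<mu> by (rule fin)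
  have V[measurable]: "V \<in> sets borel" unfolding V_def by simp
  have Vz: "norm (y - z) \<le> c1 * \<sigma> + r2" if "y \<in> V" for y
    using window_dist_le that unfolding V_def by blast
  have Vb: "bounded V"
    by (rule bounded_subset[OF bounded_cball[of z "c1 * \<sigma> + r2"]]) (use Vz in \<open>auto simp: dist_norm norm_minus_commute\<close>)
  define B where "B = c1 * \<sigma> + r2 + Cz * \<sigma>"
  have VB: "norm (P *v (y - p)) \<le> B" if "y \<in> V" for y
    using orth_proj_norm_le[OF P, of "y - p"] norm_triangle_ineq[of "y - z" "z - p"] Vz[OF that] z
    by (simp add: B_def)
  have Pm[measurable]: "(\<lambda>y. P *v (y - x)) \<in> borel_measurable borel" for x
    by (rule measurable_compose[OF _ borel_measurable_matrix_vector_mult]) measurable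
  define q where "q x = (\<integral>y. indicator V y * gauss_density \<sigma> (y - x) \<partial>lborel)" for x
  define m where "m x = (\<integral>y. indicator V y *\<^sub>R (gauss_density \<sigma> (y - x) *\<^sub>R (P *v (y - p))) \<partial>lborel)" for x
  have q: "(\<integral>y. indicator V y * G y \<partial>lborel) = (\<integral>x. q x \<partial>\<mu>)" "integrable \<mu> q"
    using convolution_Fubini[OF fin sets V Vb, of "\<lambda>_. 1::real" 1 \<sigma>] by (simp_all add: G_def q_def[abs_def])
  have m: "(\<integral>y. indicator V y *\<^sub>R (G y *\<^sub>R (P *v (y - p))) \<partial>lborel) = (\<integral>x. m x \<partial>\<mu>)" "integrable \<mu> m"
    using convolution_Fubini[OF fin sets V Vb Pm VB] by (simp_all add: G_def m_def[abs_def])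
  have q0: "q x \<ge> 0" for x
    unfolding q_def by (intro integral_nonneg_AE AE_I2 mult_nonneg_nonneg) (auto simp: gauss_density_nonneg)
  show "?q0 * measure \<mu> (ball p \<sigma>) \<le> (\<integral>y. indicator V y * G y \<partial>lborel)"
  proof -
    have "?q0 * measure \<mu> (ball p \<sigma>) = (\<integral>x. ?q0 * indicator (ball p \<sigma>) x \<partial>\<mu>)"
      by (simp add: sets)
    also have "\<dots> \<le> (\<integral>x. q x \<partial>\<mu>)"
    proof (rule integral_mono[OF _ q(2)])
      show "integrable \<mu> (\<lambda>x. ?q0 * indicator (ball p \<sigma>) x)"
        using emeasure_finite[of "ball p \<sigma>"]
        by (intro integrable_mult_right integrable_real_indicator) (auto simp: sets less_top[symmetric])
      fix x
      show "?q0 * indicator (ball p \<sigma>) x \<le> q x"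
      proof (cases "x \<in> ball p \<sigma>")
        case True
        then have "norm (x - p) < \<sigma>" by (simp add: dist_norm norm_minus_commute)
        then show ?thesis using window_mass_lower[OF P \<sigma> z K(1,3) r21, of x] True by (simp add: q_def V_def)
      qed (simp add: q0)
    qed
    finally show ?thesis using q(1) by simp
  qed
  let ?A = "2 powr (CARD('D) / 2) * exp (K\<^sup>2 / 4)"
  let ?T = "2 powr (CARD('D) / 2) * (3 * \<sigma>) * exp (- (r2 / 8)\<^sup>2 / (8 * \<sigma>\<^sup>2))"
  let ?E = "\<lambda>x. exp (- (norm (x - p))\<^sup>2 / (64 * \<sigma>\<^sup>2))"
  let ?W = "8 * \<theta> * \<sigma> + 64 * \<sigma>\<^sup>2 / \<tau>"
  have E: "integrable \<mu> ?E" "(\<integral>x. ?E x \<partial>\<mu>) \<le> C * annuli_sum d * \<sigma> ^ d"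
    using gauss_integral_ball_growth[OF sets \<sigma> C up] by auto
  note intg = integrable_gauss_density_shift[OF \<sigma>, where 'D = 'D]
  have bound: "norm (m x) \<le> ?A * ?W * ?E x + ?T" if x: "x \<in> M" for x
  proof -
    let ?\<rho> = "norm (x - p)"
    define I where "I = (\<integral>y. indicator V y *\<^sub>R (gauss_density \<sigma> (y - x) *\<^sub>R (P *v (y - x))) \<partial>lborel)"
    have i1: "integrable lborel (\<lambda>y. indicator V y *\<^sub>R (gauss_density \<sigma> (y - x) *\<^sub>R (P *v (y - p))))"
    proof (rule Bochner_Integration.integrable_bound[OF integrable_mult_right[OF intg[of x], of B]])
      have "indicator V y *\<^sub>R (gauss_density \<sigma> (y - x) * norm (P *v (y - p))) \<le> \<bar>B * gauss_density \<sigma> (y - x)\<bar>" for y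
        using VB[of y] gauss_density_nonneg[of \<sigma> "y - x"] order_trans[OF norm_ge_zero VB[of y]]
        by (cases "y \<in> V") (auto simp: abs_mult mult.commute[of B] intro!: mult_left_mono)
      then show "AE y in lborel. norm (indicator V y *\<^sub>R (gauss_density \<sigma> (y - x) *\<^sub>R (P *v (y - p))))
          \<le> norm (B * gauss_density \<sigma> (y - x))"
        by (intro AE_I2) (simp add: abs_mult abs_of_nonneg[OF gauss_density_nonneg] mult.assoc)
    qed measurable
    have i2: "integrable lborel (\<lambda>y. indicator V y * gauss_density \<sigma> (y - x))"
      using integrable_mult_indicator[OF _ intg[of x], of V] by simp
    have "I = (\<integral>y. indicator V y *\<^sub>R (gauss_density \<sigma> (y - x) *\<^sub>R (P *v (y - p)))
        - (indicator V y * gauss_density \<sigma> (y - x)) *\<^sub>R (P *v (x - p)) \<partial>lborel)"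
      unfolding I_def
    proof (intro Bochner_Integration.integral_cong refl)
      fix y
      have "P *v (y - x) = P *v (y - p) - P *v (x - p)" by (simp add: matrix_vector_mult_diff_distrib)
      then show "indicator V y *\<^sub>R (gauss_density \<sigma> (y - x) *\<^sub>R (P *v (y - x)))
          = indicator V y *\<^sub>R (gauss_density \<sigma> (y - x) *\<^sub>R (P *v (y - p)))
          - (indicator V y * gauss_density \<sigma> (y - x)) *\<^sub>R (P *v (x - p))"
        by (simp add: scaleR_diff_right)
    qed
    also have "\<dots> = m x - q x *\<^sub>R (P *v (x - p))"
      using i1 i2 by (subst Bochner_Integration.integral_diff) (auto simp: m_def q_def)
    finally have "m x = q x *\<^sub>R (P *v (x - p)) + I" by simp
    then have "norm (m x) \<le> q x * norm (P *v (x - p)) + norm I"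
      using norm_triangle_ineq[of "q x *\<^sub>R (P *v (x - p))" I] q0[of x] by simp
    also have "norm I \<le> ?T"
      unfolding I_def V_def using K by (intro window_normal_moment_le[OF P \<sigma> \<tau> z \<theta>(2) r2 K(1,2) _ r2K geo[OF x]]) simp
    also have "q x * norm (P *v (x - p)) \<le> (?A * exp (- ?\<rho>\<^sup>2 / (32 * \<sigma>\<^sup>2))) * (\<theta> * ?\<rho> + ?\<rho>\<^sup>2 / \<tau>)"
      using window_mass_upper[OF P \<sigma> \<tau> z \<theta>(2) r2 K(1,2) geo[OF x]] geo[OF x] q0[of x]
      by (intro mult_mono) (auto simp: q_def V_def)
    also have "\<dots> \<le> ?A * ?W * ?E x"
    proof -
      \<comment> \<open>One factor \<open>?E\<close> absorbs |x - p| and |x - p|^2 at the price of 8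
        \<sigma> and 64 \<sigma>^2; the other is kept for the integration over \<mu>.\<close>
      have e: "exp (- ?\<rho>\<^sup>2 / (32 * \<sigma>\<^sup>2)) = ?E x * ?E x"
        unfolding exp_add[symmetric] by simp
      have sq: "(8 * \<sigma>)\<^sup>2 = 64 * \<sigma>\<^sup>2" by (simp add: power_mult_distrib)
      have "?\<rho> * ?E x \<le> 8 * \<sigma>" using mult_exp_neg_square_le[of "8 * \<sigma>" ?\<rho>] \<sigma> unfolding sq by simp
      then have a: "\<theta> * (?\<rho> * ?E x) \<le> \<theta> * (8 * \<sigma>)" using \<theta>(1) by (rule mult_left_mono)
      have "?\<rho>\<^sup>2 * ?E x \<le> 64 * \<sigma>\<^sup>2" using square_mult_exp_neg_square_le[of "8 * \<sigma>" ?\<rho>] \<sigma> unfolding sq by simp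
      then have b: "(?\<rho>\<^sup>2 * ?E x) / \<tau> \<le> (64 * \<sigma>\<^sup>2) / \<tau>" using \<tau> by (intro divide_right_mono) auto
      have "(?A * exp (- ?\<rho>\<^sup>2 / (32 * \<sigma>\<^sup>2))) * (\<theta> * ?\<rho> + ?\<rho>\<^sup>2 / \<tau>)
          = (?A * ?E x) * (\<theta> * (?\<rho> * ?E x) + (?\<rho>\<^sup>2 * ?E x) / \<tau>)"
        unfolding e by (simp add: distrib_left distrib_right mult_ac)
      also have "\<dots> \<le> (?A * ?E x) * (\<theta> * (8 * \<sigma>) + (64 * \<sigma>\<^sup>2) / \<tau>)"
        by (rule mult_left_mono[OF add_mono[OF a b]]) simp
      finally show ?thesis by (simp add: mult_ac)
    qed
    finally show ?thesis by simp
  qed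
  have "norm (\<integral>x. m x \<partial>\<mu>) \<le> (\<integral>x. norm (m x) \<partial>\<mu>)" by (rule integral_norm_bound)
  also have "\<dots> \<le> (\<integral>x. ?A * ?W * ?E x + ?T \<partial>\<mu>)"
  proof (rule integral_mono_AE)
    show "AE x in \<mu>. norm (m x) \<le> ?A * ?W * ?E x + ?T" using M by eventually_elim (rule bound)
  qed (use m E in auto)
  also have "\<dots> = ?A * ?W * (\<integral>x. ?E x \<partial>\<mu>) + ?T * measure \<mu> UNIV"
    using E sets_eq_imp_space_eq[OF sets] by (subst Bochner_Integration.integral_add) (auto simp: mult.commute)
  also have "\<dots> \<le> ?A * ?W * (C * annuli_sum d * \<sigma> ^ d) + ?T * measure \<mu> UNIV"
    using E(2) \<theta> \<sigma> \<tau> by (intro add_right_mono mult_left_mono) auto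
  finally show "norm (\<integral>y. indicator V y *\<^sub>R (G y *\<^sub>R (P *v (y - p))) \<partial>lborel)
      \<le> ?A * ?W * (C * annuli_sum d * \<sigma> ^ d) + ?T * measure \<mu> UNIV" using m(1) by simp
qed

text \<open>The weights \<open>G y / Q\<close> integrate to 1 over \<open>V\<close>, so adding z - p
  to the mean of y - z recentres it at \<open>p\<close>; \<open>P\<close> is linear and passes under
  the integral.\<close>

lemma projected_mean_shift:
  fixes \<mu> :: "(real^'D::finite) measure" and P :: "real^'D^'D" and \<sigma> :: real
  assumes fin: "finite_measure \<mu>" and sets[measurable_cong]: "sets \<mu> = sets borel"
    and V[measurable]: "V \<in> sets borel" and Vb: "bounded V"
  defines "G \<equiv> \<lambda>y. \<integral>x. gauss_density \<sigma> (y - x) \<partial>\<mu>"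
  assumes Q: "Q = (\<integral>y. indicator V y * G y \<partial>lborel)" "Q \<noteq> 0"
  shows "P *v (z - p) + P *v ((1 / Q) *\<^sub>R (\<integral>y. indicator V y *\<^sub>R (G y *\<^sub>R (y - z)) \<partial>lborel))
    = (1 / Q) *\<^sub>R (\<integral>y. indicator V y *\<^sub>R (G y *\<^sub>R (P *v (y - p))) \<partial>lborel)"
proof -
  interpret finite_measure \<mu> by (rule fin)
  have [measurable]: "G \<in> borel_measurable borel" unfolding G_def by measurable
  obtain B where B: "\<And>y. y \<in> V \<Longrightarrow> norm y \<le> B" using Vb by (auto simp: bounded_iff)
  let ?g = "(2 * pi * \<sigma>\<^sup>2) powr (- real CARD('D) / 2)"
  have G: "\<bar>G y\<bar> \<le> ?g * measure \<mu> UNIV" for y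
  proof -
    have "norm (G y) \<le> (\<integral>x. norm (gauss_density \<sigma> (y - x)) \<partial>\<mu>)" unfolding G_def by (rule integral_norm_bound)
    also have "\<dots> \<le> (\<integral>x. ?g \<partial>\<mu>)"
      by (rule integral_mono_AE') (auto simp only: real_norm_def abs_of_nonneg[OF gauss_density_nonneg] gauss_density_le
          intro!: AE_I2 finite_measure.integrable_const[OF fin], simp)
    also have "\<dots> = ?g * measure \<mu> UNIV" using sets_eq_imp_space_eq[OF sets] by simp
    finally show ?thesis by simp
  qed
  have fV: "emeasure lborel V < \<infinity>" using Vb by (rule emeasure_bounded_finite)
  have int: "integrable lborel (\<lambda>y. indicator V y *\<^sub>R (G y *\<^sub>R (y - a)))" for a
  proof (rule integrableI_bounded_set_indicator[OF _ _ fV])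
    show "AE y in lborel. y \<in> V \<longrightarrow> norm (G y *\<^sub>R (y - a)) \<le> (?g * measure \<mu> UNIV) * (B + norm a)"
    proof (rule AE_I2, safe)
      fix y assume "y \<in> V"
      then have "norm (y - a) \<le> B + norm a" using B norm_triangle_ineq4[of y a] by (meson add_right_mono order_trans)
      then have "\<bar>G y\<bar> * norm (y - a) \<le> (?g * measure \<mu> UNIV) * (B + norm a)"
        using G[of y] by (intro mult_mono) auto
      then show "norm (G y *\<^sub>R (y - a)) \<le> (?g * measure \<mu> UNIV) * (B + norm a)" by simp
    qed
  qed auto
  have intG: "integrable lborel (\<lambda>y. indicator V y *\<^sub>R G y)"
    by (rule integrableI_bounded_set_indicator[OF _ _ fV, where B = "?g * measure \<mu> UNIV"]) (use G in auto)
  have bl: "bounded_linear ((*v) P)" by (rule matrix_vector_mul_bounded_linear)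
  have "Q *\<^sub>R (z - p) + (\<integral>y. indicator V y *\<^sub>R (G y *\<^sub>R (y - z)) \<partial>lborel)
      = (\<integral>y. (indicator V y *\<^sub>R G y) *\<^sub>R (z - p) + indicator V y *\<^sub>R (G y *\<^sub>R (y - z)) \<partial>lborel)"
    using intG int[of z] by (subst Bochner_Integration.integral_add) (auto simp: Q(1))
  also have "\<dots> = (\<integral>y. indicator V y *\<^sub>R (G y *\<^sub>R (y - p)) \<partial>lborel)"
    by (intro Bochner_Integration.integral_cong refl) (simp add: algebra_simps)
  finally have "P *v (Q *\<^sub>R (z - p) + (\<integral>y. indicator V y *\<^sub>R (G y *\<^sub>R (y - z)) \<partial>lborel))
      = (\<integral>y. P *v (indicator V y *\<^sub>R (G y *\<^sub>R (y - p))) \<partial>lborel)"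
    using integral_bounded_linear[OF bl int[of p]] by simp
  also have "\<dots> = (\<integral>y. indicator V y *\<^sub>R (G y *\<^sub>R (P *v (y - p))) \<partial>lborel)"
    by (simp add: matrix_vector_mult_scaleR)
  finally have "(1 / Q) *\<^sub>R (P *v (Q *\<^sub>R (z - p) + (\<integral>y. indicator V y *\<^sub>R (G y *\<^sub>R (y - z)) \<partial>lborel)))
      = (1 / Q) *\<^sub>R (\<integral>y. indicator V y *\<^sub>R (G y *\<^sub>R (P *v (y - p))) \<partial>lborel)" by simp
  then show ?thesis using Q(2) by (simp add: matrix_vector_right_distrib matrix_vector_mult_scaleR scaleR_add_right)
qed

section \<open>The main estimate\<close>

theorem theorem4p2:
  fixes M :: "(real^'D) set" and V \<tau> :: real
  assumes "C2_submanifold TYPE('d::finite) M" and "compact M" and "M \<noteq> {}"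
    and "\<tau> > 0" and "reach_ge M \<tau>"
    and "emeasure (hausdorff_measure CARD('d)) M \<le> ennreal V"
  shows "\<forall>\<kappa> c1 c2 Cz. 0 < \<kappa> \<and> \<kappa> \<le> 1 \<and> 0 < c1 \<and> c1 < 1 \<and> 0 < c2 \<and> c2 < 1 \<and> 1 < Cz \<longrightarrow>
    (\<exists>C0>1. \<forall>C2\<ge>C0. \<exists>C'>0. \<exists>\<sigma>0>0. \<forall>\<sigma> z Ph.
       0 < \<sigma> \<and> \<sigma> < \<sigma>0 \<and> infdist z M < Cz * \<sigma> \<and> orth_proj Ph \<and>
       frob_norm (Ph - normal_proj TYPE('d) M (proj_onto M z)) \<le> c2 * \<sigma> powr \<kappa> \<longrightarrow>
       infdist (z + Ph *v cond_mean_shift (noisy_density TYPE('d) M \<sigma>)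
                          (window Ph z (c1 * \<sigma>) (C2 * \<sigma> * sqrt (ln (1 / \<sigma>)))) z) M
         \<le> C' * \<sigma> powr (1 + \<kappa>) * sqrt (ln (1 / \<sigma>)))"
proof (intro allI impI, elim conjE)
  fix \<kappa> c1 c2 Cz :: real
  assume \<kappa>: "0 < \<kappa>" "\<kappa> \<le> 1" and c1: "0 < c1" "c1 < 1" and c2: "0 < c2" "c2 < 1" and Cz: "1 < Cz"
  let ?d = "CARD('d)" and ?D = "CARD('D)"
  let ?H = "hausdorff_measure ?d :: (real^'D) measure"
  define m0 where "m0 = measure ?H M"
  have Mb[measurable]: "M \<in> sets borel" using assms(2) by (simp add: borel_compact)
  have HM: "hausdorff_outer ?d M = emeasure ?H M" using Mb by (simp add: emeasure_hausdorff_measure)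
  then have finM: "hausdorff_outer ?d M < top" using assms(6) by (simp add: le_less_trans)
  obtain c C r0 where c: "c > 0" and C: "C > 0" and r0: "r0 > 0"
    and low: "\<And>x r. x \<in> M \<Longrightarrow> 0 < r \<Longrightarrow> r \<le> r0 \<Longrightarrow>
        ennreal (c * r ^ ?d) \<le> hausdorff_outer ?d (M \<inter> ball x r)"
    and up: "\<And>x r. x \<in> M \<Longrightarrow> 0 < r \<Longrightarrow> hausdorff_outer ?d (M \<inter> ball x r) \<le> ennreal (C * r ^ ?d)"
    using submanifold_volume_bounds[OF assms(1,2) finM] by metis
  \<comment> \<open>Restricted to \<open>M\<close> the measure is finite, as Fubini's theorem
    requires; \<open>?H\<close> itself is not even sigma-finite when d < D.\<close>
  define \<mu> where "\<mu> = density ?H (\<lambda>x. ennreal (indicator M x))"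
  have sets\<mu>[measurable_cong, simp]: "sets \<mu> = sets borel" by (simp add: \<mu>_def)
  have em: "emeasure \<mu> A = hausdorff_outer ?d (M \<inter> A)" if [measurable]: "A \<in> sets borel" for A
  proof -
    have "emeasure \<mu> A = (\<integral>\<^sup>+x. ennreal (indicator M x) * indicator A x \<partial>?H)"
      unfolding \<mu>_def by (rule emeasure_density) auto
    also have "\<dots> = (\<integral>\<^sup>+x. indicator (M \<inter> A) x \<partial>?H)"
      by (intro nn_integral_cong) (simp add: indicator_def)
    also have "\<dots> = emeasure ?H (M \<inter> A)" by (rule nn_integral_indicator) simp
    finally show ?thesis by (simp add: emeasure_hausdorff_measure)
  qed
  have fin: "finite_measure \<mu>"
    by (rule finite_measureI) (use em[of UNIV] finM in \<open>simp add: \<mu>_def less_top\<close>)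
  interpret finite_measure \<mu> by (rule fin)
  have AEM: "AE x in \<mu>. x \<in> M"
    unfolding \<mu>_def by (subst AE_density) (auto simp: indicator_def)
  have m\<mu>: "measure \<mu> UNIV = m0"
    using em[of UNIV] by (simp add: measure_def m0_def HM)
  have m0: "m0 > 0"
  proof -
    obtain x where x: "x \<in> M" using assms(3) by blast
    have "0 < ennreal (c * r0 ^ ?d)" using c r0 by simp
    also have "\<dots> \<le> hausdorff_outer ?d (M \<inter> ball x r0)" using low[OF x r0] by simp
    also have "\<dots> \<le> emeasure ?H M" unfolding HM[symmetric] by (rule hausdorff_outer_mono) simp
    finally show ?thesis using finM HM unfolding m0_def measure_def
      by (simp add: enn2real_positive_iff)
  qed
  have nd: "noisy_density TYPE('d) M \<sigma> y = (\<integral>x. gauss_density \<sigma> (y - x) \<partial>\<mu>) / m0" for \<sigma> y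
  proof -
    have "(\<integral>x. gauss_density \<sigma> (y - x) \<partial>\<mu>) = (\<integral>x. indicator M x *\<^sub>R gauss_density \<sigma> (y - x) \<partial>?H)"
      unfolding \<mu>_def by (rule integral_density) auto
    then show ?thesis by (simp add: noisy_density_def set_lebesgue_integral_def m0_def)
  qed
  define K where "K = Cz + c1"
  have K: "K > 1" using Cz c1 by (simp add: K_def)
  define q0 where "q0 = (2 * pi) powr (- real ?D / 2) * exp (- (K + 1)\<^sup>2 / 2) * unit_ball_vol ?D * c1 ^ ?D"
  have q0: "q0 > 0" unfolding q0_def using c1 unit_ball_vol_pos[of ?D] by simp
  define A where "A = 2 powr (real ?D / 2) * exp (K\<^sup>2 / 4)"
  \<comment> \<open>Constants of the upper bound for the moment over the constant
    \<open>q0 * c\<close> of the lower bound for the mass, after the common factor \<sigma>^d has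
    been removed. Neither \<sigma> nor \<open>C2\<close> occurs in it.\<close>
  define E where "E = (A * (8 + 64 / \<tau>) * (C * annuli_sum ?d) + 2 powr (real ?D / 2) * 3 * m0) / (q0 * c)"
  have A0: "A > 0" by (simp add: A_def)
  have E0: "E \<ge> 0" unfolding E_def
    using A0 C c q0 m0 assms(4) annuli_sum_nonneg[of ?d] by (intro divide_nonneg_nonneg add_nonneg_nonneg mult_nonneg_nonneg) auto
  show "\<exists>C0>1. \<forall>C2\<ge>C0. \<exists>C'>0. \<exists>\<sigma>0>0. \<forall>\<sigma> z Ph.
       0 < \<sigma> \<and> \<sigma> < \<sigma>0 \<and> infdist z M < Cz * \<sigma> \<and> orth_proj Ph \<and>
       frob_norm (Ph - normal_proj TYPE('d) M (proj_onto M z)) \<le> c2 * \<sigma> powr \<kappa> \<longrightarrow>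
       infdist (z + Ph *v cond_mean_shift (noisy_density TYPE('d) M \<sigma>)
                          (window Ph z (c1 * \<sigma>) (C2 * \<sigma> * sqrt (ln (1 / \<sigma>)))) z) M
         \<le> C' * \<sigma> powr (1 + \<kappa>) * sqrt (ln (1 / \<sigma>))"
  \<comment> \<open>The tail exponent (r2/8)^2 / (8 \<sigma>^2) equals C2^2/512 times
    ln(1/\<sigma>), and C2^2/512 \<ge> d + 1 makes the tail at most \<sigma>^(d+1). A bound on
    \<open>C2\<close> itself suffices since \<open>C2\<close> is at most its square.\<close>
  proof (rule exI[of _ "512 * (real ?d + 1)"], intro conjI allI impI)
    show "1 < 512 * (real ?d + 1)" by simp
    fix C2 :: real assume C2: "512 * (real ?d + 1) \<le> C2"
    have C2pos: "C2 > 1" using C2 by (smt (verit) of_nat_0_le_iff)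
    \<comment> \<open>In order, the entries give: the range of the lower volume bound;
      \<open>L \<ge> 12 * K\<close>, from which both lower bounds on \<open>r2\<close> follow;
      \<open>r2 \<le> \<tau> / 8\<close>; and \<open>\<theta> \<le> 1/4\<close>.\<close>
    define \<sigma>0 where "\<sigma>0 = Min {r0, exp (- (12 * K)\<^sup>2), (\<tau> / (8 * C2))\<^sup>2, (1/4) powr (1 / \<kappa>)}"
    have \<sigma>0: "\<sigma>0 > 0" using r0 assms(4) C2pos by (simp add: \<sigma>0_def)
    show "\<exists>C'>0. \<exists>\<sigma>0>0. \<forall>\<sigma> z Ph.
       0 < \<sigma> \<and> \<sigma> < \<sigma>0 \<and> infdist z M < Cz * \<sigma> \<and> orth_proj Ph \<and>
       frob_norm (Ph - normal_proj TYPE('d) M (proj_onto M z)) \<le> c2 * \<sigma> powr \<kappa> \<longrightarrow>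
       infdist (z + Ph *v cond_mean_shift (noisy_density TYPE('d) M \<sigma>)
                          (window Ph z (c1 * \<sigma>) (C2 * \<sigma> * sqrt (ln (1 / \<sigma>)))) z) M
         \<le> C' * \<sigma> powr (1 + \<kappa>) * sqrt (ln (1 / \<sigma>))"
    proof (rule exI[of _ "Cz + E"], intro conjI, goal_cases)
      case 1
      then show ?case using Cz E0 by simp
    next
      case 2
      show ?case
      proof (rule exI[of _ \<sigma>0], intro conjI allI impI, rule \<sigma>0, elim conjE)
        fix \<sigma> :: real and z :: "real^'D" and Ph :: "real^'D^'D"
        assume \<sigma>: "0 < \<sigma>" "\<sigma> < \<sigma>0" and z: "infdist z M < Cz * \<sigma>" and P: "orth_proj Ph"
          and Pn: "frob_norm (Ph - normal_proj TYPE('d) M (proj_onto M z)) \<le> c2 * \<sigma> powr \<kappa>"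
        define p where "p = proj_onto M z"
        let ?N = "normal_proj TYPE('d) M p"
        have p: "p \<in> M" "dist z p = infdist z M" using proj_onto[OF assms(2,3)] by (auto simp: p_def)
        have zp: "norm (z - p) \<le> Cz * \<sigma>" using z p by (simp add: dist_norm)
        define L where "L = sqrt (ln (1 / \<sigma>))"
        define r2 where "r2 = C2 * \<sigma> * L"
        have s1: "\<sigma> < r0" "\<sigma> < exp (- (12 * K)\<^sup>2)" "\<sigma> < (\<tau> / (8 * C2))\<^sup>2" "\<sigma> < (1/4) powr (1 / \<kappa>)"
          using \<sigma> by (auto simp: \<sigma>0_def)
        have "ln \<sigma> < - (12 * K)\<^sup>2" using s1(2) \<sigma> by (metis ln_exp ln_less_cancel_iff exp_gt_zero)
        then have lnK: "(12 * K)\<^sup>2 < ln (1 / \<sigma>)" using \<sigma> by (simp add: ln_div)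
        then have ln0: "0 \<le> ln (1 / \<sigma>)" using zero_le_power2[of "12 * K"] by linarith
        have L12: "12 * K \<le> L" unfolding L_def using K lnK by (intro real_le_rsqrt) simp
        have L1: "L \<ge> 1" using L12 K by linarith
        have Lsq: "L\<^sup>2 = ln (1 / \<sigma>)" unfolding L_def using ln0 by simp
        have \<sigma>1: "\<sigma> < 1"
        proof -
          have "exp (- (12 * K)\<^sup>2) \<le> 1" by simp
          then show ?thesis using s1(2) by linarith
        qed
        have r2\<tau>: "r2 \<le> \<tau> / 8"
        proof -
          \<comment> \<open>The crude bound ln(1/\<sigma>) \<le> 1/\<sigma> gives (\<sigma> L)^2
            \<le> \<sigma>, which explains the square in the third entry of
            \<open>\<sigma>0\<close>.\<close>
          have "ln (1 / \<sigma>) \<le> 1 / \<sigma> - 1" using \<sigma> by (intro ln_le_minus_one) simp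
          then have "\<sigma>\<^sup>2 * ln (1 / \<sigma>) \<le> \<sigma>\<^sup>2 * (1 / \<sigma>)" using \<sigma> by (intro mult_left_mono) auto
          moreover have "\<sigma>\<^sup>2 * (1 / \<sigma>) = \<sigma>" using \<sigma> by (simp add: power2_eq_square)
          ultimately have "(\<sigma> * L)\<^sup>2 \<le> \<sigma>" by (simp only: power_mult_distrib Lsq)
          then have "(\<sigma> * L)\<^sup>2 \<le> (\<tau> / (8 * C2))\<^sup>2" using s1(3) by linarith
          then have "\<sigma> * L \<le> \<tau> / (8 * C2)" by (rule power2_le_imp_le) (use assms(4) C2pos in simp)
          then show ?thesis using C2pos by (simp add: r2_def field_simps)
        qed
        have r2K: "12 * K * \<sigma> \<le> r2"
        proof -
          have "12 * K * \<sigma> \<le> L * \<sigma>" using L12 \<sigma> by (intro mult_right_mono) auto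
          also have "\<dots> \<le> C2 * (L * \<sigma>)" using C2pos L1 \<sigma> by simp
          finally show ?thesis by (simp add: r2_def mult_ac)
        qed
        have r21: "c1 * \<sigma> \<le> r2"
        proof -
          have "c1 * \<sigma> \<le> 12 * K * \<sigma>" using c1 K \<sigma> by (intro mult_right_mono) auto
          then show ?thesis using r2K by linarith
        qed
        define \<theta> where "\<theta> = c2 * \<sigma> powr \<kappa>"
        have \<sigma>\<kappa>: "\<sigma> powr \<kappa> \<le> 1/4"
        proof -
          have "\<sigma> powr \<kappa> \<le> ((1/4) powr (1 / \<kappa>)) powr \<kappa>" using s1(4) \<sigma> \<kappa> by (intro powr_mono2) auto
          then show ?thesis using \<kappa> by (simp add: powr_powr)
        qed
        have \<theta>: "0 \<le> \<theta>" "\<theta> \<le> 1/4" "\<theta> \<le> \<sigma> powr \<kappa>"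
        proof -
          show "0 \<le> \<theta>" using c2 by (simp add: \<theta>_def)
          show "\<theta> \<le> \<sigma> powr \<kappa>" using c2 unfolding \<theta>_def by (simp add: mult_left_le_one_le)
          then show "\<theta> \<le> 1/4" using \<sigma>\<kappa> by linarith
        qed
        have PN: "norm ((Ph - ?N) *v x) \<le> \<theta> * norm x" for x
        proof -
          have "norm ((Ph - ?N) *v x) \<le> norm (Ph - ?N) * norm x" by (rule norm_matrix_vector_mult_le)
          also have "\<dots> \<le> \<theta> * norm x" using Pn by (intro mult_right_mono) (auto simp: \<theta>_def p_def frob_norm_eq_norm)
          finally show ?thesis .
        qed
        have geo: "norm (Ph *v (x - p)) \<le> \<theta> * norm (x - p) + (norm (x - p))\<^sup>2 / \<tau>" if x: "x \<in> M" for x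
        proof -
          have "Ph *v (x - p) = (Ph - ?N) *v (x - p) + ?N *v (x - p)" by (simp add: matrix_vector_mult_diff_rdistrib)
          then have "norm (Ph *v (x - p)) \<le> norm ((Ph - ?N) *v (x - p)) + norm (?N *v (x - p))"
            by (metis norm_triangle_ineq)
          then show ?thesis using PN[of "x - p"] normal_proj_diff_le[OF assms(1,2,5,4) p(1) x] by linarith
        qed
        let ?V = "window Ph z (c1 * \<sigma>) r2"
        define G where "G y = (\<integral>x. gauss_density \<sigma> (y - x) \<partial>\<mu>)" for y
        define Q where "Q = (\<integral>y. indicator ?V y * G y \<partial>lborel)"
        define S where "S = (\<integral>y. indicator ?V y *\<^sub>R (G y *\<^sub>R (Ph *v (y - p))) \<partial>lborel)"
        have Vb: "bounded ?V"
          by (rule bounded_subset[OF bounded_cball[of z "c1 * \<sigma> + r2"]])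
            (use window_dist_le in \<open>auto simp: dist_norm norm_minus_commute\<close>)
        have up\<mu>: "emeasure \<mu> (ball p r) \<le> ennreal (C * r ^ ?d)" if "r > 0" for r
          using up[OF p(1) that] by (simp add: em)
        have K0: "K = Cz + c1" "K > 0" "c1 > 0" using K c1 by (auto simp: K_def)
        note est = window_convolution_estimates[OF fin sets\<mu> AEM P \<sigma>(1) assms(4) zp \<theta>(1,2) r2\<tau> K0 r2K r21 geo
            less_imp_le[OF C] up\<mu>]
        have "c * \<sigma> ^ ?d \<le> measure \<mu> (ball p \<sigma>)"
        proof -
          have "ennreal (c * \<sigma> ^ ?d) \<le> ennreal (measure \<mu> (ball p \<sigma>))"
            using low[OF p(1) \<sigma>(1)] s1(1) em[of "ball p \<sigma>"] by (simp add: emeasure_eq_measure)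
          then show ?thesis by (simp add: measure_nonneg)
        qed
        then have "q0 * (c * \<sigma> ^ ?d) \<le> q0 * measure \<mu> (ball p \<sigma>)" using q0 by simp
        also have "\<dots> \<le> Q" using est(1) unfolding q0_def Q_def G_def by simp
        finally have Q: "q0 * c * \<sigma> ^ ?d \<le> Q" by (simp add: mult.assoc)
        have Qpos: "Q > 0" using Q q0 c \<sigma> by (smt (verit) mult_pos_pos zero_less_power)
        have T: "exp (- (r2 / 8)\<^sup>2 / (8 * \<sigma>\<^sup>2)) \<le> \<sigma> ^ (?d + 1)"
        proof -
          have "(r2 / 8)\<^sup>2 / (8 * \<sigma>\<^sup>2) = C2\<^sup>2 / 512 * ln (1 / \<sigma>)"
            using \<sigma> by (simp add: r2_def power_mult_distrib power_divide Lsq)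
          moreover have "real (?d + 1) \<le> C2\<^sup>2 / 512"
          proof -
            have "C2 \<le> C2\<^sup>2" using C2pos by (simp add: power2_eq_square)
            then show ?thesis using C2 by simp
          qed
          then have "real (?d + 1) * ln (1 / \<sigma>) \<le> C2\<^sup>2 / 512 * ln (1 / \<sigma>)"
            using ln0 by (intro mult_right_mono)
          ultimately have "- (r2 / 8)\<^sup>2 / (8 * \<sigma>\<^sup>2) \<le> real (?d + 1) * ln \<sigma>" using \<sigma> by (simp add: ln_div)
          then have "exp (- (r2 / 8)\<^sup>2 / (8 * \<sigma>\<^sup>2)) \<le> exp (real (?d + 1) * ln \<sigma>)" by simp
          also have "\<dots> = \<sigma> ^ (?d + 1)" using \<sigma> by (simp only: exp_of_nat_mult exp_ln)
          finally show ?thesis .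
        qed
        \<comment> \<open>The curvature term and the noise term are of order \<sigma>^2; they are
          absorbed because \<kappa> \<le> 1.\<close>
        have \<sigma>2: "\<sigma>\<^sup>2 \<le> \<sigma> powr (1 + \<kappa>)"
        proof -
          have "\<sigma>\<^sup>2 = \<sigma> powr 2" using \<sigma> by simp
          also have "\<dots> \<le> \<sigma> powr (1 + \<kappa>)" using \<sigma> \<sigma>1 \<kappa> by (intro powr_mono') auto
          finally show ?thesis .
        qed
        have \<theta>\<sigma>: "\<theta> * \<sigma> \<le> \<sigma> powr (1 + \<kappa>)"
        proof -
          have "\<theta> * \<sigma> \<le> \<sigma> powr \<kappa> * \<sigma>" using \<theta> \<sigma> by (intro mult_right_mono) auto
          also have "\<dots> = \<sigma> powr (1 + \<kappa>)" using \<sigma> by (simp add: powr_add mult.commute)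
          finally show ?thesis .
        qed
        have "norm S \<le> A * (8 * \<theta> * \<sigma> + 64 * \<sigma>\<^sup>2 / \<tau>) * (C * annuli_sum ?d * \<sigma> ^ ?d)
            + 2 powr (real ?D / 2) * (3 * \<sigma>) * exp (- (r2 / 8)\<^sup>2 / (8 * \<sigma>\<^sup>2)) * m0"
          using est(2) unfolding S_def G_def A_def m\<mu> by simp
        also have "\<dots> \<le> A * ((8 + 64 / \<tau>) * \<sigma> powr (1 + \<kappa>)) * (C * annuli_sum ?d * \<sigma> ^ ?d)
            + 2 powr (real ?D / 2) * (3 * \<sigma>) * \<sigma> ^ (?d + 1) * m0"
        proof (intro add_mono mult_right_mono mult_left_mono T)
          have "64 * \<sigma>\<^sup>2 / \<tau> \<le> 64 * \<sigma> powr (1 + \<kappa>) / \<tau>"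
            using \<sigma>2 assms(4) by (intro divide_right_mono) auto
          then show "8 * \<theta> * \<sigma> + 64 * \<sigma>\<^sup>2 / \<tau> \<le> (8 + 64 / \<tau>) * \<sigma> powr (1 + \<kappa>)"
            using \<theta>\<sigma> by (simp add: algebra_simps)
        qed (use A0 C \<sigma> m0 annuli_sum_nonneg[of ?d] in auto)
        \<comment> \<open>The tail \<sigma>^(d+1) and the factor 3 \<sigma> in front of it combine
          to 3 \<sigma>^2 \<sigma>^d, so that \<sigma>^d comes out of both terms and can be matched
          with the lower bound for \<open>Q\<close>.\<close>
        also have "\<dots> = (A * (8 + 64 / \<tau>) * (C * annuli_sum ?d) * \<sigma> powr (1 + \<kappa>)
            + 2 powr (real ?D / 2) * 3 * m0 * \<sigma>\<^sup>2) * \<sigma> ^ ?d"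
          by (simp add: algebra_simps power2_eq_square)
        also have "\<dots> \<le> (A * (8 + 64 / \<tau>) * (C * annuli_sum ?d) * \<sigma> powr (1 + \<kappa>)
            + 2 powr (real ?D / 2) * 3 * m0 * \<sigma> powr (1 + \<kappa>)) * \<sigma> ^ ?d"
          using \<sigma>2 m0 \<sigma> by (intro mult_right_mono add_left_mono mult_left_mono) auto
        also have "\<dots> = E * \<sigma> powr (1 + \<kappa>) * (q0 * c * \<sigma> ^ ?d)"
          using q0 c unfolding E_def by (simp add: field_simps)
        also have "\<dots> \<le> E * \<sigma> powr (1 + \<kappa>) * Q" using Q E0 by (intro mult_left_mono) auto
        finally have S: "norm ((1 / Q) *\<^sub>R S) \<le> E * \<sigma> powr (1 + \<kappa>)"
          using Qpos by (simp add: field_simps)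
        \<comment> \<open>The normalising volume \<open>m0\<close> appears in numerator and
          denominator and cancels, which leaves the unnormalised \<open>G\<close>.\<close>
        have cm: "cond_mean_shift (noisy_density TYPE('d) M \<sigma>) ?V z
            = (1 / Q) *\<^sub>R (\<integral>y. indicator ?V y *\<^sub>R (G y *\<^sub>R (y - z)) \<partial>lborel)"
        proof -
          have "(LINT y:?V|lborel. noisy_density TYPE('d) M \<sigma> y) = (\<integral>y. (1 / m0) * (indicator ?V y * G y) \<partial>lborel)"
            unfolding set_lebesgue_integral_def by (intro Bochner_Integration.integral_cong) (simp_all add: nd G_def)
          then have 1: "(LINT y:?V|lborel. noisy_density TYPE('d) M \<sigma> y) = Q / m0" by (simp add: Q_def)
          have "(LINT y:?V|lborel. noisy_density TYPE('d) M \<sigma> y *\<^sub>R (y - z))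
              = (\<integral>y. (1 / m0) *\<^sub>R (indicator ?V y *\<^sub>R (G y *\<^sub>R (y - z))) \<partial>lborel)"
            unfolding set_lebesgue_integral_def by (intro Bochner_Integration.integral_cong) (simp_all add: nd G_def)
          then have 2: "(LINT y:?V|lborel. noisy_density TYPE('d) M \<sigma> y *\<^sub>R (y - z))
              = (1 / m0) *\<^sub>R (\<integral>y. indicator ?V y *\<^sub>R (G y *\<^sub>R (y - z)) \<partial>lborel)" by (simp only: integral_scaleR_right)
          show ?thesis unfolding cond_mean_shift_def 1 2 using m0 by simp
        qed
        have shift: "Ph *v (z - p) + Ph *v cond_mean_shift (noisy_density TYPE('d) M \<sigma>) ?V z = (1 / Q) *\<^sub>R S"
          unfolding cm S_def G_def
          using Qpos by (intro projected_mean_shift[OF fin sets\<mu> window_borel Vb]) (auto simp: Q_def G_def)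
        let ?w = "z + Ph *v cond_mean_shift (noisy_density TYPE('d) M \<sigma>) ?V z"
        have "?N *v (z - p) = z - p"
          by (rule normal_proj_fixes[OF nearest_point_normal[OF p]])
        then have "?w - p = - ((Ph - ?N) *v (z - p)) + (Ph *v (z - p) + Ph *v cond_mean_shift (noisy_density TYPE('d) M \<sigma>) ?V z)"
          by (simp add: matrix_vector_mult_diff_rdistrib)
        then have "norm (?w - p) \<le> norm ((Ph - ?N) *v (z - p)) + norm ((1 / Q) *\<^sub>R S)"
          unfolding shift by (metis norm_triangle_ineq norm_minus_cancel)
        also have "norm ((Ph - ?N) *v (z - p)) \<le> \<theta> * (Cz * \<sigma>)"
          using PN[of "z - p"] mult_left_mono[OF zp \<theta>(1)] by linarith
        also have "\<theta> * (Cz * \<sigma>) \<le> Cz * \<sigma> powr (1 + \<kappa>)" using \<theta>\<sigma> Cz by (simp add: mult.left_commute)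
        also note S
        finally have w: "norm (?w - p) \<le> (Cz + E) * \<sigma> powr (1 + \<kappa>)" by (simp add: algebra_simps)
        have "infdist ?w M \<le> norm (?w - p)" using infdist_le[OF p(1), of ?w] by (simp add: dist_norm)
        also note w
        \<comment> \<open>The estimate has no logarithm up to this point; \<open>L \<ge> 1\<close>
          lets the factor be put in.\<close>
        also have "(Cz + E) * \<sigma> powr (1 + \<kappa>) \<le> (Cz + E) * \<sigma> powr (1 + \<kappa>) * L"
          using mult_left_mono[OF L1, of "(Cz + E) * \<sigma> powr (1 + \<kappa>)"] Cz E0 by simp
        finally show "infdist (z + Ph *v cond_mean_shift (noisy_density TYPE('d) M \<sigma>)
                          (window Ph z (c1 * \<sigma>) (C2 * \<sigma> * sqrt (ln (1 / \<sigma>)))) z) M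
         \<le> (Cz + E) * \<sigma> powr (1 + \<kappa>) * sqrt (ln (1 / \<sigma>))"
          unfolding r2_def L_def .
      qed
    qed
  qed
qed

end
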